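(* For every $q\ge 3$ and every constant $\delta$ there exists $\epsilon>0$ with the following property: for every constant $\sigma$, every instance $(G,L)$ of List $q$-Coloring with $n$ vertices, given with a $(\sigma,\delta)$-hub of size $p$, can be solved in time $(q-\epsilon)^p\cdot n^{\mathcal{O}(1)}$.
   Context: For a graph $G$, a set $Q\subseteq V(G)$ is a $(\sigma,\delta)$-hub if every connected component of $G-Q$ has at most $\sigma$ vertices and is adjacent to at most $\delta$ vertices of $Q$. List $q$-Coloring: given a graph $G$ and lists $L:V(G)\to 2^{\{1,\dots,q\}}$, decide whether there is a proper coloring $\phi$ of $G$ with $\phi(v)\in L(v)$ for all $v$. *)

theory Defs
  imports Complex_Main "HOL-Library.Log_Nat"
begin

section \<open>Graphs, hubs and list colorings\<close>

record 'a graph =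
  verts :: "'a set"
  edges :: "'a set set"

definition simple_graph :: "'a graph \<Rightarrow> bool" where
  "simple_graph G \<longleftrightarrow> finite (verts G) \<and> (\<forall>e\<in>edges G. e \<subseteq> verts G \<and> card e = 2)"

definition delete_verts :: "'a graph \<Rightarrow> 'a set \<Rightarrow> 'a graph" where
  "delete_verts G Q = \<lparr>verts = verts G - Q, edges = {e \<in> edges G. e \<inter> Q = {}}\<rparr>"

definition connected_rel :: "'a graph \<Rightarrow> ('a \<times> 'a) set" where
  "connected_rel G = {(u, v). {u, v} \<in> edges G}\<^sup>* \<inter> verts G \<times> verts G"

definition components :: "'a graph \<Rightarrow> 'a set set" where
  "components G = verts G // connected_rel G"

definition hub :: "nat \<Rightarrow> nat \<Rightarrow> 'a graph \<Rightarrow> 'a set \<Rightarrow> bool" where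
  "hub \<sigma> \<delta> G Q \<longleftrightarrow> Q \<subseteq> verts G \<and>
     (\<forall>C\<in>components (delete_verts G Q).
        card C \<le> \<sigma> \<and> card {x\<in>Q. \<exists>c\<in>C. {c, x} \<in> edges G} \<le> \<delta>)"

definition list_coloring_instance :: "nat \<Rightarrow> 'a graph \<Rightarrow> ('a \<Rightarrow> nat set) \<Rightarrow> bool" where
  "list_coloring_instance q G L \<longleftrightarrow> simple_graph G \<and> (\<forall>v\<in>verts G. L v \<subseteq> {1..q})"

definition list_colorable :: "'a graph \<Rightarrow> ('a \<Rightarrow> nat set) \<Rightarrow> bool" where
  "list_colorable G L \<longleftrightarrow>
     (\<exists>\<phi>. (\<forall>v\<in>verts G. \<phi> v \<in> L v) \<and> (\<forall>u v. {u, v} \<in> edges G \<longrightarrow> \<phi> u \<noteq> \<phi> v))"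


section \<open>Random access machines with logarithmic cost\<close>

text \<open>
  The random access machine of Cook and Reckhow: registers \<open>X\<^sub>0, X\<^sub>1, \<dots>\<close> hold natural numbers
  (subtraction is truncated) and are initially 0, and the input is a read-only sequence of natural
  numbers consumed from left to right. Under the logarithmic cost criterion an instruction costs
  the total bit length of the numbers and indirect addresses it handles.
\<close>

datatype instr =
    Const nat nat
  | Add nat nat nat
  | Sub nat nat nat
  | Load nat nat
  | Store nat nat
  | Jpos nat nat
  | Read nat

record config =
  pc :: nat
  regs :: "nat \<Rightarrow> nat"
  inp :: "nat list"

definition init_config :: "nat list \<Rightarrow> config" where
  "init_config xs = \<lparr>pc = 0, regs = (\<lambda>_. 0), inp = xs\<rparr>"

definition next_input :: "nat list \<Rightarrow> nat" where
  "next_input xs = (case xs of [] \<Rightarrow> 0 | x # _ \<Rightarrow> x)"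

fun step :: "instr \<Rightarrow> config \<Rightarrow> config" where
  "step (Const i c) s = s\<lparr>pc := pc s + 1, regs := (regs s)(i := c)\<rparr>"
| "step (Add i j k) s = s\<lparr>pc := pc s + 1, regs := (regs s)(i := regs s j + regs s k)\<rparr>"
| "step (Sub i j k) s = s\<lparr>pc := pc s + 1, regs := (regs s)(i := regs s j - regs s k)\<rparr>"
| "step (Load i j) s = s\<lparr>pc := pc s + 1, regs := (regs s)(i := regs s (regs s j))\<rparr>"
| "step (Store i j) s = s\<lparr>pc := pc s + 1, regs := (regs s)(regs s i := regs s j)\<rparr>"
| "step (Jpos j m) s = s\<lparr>pc := (if regs s j > 0 then m else pc s + 1)\<rparr>"
| "step (Read i) s =
     s\<lparr>pc := pc s + 1, regs := (regs s)(i := next_input (inp s)), inp := tl (inp s)\<rparr>"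

definition bits :: "nat \<Rightarrow> nat" where
  "bits x = max 1 (floorlog 2 x)"

fun cost :: "instr \<Rightarrow> config \<Rightarrow> nat" where
  "cost (Const i c) s = bits c"
| "cost (Add i j k) s = bits (regs s j) + bits (regs s k)"
| "cost (Sub i j k) s = bits (regs s j) + bits (regs s k)"
| "cost (Load i j) s = bits (regs s j) + bits (regs s (regs s j))"
| "cost (Store i j) s = bits (regs s i) + bits (regs s j)"
| "cost (Jpos j m) s = bits (regs s j)"
| "cost (Read i) s = bits (next_input (inp s))"

text \<open>
  \<open>exec P s t s'\<close>: started in \<open>s\<close>, the program \<open>P\<close> halts (by leaving the range of its
  instructions) in \<open>s'\<close> after total time \<open>t\<close>.
\<close>

inductive exec :: "instr list \<Rightarrow> config \<Rightarrow> nat \<Rightarrow> config \<Rightarrow> bool" for P where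
  halt: "pc s \<ge> length P \<Longrightarrow> exec P s 0 s"
| step: "pc s < length P \<Longrightarrow> exec P (step (P ! pc s) s) t s' \<Longrightarrow>
           exec P s (cost (P ! pc s) s + t) s'"

text \<open>A halting machine answers yes or no by leaving 1 or 0 in register 0.\<close>

definition decides_in_time :: "instr list \<Rightarrow> nat list \<Rightarrow> bool \<Rightarrow> real \<Rightarrow> bool" where
  "decides_in_time P xs b T \<longleftrightarrow>
     (\<exists>t s'. exec P (init_config xs) t s' \<and> regs s' 0 = of_bool b \<and> real t \<le> T)"


section \<open>Encoding of instances\<close>

text \<open>
  For a graph on the vertices \<open>0, \<dots>, n - 1\<close>: the number \<open>n\<close>, the adjacency matrix row by row,
  the characteristic vectors of the lists, and the characteristic vector of the hub.
\<close>

definition encode :: "nat \<Rightarrow> nat graph \<Rightarrow> (nat \<Rightarrow> nat set) \<Rightarrow> nat set \<Rightarrow> nat list" where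
  "encode q G L Q = (let n = card (verts G) in
     n # [of_bool ({u, v} \<in> edges G). u \<leftarrow> [0..<n], v \<leftarrow> [0..<n]]
       @ [of_bool (c \<in> L v). v \<leftarrow> [0..<n], c \<leftarrow> [1..<Suc q]]
       @ [of_bool (v \<in> Q). v \<leftarrow> [0..<n]])"

end

theory Submission
  imports Defs
begin

text \<open>
  Let \<open>D = max \<delta> 2\<close>. A partial coloring of the hub is violated if some set of at most \<open>\<sigma> + 1\<close> vertices
  has no proper list coloring compatible with it; a total coloring of the hub extends to the graph iff
  it is not violated, and a violation by a component, or by an edge or a list inside the hub, involves
  at most \<open>D\<close> hub vertices. So as long as some choice of \<open>D\<close> uncolored hub vertices and colors for
  them leads to a violation, one can branch on the other \<open>q ^ D - 1\<close> colorings of these vertices; if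
  no such choice exists although \<open>D\<close> hub vertices are uncolored, every completion extends. This
  leaves at most \<open>(q ^ D - 1) ^ (p div D)\<close> branches, so \<open>q - \<epsilon>\<close> may be the \<open>D\<close>-th root of \<open>q ^ D - 1\<close>.
  All tests quantify over boundedly many vertices, which takes time polynomial in \<open>n\<close>.

  The machine replaces the recursion by a counter that runs through all sequences of branching
  choices. It is obtained by compiling a small language of loop programs, whose tests are first-order
  formulas with bounded quantifiers.
\<close>

section \<open>A loop language\<close>

text \<open>The order of quantifiers shapes the proof: \<epsilon> is fixed before \<sigma>, so the
  saving must come from sets of hub vertices whose size depends on \<delta> alone, while \<sigma>
  may enter only the program and its polynomial factor. Violations are therefore found by searching
  all vertex tuples of length \<open>Suc \<sigma>\<close>, without computing components; the
  successor leaves room for one hub vertex even if \<sigma> is 0. Branching always uses exactly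
  \<open>D\<close> distinct uncolored vertices, so each round pays for its \<open>q ^ D - 1\<close>
  branches with \<open>D\<close> hub vertices, and fewer than \<open>D\<close> remain at the end of
  a branch that never gets stuck. These last ones are tried exhaustively. The second obstacle is
  that the bound concerns a concrete machine under logarithmic cost. The machine handles numbers as
  large as the number of branches, but their bit length is linear in \<open>n\<close>, so it
  suffices to bound the number of steps and the largest register, and to multiply the former by the
  bit length of the latter.\<close>

datatype vr = VRes | VN | VN1 | VQ | VQ1 | VZ | VU | VV | VP | VA | VR | VT | VM | VI | VJ | VG | VK | VL
  | VX nat | VC nat | VY nat | VW nat | VD nat

datatype arr = Adj | Row | Lst | LRow | Hub | Col | Dig

text \<open>Matrices are flattened, and the machine cannot multiply. \<open>Rd2\<close> therefore
  takes the offset of a row from a second array, which is filled while the input is read.\<close>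

datatype tm = TV vr | TN nat | Rd arr vr | Rd2 arr arr vr vr

datatype fm = Eq tm tm | Neg fm | And fm fm | Ex vr vr fm

text \<open>Every loop runs a number of times that is fixed on entry. Hence all programs terminate,
  and semantics and step counts are primitive recursive functions.\<close>

datatype com = Skip | Assign vr tm | Inc vr | Put arr vr vr | Input vr | Seq com com
  | Cond fm com com | Loop vr vr com | Find vr vr fm

record store =
  vars :: "vr \<Rightarrow> nat"
  arrs :: "arr \<Rightarrow> nat \<Rightarrow> nat"
  ins :: "nat list"

primrec tval :: "tm \<Rightarrow> (vr \<Rightarrow> nat) \<Rightarrow> (arr \<Rightarrow> nat \<Rightarrow> nat) \<Rightarrow> nat" where
  "tval (TV x) e m = e x"
| "tval (TN c) e m = c"
| "tval (Rd a x) e m = m a (e x)"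
| "tval (Rd2 a r x y) e m = m a (m r (e x) + e y)"

primrec holds :: "fm \<Rightarrow> (vr \<Rightarrow> nat) \<Rightarrow> (arr \<Rightarrow> nat \<Rightarrow> nat) \<Rightarrow> bool" where
  "holds (Eq t u) e m \<longleftrightarrow> tval t e m = tval u e m"
| "holds (Neg f) e m \<longleftrightarrow> \<not> holds f e m"
| "holds (And f g) e m \<longleftrightarrow> holds f e m \<and> holds g e m"
| "holds (Ex x b f) e m \<longleftrightarrow> (\<exists>i<e b. holds f (e(x := i)) m)"

text \<open>The shift by one reserves 0 for failure, so the same number serves as truth value of
  \<open>Ex\<close> and as result of \<open>Find\<close>. The last witness is taken because the
  compiled loop overwrites its finding whenever the test succeeds.\<close>

primrec last_wit :: "nat \<Rightarrow> (nat \<Rightarrow> bool) \<Rightarrow> nat" where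
  "last_wit 0 P = 0"
| "last_wit (Suc n) P = (if P n then Suc n else last_wit n P)"

primrec iter :: "(nat \<Rightarrow> 's \<Rightarrow> 's) \<Rightarrow> nat \<Rightarrow> 's \<Rightarrow> 's" where
  "iter f 0 s = s"
| "iter f (Suc k) s = f k (iter f k s)"

definition setv :: "vr \<Rightarrow> nat \<Rightarrow> store \<Rightarrow> store" where
  "setv x v S = S\<lparr>vars := (vars S)(x := v)\<rparr>"

primrec sem :: "com \<Rightarrow> store \<Rightarrow> store" where
  "sem Skip S = S"
| "sem (Assign x t) S = setv x (tval t (vars S) (arrs S)) S"
| "sem (Inc x) S = setv x (Suc (vars S x)) S"
| "sem (Put a x y) S = S\<lparr>arrs := (arrs S)(a := (arrs S a)(vars S x := vars S y))\<rparr>"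
| "sem (Input x) S = (setv x (next_input (ins S)) S)\<lparr>ins := tl (ins S)\<rparr>"
| "sem (Seq c d) S = sem d (sem c S)"
| "sem (Cond f c d) S = (if holds f (vars S) (arrs S) then sem c S else sem d S)"
| "sem (Loop x b c) S = iter (\<lambda>i S. sem c (setv x i S)) (vars S b) S"
| "sem (Find x b f) S =
     setv x (last_wit (vars S b) (\<lambda>i. holds f ((vars S)(x := i)) (arrs S)) - 1) S"

text \<open>
  The step counts charge a constant its value. As values grow only by constants and increments,
  every value is then bounded by the largest initial value plus the number of steps.
\<close>

primrec tsteps :: "tm \<Rightarrow> nat" where
  "tsteps (TV x) = 1"
| "tsteps (TN c) = Suc c"
| "tsteps (Rd a x) = 1"
| "tsteps (Rd2 a r x y) = 1"

primrec fsteps :: "fm \<Rightarrow> (vr \<Rightarrow> nat) \<Rightarrow> nat" where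
  "fsteps (Eq t u) e = tsteps t + tsteps u"
| "fsteps (Neg f) e = Suc (fsteps f e)"
| "fsteps (And f g) e = Suc (fsteps f e + fsteps g e)"
| "fsteps (Ex x b f) e = Suc (\<Sum>i<e b. Suc (fsteps f (e(x := i))))"

primrec csteps :: "com \<Rightarrow> store \<Rightarrow> nat" where
  "csteps Skip S = 0"
| "csteps (Assign x t) S = tsteps t"
| "csteps (Inc x) S = 1"
| "csteps (Put a x y) S = 1"
| "csteps (Input x) S = 1"
| "csteps (Seq c d) S = csteps c S + csteps d (sem c S)"
| "csteps (Cond f c d) S =
     Suc (fsteps f (vars S) + (if holds f (vars S) (arrs S) then csteps c S else csteps d S))"
| "csteps (Loop x b c) S =
     Suc (\<Sum>k<vars S b. Suc (csteps c (setv x k (iter (\<lambda>i S. sem c (setv x i S)) k S))))"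
| "csteps (Find x b f) S = Suc (fsteps (Ex x b f) (vars S))"

lemma setv_simps [simp]:
  "vars (setv x v S) = (vars S)(x := v)" "arrs (setv x v S) = arrs S" "ins (setv x v S) = ins S"
  by (simp_all add: setv_def)

lemma last_wit_pos: "0 < last_wit n P \<longleftrightarrow> (\<exists>i<n. P i)"
  by (induction n) (auto simp: less_Suc_eq)

lemma last_wit_le: "last_wit n P \<le> n"
  by (induction n) auto

lemma last_wit_sat: "\<exists>i<n. P i \<Longrightarrow> last_wit n P - 1 < n \<and> P (last_wit n P - 1)"
  by (induction n) (auto simp: less_Suc_eq)

section \<open>Compilation to random access machines\<close>

text \<open>
  Registers are split by residue modulo 16: variables live in the class 0, auxiliary registers in
  the class 1, and each array in a class of its own.
\<close>

fun vcode :: "vr \<Rightarrow> nat" where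
  "vcode VRes = 0" | "vcode VN = 1" | "vcode VN1 = 2" | "vcode VQ = 3" | "vcode VQ1 = 4"
| "vcode VZ = 5" | "vcode VU = 6" | "vcode VV = 7" | "vcode VP = 8" | "vcode VA = 9"
| "vcode VR = 10" | "vcode VT = 11" | "vcode VM = 12" | "vcode VI = 13" | "vcode VJ = 14"
| "vcode VG = 15" | "vcode VK = 16" | "vcode VL = 17"
| "vcode (VX i) = 5 * i + 18" | "vcode (VC i) = 5 * i + 19" | "vcode (VY i) = 5 * i + 20"
| "vcode (VW i) = 5 * i + 21" | "vcode (VD i) = 5 * i + 22"

fun acode :: "arr \<Rightarrow> nat" where
  "acode Adj = 2" | "acode Row = 3" | "acode Lst = 4" | "acode LRow = 5" | "acode Hub = 6"
| "acode Col = 7" | "acode Dig = 8"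

definition vnum :: "vr \<Rightarrow> nat" where "vnum x = 16 * vcode x"
definition hid :: "nat \<Rightarrow> nat" where "hid k = 16 * k + 1"
definition anum :: "arr \<Rightarrow> nat \<Rightarrow> nat" where "anum a i = 16 * i + acode a"

abbreviation "ZERO \<equiv> hid 0"
abbreviation "ONE \<equiv> hid 1"
abbreviation "RES \<equiv> hid 2"
abbreviation "TMP \<equiv> hid 3"
abbreviation "TMP2 \<equiv> hid 4"
abbreviation "AD \<equiv> hid 5"

lemma vcode_inj: "vcode x = vcode y \<longleftrightarrow> x = y"
  by (cases x; cases y; simp; presburger)

lemma acode_inj: "acode x = acode y \<longleftrightarrow> x = y"
  by (cases x; cases y; simp)

lemma acode_bounds: "2 \<le> acode a" "acode a \<le> 8"
  by (cases a; simp)+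

lemma num_inj [simp]:
  "vnum x = vnum y \<longleftrightarrow> x = y" "hid i = hid j \<longleftrightarrow> i = j"
  by (simp_all add: vnum_def hid_def vcode_inj)

lemma anum_inj [simp]: "anum a i = anum b j \<longleftrightarrow> a = b \<and> i = j"
proof
  assume "anum a i = anum b j"
  then have "16 * i + acode a = 16 * j + acode b" by (simp add: anum_def)
  moreover from this have "i = j" using acode_bounds[of a] acode_bounds[of b] by linarith
  ultimately show "a = b \<and> i = j" by (simp add: acode_inj)
qed simp

lemma num_neq [simp]:
  "vnum x \<noteq> hid k" "hid k \<noteq> vnum x" "vnum x \<noteq> anum a i" "anum a i \<noteq> vnum x"
  "hid k \<noteq> anum a i" "anum a i \<noteq> hid k"
  using acode_bounds[of a] by (auto simp: vnum_def hid_def anum_def) presburger+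

text \<open>Multiplication by 16 is done by four doublings. The register \<open>d\<close> is written
  only after \<open>r\<close> has been read, so both may coincide, as they do in the second half of
  \<open>Rd2\<close>.\<close>

definition addr_code :: "arr \<Rightarrow> nat \<Rightarrow> nat \<Rightarrow> instr list" where
  "addr_code a r d = [Add AD r r, Add AD AD AD, Add AD AD AD, Add AD AD AD, Const d (acode a), Add AD AD d]"

primrec tcode :: "tm \<Rightarrow> nat \<Rightarrow> instr list" where
  "tcode (TV x) d = [Add d (vnum x) ZERO]"
| "tcode (TN c) d = [Const d c]"
| "tcode (Rd a x) d = addr_code a (vnum x) d @ [Load d AD]"
| "tcode (Rd2 a r x y) d =
     addr_code r (vnum x) d @ [Load d AD, Add d d (vnum y)] @ addr_code a d d @ [Load d AD]"

text \<open>Shared by \<open>Ex\<close> and \<open>Find\<close>. Auxiliary register \<open>k\<close>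
  counts the remaining rounds, \<open>k + 1\<close> saves the old value of \<open>x\<close>, and
  \<open>k + 2\<close> holds the witness found so far plus one. A jump on \<open>ONE\<close> is
  unconditional; \<open>p\<close> is the absolute address of the code.\<close>

definition ex_code :: "vr \<Rightarrow> vr \<Rightarrow> nat \<Rightarrow> nat \<Rightarrow> instr list \<Rightarrow> instr list" where
  "ex_code x b k p c = (let l = length c in
     [Add (hid k) (vnum b) ZERO, Add (hid (k + 1)) (vnum x) ZERO, Const (vnum x) 0,
      Const (hid (k + 2)) 0, Jpos (hid k) (p + 6), Jpos ONE (p + l + 12)] @ c @
     [Jpos RES (p + l + 8), Jpos ONE (p + l + 9), Add (hid (k + 2)) (vnum x) ONE,
      Add (vnum x) (vnum x) ONE, Sub (hid k) (hid k) ONE, Jpos ONE (p + 4),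
      Add (vnum x) (hid (k + 1)) ZERO, Add RES (hid (k + 2)) ZERO])"

text \<open>Truth is positivity of \<open>RES\<close>. Equality subtracts both truncated differences
  from 1; a failing first conjunct leaves 0 in \<open>RES\<close> and skips the second.\<close>

primrec fcode :: "fm \<Rightarrow> nat \<Rightarrow> nat \<Rightarrow> instr list" where
  "fcode (Eq t u) k p = tcode t TMP @ tcode u TMP2 @
     [Sub AD TMP TMP2, Sub RES TMP2 TMP, Add RES RES AD, Sub RES ONE RES]"
| "fcode (Neg f) k p = fcode f k p @ [Sub RES ONE RES]"
| "fcode (And f g) k p =
     (let c = fcode f k p; q = p + length c + 2; d = fcode g k q
      in c @ [Jpos RES q, Jpos ONE (q + length d)] @ d)"
| "fcode (Ex x b f) k p = ex_code x b k p (fcode f (k + 3) (p + 6))"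

text \<open>Bound and counter of a loop are kept in auxiliary registers, and the counter is copied
  to the loop variable in each round. So the body may overwrite both variables, in agreement with
  \<open>sem\<close>.\<close>

primrec ccode :: "com \<Rightarrow> nat \<Rightarrow> nat \<Rightarrow> instr list" where
  "ccode Skip k p = []"
| "ccode (Assign x t) k p = tcode t TMP @ [Add (vnum x) TMP ZERO]"
| "ccode (Inc x) k p = [Add (vnum x) (vnum x) ONE]"
| "ccode (Put a x y) k p = addr_code a (vnum x) TMP @ [Store AD (vnum y)]"
| "ccode (Input x) k p = [Read (vnum x)]"
| "ccode (Seq c d) k p = (let cs = ccode c k p in cs @ ccode d k (p + length cs))"
| "ccode (Cond f c d) k p =
     (let fs = fcode f k p; q = p + length fs + 2; cs = ccode c k q; r = q + length cs + 1;
        ds = ccode d k r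
      in fs @ [Jpos RES q, Jpos ONE r] @ cs @ [Jpos ONE (r + length ds)] @ ds)"
| "ccode (Loop x b c) k p =
     (let cs = ccode c (k + 2) (p + 5); l = length cs in
      [Add (hid k) (vnum b) ZERO, Const (hid (k + 1)) 0, Jpos (hid k) (p + 4),
       Jpos ONE (p + l + 8), Add (vnum x) (hid (k + 1)) ZERO] @ cs @
      [Add (hid (k + 1)) (hid (k + 1)) ONE, Sub (hid k) (hid k) ONE, Jpos ONE (p + 2)])"
| "ccode (Find x b f) k p =
     ex_code x b k p (fcode f (k + 3) (p + 6)) @ [Sub (vnum x) RES ONE]"

section \<open>Runs with bounded registers and their logarithmic cost\<close>

inductive run :: "instr list \<Rightarrow> nat \<Rightarrow> config \<Rightarrow> nat \<Rightarrow> config \<Rightarrow> bool" for P Z where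
  run_refl: "run P Z s 0 s"
| run_step: "pc s < length P \<Longrightarrow> \<forall>r. regs s r \<le> Z \<Longrightarrow> \<forall>r. regs (step (P ! pc s) s) r \<le> Z \<Longrightarrow>
     run P Z (step (P ! pc s) s) k s' \<Longrightarrow> run P Z s (Suc k) s'"

lemma run_trans: "run P Z s j s' \<Longrightarrow> run P Z s' k s'' \<Longrightarrow> run P Z s (j + k) s''"
  by (induction rule: run.induct) (auto intro: run.intros)

lemma bits_mono: "x \<le> y \<Longrightarrow> bits x \<le> bits y"
  by (simp add: bits_def max.coboundedI2 floorlog_mono)

text \<open>\<open>Const\<close> and \<open>Read\<close> are charged for a number that need not be
  in a register yet; it is bounded through the register in which it ends up. This is why
  \<open>run\<close> bounds the registers after each step as well.\<close>

lemma cost_le: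
  assumes "\<forall>r. regs s r \<le> Z" "\<forall>r. regs (step i s) r \<le> Z"
  shows "cost i s \<le> 2 * bits Z"
proof -
  have *: "bits (regs s r) \<le> bits Z" for r using assms(1) bits_mono by blast
  have **: "bits (regs (step i s) r) \<le> bits Z" for r using assms(2) bits_mono by blast
  show ?thesis
  proof (cases i)
    case (Const r c) then show ?thesis using **[of r] by simp
  next
    case (Add r x y) then show ?thesis using *[of x] *[of y] by simp
  next
    case (Sub r x y) then show ?thesis using *[of x] *[of y] by simp
  next
    case (Load r x) then show ?thesis using *[of x] *[of "regs s x"] by simp
  next
    case (Store x y) then show ?thesis using *[of x] *[of y] by simp
  next
    case (Jpos x y) then show ?thesis using *[of x] by simp
  next
    case (Read r) then show ?thesis using **[of r] by simp
  qed
qed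

lemma run_exec:
  assumes "run P Z s k s'" "length P \<le> pc s'"
  shows "\<exists>t. exec P s t s' \<and> t \<le> k * (2 * bits Z)"
  using assms
proof (induction rule: run.induct)
  case (run_refl s) then show ?case by (auto intro: exec.halt)
next
  case (run_step s k s')
  then obtain t where t: "exec P (step (P ! pc s) s) t s'" "t \<le> k * (2 * bits Z)" by blast
  then show ?case
    using exec.step[OF run_step.hyps(1) t(1)] cost_le[OF run_step.hyps(2,3)]
    by (intro exI[of _ "cost (P ! pc s) s + t"]) auto
qed

section \<open>Placement of code and straight-line blocks\<close>

definition code_at :: "instr list \<Rightarrow> nat \<Rightarrow> instr list \<Rightarrow> bool" where
  "code_at P p c \<longleftrightarrow> (\<forall>i<length c. p + i < length P \<and> P ! (p + i) = c ! i)"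

lemma code_at_Nil [simp]: "code_at P p []"
  by (simp add: code_at_def)

lemma code_at_Cons [simp]:
  "code_at P p (i # c) \<longleftrightarrow> p < length P \<and> P ! p = i \<and> code_at P (Suc p) c"
  by (auto simp: code_at_def All_less_Suc2)

lemma code_at_append [simp]:
  "code_at P p (c @ d) \<longleftrightarrow> code_at P p c \<and> code_at P (p + length c) d"
  by (induction c arbitrary: p) auto

fun straight :: "instr \<Rightarrow> (nat \<Rightarrow> nat) \<Rightarrow> nat \<times> nat" where
  "straight (Const i c) R = (i, c)"
| "straight (Add i j k) R = (i, R j + R k)"
| "straight (Sub i j k) R = (i, R j - R k)"
| "straight (Load i j) R = (i, R (R j))"
| "straight (Store i j) R = (R i, R j)"
| "straight _ R = (0, R 0)"

primrec is_straight :: "instr \<Rightarrow> bool" where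
  "is_straight (Const i c) = True"
| "is_straight (Add i j k) = True"
| "is_straight (Sub i j k) = True"
| "is_straight (Load i j) = True"
| "is_straight (Store i j) = True"
| "is_straight (Jpos i j) = False"
| "is_straight (Read i) = False"

text \<open>Straight-line code as a relation between register contents, which the simplifier can
  execute symbolically while it collects the bounds on the written values.\<close>

primrec block :: "instr list \<Rightarrow> nat \<Rightarrow> (nat \<Rightarrow> nat) \<Rightarrow> (nat \<Rightarrow> nat) \<Rightarrow> bool" where
  "block [] Z R R' \<longleftrightarrow> R' = R"
| "block (i # c) Z R R' \<longleftrightarrow> is_straight i \<and> snd (straight i R) \<le> Z \<and>
     block c Z (R(fst (straight i R) := snd (straight i R))) R'"

lemma run_block:
  assumes "block c Z R R'" "code_at P p c" "\<forall>r. R r \<le> Z" "q = p + length c" "j = length c"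
  shows "run P Z \<lparr>pc = p, regs = R, inp = I\<rparr> j \<lparr>pc = q, regs = R', inp = I\<rparr>"
  using assms
proof (induction c arbitrary: p R q j)
  case Nil then show ?case by (auto intro: run_refl)
next
  case (Cons i c)
  let ?R = "R(fst (straight i R) := snd (straight i R))"
  have "run P Z \<lparr>pc = Suc p, regs = ?R, inp = I\<rparr> (length c) \<lparr>pc = q, regs = R', inp = I\<rparr>"
    by (rule Cons.IH) (use Cons.prems in \<open>simp_all del: fun_upd_apply\<close>, simp)
  moreover have "step i \<lparr>pc = p, regs = R, inp = I\<rparr> = \<lparr>pc = Suc p, regs = ?R, inp = I\<rparr>"
    using Cons.prems by (cases i) auto
  ultimately show ?case
    using Cons.prems run_step[of "\<lparr>pc = p, regs = R, inp = I\<rparr>" P Z "length c"] by auto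
qed

lemma run_Jpos:
  assumes "code_at P p [Jpos r q]" "\<forall>r. R r \<le> Z" "t = (if 0 < R r then q else Suc p)"
  shows "run P Z \<lparr>pc = p, regs = R, inp = I\<rparr> 1 \<lparr>pc = t, regs = R, inp = I\<rparr>"
  using assms run_step[OF _ _ _ run_refl, of "\<lparr>pc = p, regs = R, inp = I\<rparr>" P Z] by auto

text \<open>
  The auxiliary registers from 6 on are allocated by nesting depth; code at depth \<open>k\<close> must not
  touch those below \<open>k\<close>.
\<close>

definition keeps :: "nat \<Rightarrow> (nat \<Rightarrow> nat) \<Rightarrow> (nat \<Rightarrow> nat) \<Rightarrow> bool" where
  "keeps k R R' \<longleftrightarrow> (\<forall>h. 6 \<le> h \<and> h < k \<longrightarrow> R' (hid h) = R (hid h))"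

definition rep :: "nat \<Rightarrow> (vr \<Rightarrow> nat) \<Rightarrow> (arr \<Rightarrow> nat \<Rightarrow> nat) \<Rightarrow> (nat \<Rightarrow> nat) \<Rightarrow> bool" where
  "rep Z e m R \<longleftrightarrow> (\<forall>x. R (vnum x) = e x) \<and> (\<forall>a i. R (anum a i) = m a i) \<and>
     R ZERO = 0 \<and> R ONE = 1 \<and> (\<forall>r. R r \<le> Z)"

definition bounded_by :: "nat \<Rightarrow> (vr \<Rightarrow> nat) \<Rightarrow> (arr \<Rightarrow> nat \<Rightarrow> nat) \<Rightarrow> bool" where
  "bounded_by M e m \<longleftrightarrow> (\<forall>x. e x \<le> M) \<and> (\<forall>a i. m a i \<le> M)"

text \<open>A read through \<open>Rd2\<close> adds an offset and an index, each at most
  \<open>M\<close>; the sum is multiplied by 16 and shifted by at most 8. This gives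
  \<open>32 * M + 8\<close>, rounded up.\<close>

definition cap :: "nat \<Rightarrow> nat" where "cap M = 32 * M + 32"

lemma bounded_by_upd: "bounded_by M e m \<Longrightarrow> v \<le> M \<Longrightarrow> bounded_by M (e(x := v)) m"
  by (simp add: bounded_by_def)

lemma keeps_trans: "keeps k R R' \<Longrightarrow> keeps k' R' R'' \<Longrightarrow> k \<le> k' \<Longrightarrow> keeps k R R''"
  by (auto simp: keeps_def)

lemma block_append: "block (c @ d) Z R R'' \<longleftrightarrow> (\<exists>R'. block c Z R R' \<and> block d Z R' R'')"
  by (induction c arbitrary: R) auto

lemma block_appendI: "block c Z R R' \<Longrightarrow> block d Z R' R'' \<Longrightarrow> block (c @ d) Z R R''"
  by (auto simp: block_append)

section \<open>Simulation of terms and formulas\<close>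

lemma addr_code_block:
  assumes "R r \<le> 2 * M" "d \<noteq> AD" "\<forall>r. R r \<le> cap M" "v = R r"
  shows "block (addr_code a r d) (cap M) R (R(AD := anum a v, d := acode a))"
proof -
  have "R(d := acode a, AD := R r + R r + (R r + R r) + (R r + R r + (R r + R r)) +
      (R r + R r + (R r + R r) + (R r + R r + (R r + R r))) + acode a) =
    R(d := acode a, AD := anum a (R r))"
    by (auto simp: anum_def)
  then show ?thesis
    using assms acode_bounds[of a]
    by (simp add: addr_code_def cap_def fun_upd_twist[of AD d] del: fun_upd_apply)
      (simp add: fun_upd_apply)
qed

lemma anum_le: "i \<le> 2 * M \<Longrightarrow> anum a i \<le> cap M"
  using acode_bounds[of a] by (simp add: anum_def cap_def)

lemma tcode_block:
  assumes "rep (cap M) e m R" "bounded_by M e m" "tsteps t \<le> M" "d = TMP \<or> d = TMP2"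
  shows "\<exists>w\<le>cap M. block (tcode t d) (cap M) R (R(AD := w, d := tval t e m))"
proof -
  have R: "\<And>x. R (vnum x) = e x" "\<And>a i. R (anum a i) = m a i" "R ZERO = 0"
    "\<And>r. R r \<le> cap M" "d \<noteq> AD" "AD \<noteq> d" "\<And>x. vnum x \<noteq> d" "\<And>a i. anum a i \<noteq> d"
    and e: "\<And>x. e x \<le> M" "\<And>a i. m a i \<le> M"
    using assms by (auto simp: rep_def bounded_by_def)
  have le: "M \<le> cap M" by (auto simp: cap_def)
  have e': "e x \<le> cap M" "m a i \<le> cap M" for x a i
    using e(1)[of x] e(2)[of a i] le by linarith+
  have dbl: "x \<le> M \<Longrightarrow> x \<le> 2 * M" for x by simp
  have rd: "block (addr_code a (vnum x) d @ [Load d AD]) (cap M) R (R(AD := anum a (e x), d := m a (e x)))"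
    for a x
    unfolding block_append
    by (intro exI[of _ "R(AD := anum a (e x), d := acode a)"] conjI addr_code_block)
      (use R e' dbl[OF e(1)[of x]] in auto)
  show ?thesis
  proof (cases t)
    case (TV x)
    show ?thesis using R e' TV by (intro exI[of _ "R AD"]) simp
  next
    case (TN x)
    show ?thesis using assms(3) R le TN by (intro exI[of _ "R AD"]) simp
  next
    case (Rd a x)
    show ?thesis
      using rd[of a x] Rd anum_le[OF dbl[OF e(1)[of x]]] by auto
  next
    case (Rd2 a r x y)
    let ?v = "m r (e x) + e y"
    have v: "?v \<le> 2 * M" "?v \<le> cap M" using e(1)[of y] e(2)[of r "e x"] by (simp_all add: cap_def)
    define R1 where "R1 = R(AD := anum r (e x), d := m r (e x))"
    define R2 where "R2 = R1(d := ?v)"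
    define R3 where "R3 = R2(AD := anum a ?v, d := acode a)"
    have 1: "block (addr_code r (vnum x) d @ [Load d AD]) (cap M) R R1"
      unfolding R1_def by (rule rd)
    have 2: "block [Add d d (vnum y)] (cap M) R1 R2"
      using v R by (simp add: R1_def R2_def)
    have 3: "block (addr_code a d d) (cap M) R2 R3"
      unfolding R3_def
      by (rule addr_code_block)
        (use v R e' anum_le[OF dbl[OF e(1)[of x]]] in \<open>auto simp: R1_def R2_def\<close>)
    have 4: "block [Load d AD] (cap M) R3 (R(AD := anum a ?v, d := m a ?v))"
      using v R e' by (auto simp: R1_def R2_def R3_def)
    have "tcode t d = (addr_code r (vnum x) d @ [Load d AD]) @ [Add d d (vnum y)] @ addr_code a d d @ [Load d AD]"
      using Rd2 by simp
    then have "block (tcode t d) (cap M) R (R(AD := anum a ?v, d := m a ?v))"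
      by (simp only:) (intro block_appendI[OF 1] block_appendI[OF 2] block_appendI[OF 3] 4)
    then show ?thesis using anum_le[OF v(1)] Rd2 by auto
  qed
qed

lemma tcode_length: "length (tcode t d) \<le> 15"
  by (cases t) (simp_all add: addr_code_def)

lemma rep_le: "rep Z e m R \<Longrightarrow> \<forall>r. R r \<le> Z"
  by (simp add: rep_def)

lemma rep_upd_hid: "rep Z e m R \<Longrightarrow> v \<le> Z \<Longrightarrow> 2 \<le> h \<Longrightarrow> rep Z e m (R(hid h := v))"
  by (auto simp: rep_def)

lemma rep_upd_var: "rep Z e m R \<Longrightarrow> v \<le> Z \<Longrightarrow> rep Z (e(x := v)) m (R(vnum x := v))"
  by (auto simp: rep_def)

lemma rep_upd_arr:
  "rep Z e m R \<Longrightarrow> v \<le> Z \<Longrightarrow> rep Z e (m(a := (m a)(i := v))) (R(anum a i := v))"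
  by (auto simp: rep_def)

text \<open>The body is arbitrary code with a specification, so that the lemma serves both
  \<open>Ex\<close> and \<open>Find\<close>. A round is charged 7 instructions besides its body, and
  8 more are charged once; the factor 40 is generous and also covers the longest pair of terms in an
  equality test.\<close>

lemma ex_code_run:
  assumes code: "code_at P p (ex_code x b k p c)" and k: "6 \<le> k"
    and R: "rep (cap M) e m R" and M: "bounded_by M e m"
    and body: "\<And>i R. i < e b \<Longrightarrow> rep (cap M) (e(x := i)) m R \<Longrightarrow>
      \<exists>R' j. run P (cap M) \<lparr>pc = p + 6, regs = R, inp = I\<rparr> j
          \<lparr>pc = p + 6 + length c, regs = R', inp = I\<rparr> \<and> j \<le> 40 * s i \<and>
        rep (cap M) (e(x := i)) m R' \<and> keeps (k + 3) R R' \<and> (0 < R' RES \<longleftrightarrow> Q i)"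
  shows "\<exists>R' j. run P (cap M) \<lparr>pc = p, regs = R, inp = I\<rparr> j
      \<lparr>pc = p + length (ex_code x b k p c), regs = R', inp = I\<rparr> \<and>
    j \<le> 40 * Suc (\<Sum>i<e b. Suc (s i)) \<and> rep (cap M) e m R' \<and> keeps k R R' \<and>
    R' RES = last_wit (e b) Q"
proof -
  let ?l = "length c" and ?Z = "cap M"
  have MZ: "v \<le> M \<Longrightarrow> v \<le> cap M" "v \<le> M \<Longrightarrow> Suc v \<le> cap M" for v by (simp_all add: cap_def)
  have eM: "e y \<le> M" for y using M by (simp add: bounded_by_def)
  have code1: "code_at P p [Add (hid k) (vnum b) ZERO, Add (hid (k + 1)) (vnum x) ZERO,
      Const (vnum x) 0, Const (hid (k + 2)) 0]"
    and code2: "code_at P (p + 4) [Jpos (hid k) (p + 6)]" "code_at P (p + 5) [Jpos ONE (p + ?l + 12)]"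
      "code_at P (p + ?l + 6) [Jpos RES (p + ?l + 8)]" "code_at P (p + ?l + 7) [Jpos ONE (p + ?l + 9)]"
      "code_at P (p + ?l + 11) [Jpos ONE (p + 4)]"
    and code3: "code_at P (p + ?l + 8) [Add (hid (k + 2)) (vnum x) ONE]"
      "code_at P (p + ?l + 9) [Add (vnum x) (vnum x) ONE, Sub (hid k) (hid k) ONE]"
    and code4: "code_at P (p + ?l + 12) [Add (vnum x) (hid (k + 1)) ZERO, Add RES (hid (k + 2)) ZERO]"
    using code by (simp_all add: ex_code_def Let_def add.commute add.left_commute numeral_eq_Suc)
  \<comment> \<open>Invariant at the loop head: the values below \<open>i\<close> are tested,
    \<open>r\<close> rounds remain, and the witness register describes the tested part.\<close>
  have loop: "\<exists>R' j. run P ?Z \<lparr>pc = p + 4, regs = R, inp = I\<rparr> j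
        \<lparr>pc = p + ?l + 14, regs = R', inp = I\<rparr> \<and>
      j \<le> 4 + (\<Sum>i\<in>{i..<i + r}. 7 + 40 * s i) \<and> rep ?Z e m R' \<and> keeps k R R' \<and>
      R' RES = last_wit (e b) Q"
    if "i + r = e b" "rep ?Z (e(x := i)) m R" "R (hid k) = r" "R (hid (k + 1)) = e x"
      "R (hid (k + 2)) = last_wit i Q" for i r R
    using that
  proof (induction r arbitrary: i R)
    case 0
    define R' where "R' = R(vnum x := e x, RES := last_wit i Q)"
    have ONE: "R ONE = 1" "R ZERO = 0" using 0 by (simp_all add: rep_def)
    note Z = rep_le[OF 0(2)]
    have "run P ?Z \<lparr>pc = p + 4, regs = R, inp = I\<rparr> 1 \<lparr>pc = p + 5, regs = R, inp = I\<rparr>"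
      by (rule run_Jpos[OF code2(1) Z]) (use 0 in simp)
    moreover have "run P ?Z \<lparr>pc = p + 5, regs = R, inp = I\<rparr> 1 \<lparr>pc = p + ?l + 12, regs = R, inp = I\<rparr>"
      by (rule run_Jpos[OF code2(2) Z]) (use ONE in simp)
    moreover have "run P ?Z \<lparr>pc = p + ?l + 12, regs = R, inp = I\<rparr> 2 \<lparr>pc = p + ?l + 14, regs = R', inp = I\<rparr>"
      by (rule run_block[OF _ code4 Z])
        (use 0 k ONE MZ eM[of x] eM[of b] last_wit_le[of i Q] in \<open>auto simp: R'_def\<close>)
    ultimately have "run P ?Z \<lparr>pc = p + 4, regs = R, inp = I\<rparr> (1 + 1 + 2) \<lparr>pc = p + ?l + 14, regs = R', inp = I\<rparr>"
      by (blast intro: run_trans)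
    moreover have "rep ?Z e m R'"
    proof -
      \<comment> \<open>The saved value returns to \<open>x\<close>: the quantified variable is
        local.\<close>
      have "rep ?Z (e(x := i, x := e x)) m R'"
        unfolding R'_def by (intro rep_upd_hid rep_upd_var 0) (use 0 MZ eM[of x] eM[of b] last_wit_le[of i Q] in auto)
      then show ?thesis by simp
    qed
    moreover have "keeps k R R'" using k by (simp add: keeps_def R'_def)
    moreover have "R' RES = last_wit (e b) Q" using 0 by (simp add: R'_def)
    ultimately show ?case by (intro exI[of _ R'] exI[of _ "1 + 1 + 2"] conjI) auto
  next
    case (Suc r)
    have ONE: "R ONE = 1" "R ZERO = 0" using Suc by (simp_all add: rep_def)
    note Z = rep_le[OF Suc.prems(2)]
    have i: "i < e b" "i < M" using Suc.prems(1) eM[of b] by linarith+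
    have 1: "run P ?Z \<lparr>pc = p + 4, regs = R, inp = I\<rparr> 1 \<lparr>pc = p + 6, regs = R, inp = I\<rparr>"
      by (rule run_Jpos[OF code2(1) Z]) (use Suc in simp)
    obtain R1 j1 where 2: "run P ?Z \<lparr>pc = p + 6, regs = R, inp = I\<rparr> j1
        \<lparr>pc = p + 6 + ?l, regs = R1, inp = I\<rparr>" "j1 \<le> 40 * s i"
      "rep ?Z (e(x := i)) m R1" "keeps (k + 3) R R1" "0 < R1 RES \<longleftrightarrow> Q i"
      using body[OF i(1) Suc.prems(2)] by (elim exE conjE) (rule that)
    have R1: "R1 (hid k) = Suc r" "R1 (hid (k + 1)) = e x" "R1 (hid (k + 2)) = last_wit i Q"
      "R1 ONE = 1" "R1 (vnum x) = i"
      using 2(3,4) Suc.prems k by (simp_all add: keeps_def rep_def)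
    note Z1 = rep_le[OF 2(3)]
    define R2 where "R2 = (if Q i then R1(hid (k + 2) := Suc i) else R1)"
    have 3: "\<exists>j\<le>2. run P ?Z \<lparr>pc = p + ?l + 6, regs = R1, inp = I\<rparr> j \<lparr>pc = p + ?l + 9, regs = R2, inp = I\<rparr>"
    proof (cases "Q i")
      case True
      have "run P ?Z \<lparr>pc = p + ?l + 6, regs = R1, inp = I\<rparr> 1 \<lparr>pc = p + ?l + 8, regs = R1, inp = I\<rparr>"
        by (rule run_Jpos[OF code2(3) Z1]) (use 2 True in simp)
      moreover have "run P ?Z \<lparr>pc = p + ?l + 8, regs = R1, inp = I\<rparr> 1 \<lparr>pc = p + ?l + 9, regs = R2, inp = I\<rparr>"
        by (rule run_block[OF _ code3(1) Z1]) (use R1 True MZ i in \<open>auto simp: R2_def\<close>)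
      ultimately have "run P ?Z \<lparr>pc = p + ?l + 6, regs = R1, inp = I\<rparr> (1 + 1) \<lparr>pc = p + ?l + 9, regs = R2, inp = I\<rparr>"
        by (rule run_trans)
      then show ?thesis by (intro exI[of _ "1 + 1"]) simp
    next
      case False
      have "run P ?Z \<lparr>pc = p + ?l + 6, regs = R1, inp = I\<rparr> 1 \<lparr>pc = p + ?l + 7, regs = R1, inp = I\<rparr>"
        by (rule run_Jpos[OF code2(3) Z1]) (use 2 False in simp)
      moreover have "run P ?Z \<lparr>pc = p + ?l + 7, regs = R1, inp = I\<rparr> 1 \<lparr>pc = p + ?l + 9, regs = R2, inp = I\<rparr>"
        using False run_Jpos[OF code2(4) Z1 refl] R1(4) by (simp add: R2_def)
      ultimately have "run P ?Z \<lparr>pc = p + ?l + 6, regs = R1, inp = I\<rparr> (1 + 1) \<lparr>pc = p + ?l + 9, regs = R2, inp = I\<rparr>"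
        by (rule run_trans)
      then show ?thesis by (intro exI[of _ "1 + 1"]) simp
    qed
    have R2: "rep ?Z (e(x := i)) m R2" "R2 (hid k) = Suc r" "R2 (hid (k + 1)) = e x"
      "R2 (hid (k + 2)) = last_wit (Suc i) Q" "R2 ONE = 1" "R2 (vnum x) = i" "keeps k R1 R2"
      using R1 2(3) MZ i by (auto simp: R2_def keeps_def intro!: rep_upd_hid)
    note Z2 = rep_le[OF R2(1)]
    define R3 where "R3 = R2(vnum x := Suc i, hid k := r)"
    have 4: "run P ?Z \<lparr>pc = p + ?l + 9, regs = R2, inp = I\<rparr> 2 \<lparr>pc = p + ?l + 11, regs = R3, inp = I\<rparr>"
      by (rule run_block[OF _ code3(2) Z2])
        (use R2 MZ[of i] MZ[of r] i Suc.prems(1) eM[of b] in \<open>auto simp: R3_def\<close>)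
    have R3: "rep ?Z (e(x := Suc i)) m R3" "R3 (hid k) = r" "R3 (hid (k + 1)) = e x"
      "R3 (hid (k + 2)) = last_wit (Suc i) Q" "R3 ONE = 1" "keeps k R2 R3"
    proof -
      have "rep ?Z (e(x := i, x := Suc i)) m R3"
        unfolding R3_def
        by (intro rep_upd_hid rep_upd_var)
          (use R2 k MZ[of i] MZ[of r] i Suc.prems(1) eM[of b] in auto)
      then show "rep ?Z (e(x := Suc i)) m R3" by simp
    qed (use R2 k in \<open>auto simp: R3_def keeps_def\<close>)
    have 5: "run P ?Z \<lparr>pc = p + ?l + 11, regs = R3, inp = I\<rparr> 1 \<lparr>pc = p + 4, regs = R3, inp = I\<rparr>"
      by (rule run_Jpos[OF code2(5) rep_le[OF R3(1)]]) (use R3 in simp)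
    have "Suc i + r = e b" using Suc.prems(1) by simp
    from Suc.IH[OF this R3(1-4)]
    obtain R4 j4 where 6: "run P ?Z \<lparr>pc = p + 4, regs = R3, inp = I\<rparr> j4
        \<lparr>pc = p + ?l + 14, regs = R4, inp = I\<rparr>"
      "j4 \<le> 4 + (\<Sum>i\<in>{Suc i..<Suc i + r}. 7 + 40 * s i)" "rep ?Z e m R4" "keeps k R3 R4"
      "R4 RES = last_wit (e b) Q"
      by (elim exE conjE) (rule that)
    obtain j3 where 3: "j3 \<le> 2"
      "run P ?Z \<lparr>pc = p + 6 + ?l, regs = R1, inp = I\<rparr> j3 \<lparr>pc = p + ?l + 9, regs = R2, inp = I\<rparr>"
      using 3 by (auto simp: ac_simps)
    have "run P ?Z \<lparr>pc = p + 4, regs = R, inp = I\<rparr> (1 + (j1 + (j3 + (2 + (1 + j4)))))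
        \<lparr>pc = p + ?l + 14, regs = R4, inp = I\<rparr>"
      by (intro run_trans[OF 1] run_trans[OF 2(1)] run_trans[OF 3(2)] run_trans[OF 4] run_trans[OF 5] 6)
    moreover have "keeps k R R4"
      using 2(4) R2(7) R3(6) 6(4) by (auto simp: keeps_def)
    moreover have "(\<Sum>i\<in>{i..<i + Suc r}. 7 + 40 * s i) = 7 + 40 * s i + (\<Sum>i\<in>{Suc i..<Suc i + r}. 7 + 40 * s i)"
      by (subst sum.atLeast_Suc_lessThan) auto
    then have "1 + (j1 + (j3 + (2 + (1 + j4)))) \<le> 4 + (\<Sum>i\<in>{i..<i + Suc r}. 7 + 40 * s i)"
      using 6(2) 2(2) 3(1) by linarith
    ultimately show ?case using 6(3,5) by (intro exI conjI)
  qed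
  define R0 where "R0 = R(hid k := e b, hid (k + 1) := e x, vnum x := 0, hid (k + 2) := 0)"
  have 1: "run P ?Z \<lparr>pc = p, regs = R, inp = I\<rparr> 4 \<lparr>pc = p + 4, regs = R0, inp = I\<rparr>"
    by (rule run_block[OF _ code1 rep_le[OF R]])
      (use R k MZ[OF eM] in \<open>auto simp: R0_def rep_def\<close>)
  have R0: "rep ?Z (e(x := 0)) m R0" "keeps k R R0"
    unfolding R0_def using R k MZ[OF eM]
    by (auto intro!: rep_upd_hid rep_upd_var simp: keeps_def)
  obtain R' j where *: "run P ?Z \<lparr>pc = p + 4, regs = R0, inp = I\<rparr> j
        \<lparr>pc = p + ?l + 14, regs = R', inp = I\<rparr>"
      "j \<le> 4 + (\<Sum>i\<in>{0..<0 + e b}. 7 + 40 * s i)" "rep ?Z e m R'" "keeps k R0 R'"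
      "R' RES = last_wit (e b) Q"
    using loop[of 0 "e b" R0] R0 by (auto simp: R0_def)
  have "4 + (4 + (\<Sum>i\<in>{0..<0 + e b}. 7 + 40 * s i)) \<le> 40 * Suc (\<Sum>i<e b. Suc (s i))"
    by (simp add: atLeast0LessThan sum.distrib sum_distrib_left[symmetric] sum_Suc)
  moreover have "keeps k R R'" using R0 * by (auto simp: keeps_def)
  moreover have len: "p + length (ex_code x b k p c) = p + ?l + 14" by (simp add: ex_code_def Let_def)
  ultimately show ?thesis unfolding len
    using run_trans[OF 1 *(1)] * by (intro exI[of _ R'] exI[of _ "4 + j"]) auto
qed

text \<open>A constant is charged its value, so the assumption on \<open>fsteps\<close> bounds the
  constants in \<open>f\<close>, and with them all numbers that the code computes.\<close>

lemma fcode_run: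
  assumes "code_at P p (fcode f k p)" "6 \<le> k" "rep (cap M) e m R" "bounded_by M e m" "fsteps f e \<le> M"
  shows "\<exists>R' j. run P (cap M) \<lparr>pc = p, regs = R, inp = I\<rparr> j
      \<lparr>pc = p + length (fcode f k p), regs = R', inp = I\<rparr> \<and>
    j \<le> 40 * fsteps f e \<and> rep (cap M) e m R' \<and> keeps k R R' \<and> (0 < R' RES \<longleftrightarrow> holds f e m)"
  using assms
proof (induction f arbitrary: k p e R)
  case (Eq t u)
  let ?c = "[Sub AD TMP TMP2, Sub RES TMP2 TMP, Add RES RES AD, Sub RES ONE RES]"
  let ?t = "tval t e m" and ?u = "tval u e m"
  note R = Eq.prems(3) and M = Eq.prems(4)
  have tv: "tval t e m \<le> M" if "tsteps t \<le> M" for t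
    using that M by (cases t) (auto simp: bounded_by_def)
  have tu: "tsteps t \<le> M" "tsteps u \<le> M" using Eq.prems(5) by simp_all
  have le: "?t \<le> M" "?u \<le> M" "M \<le> cap M" "?u + M \<le> cap M" "?t + M \<le> cap M" "1 \<le> cap M"
    using tv[OF tu(1)] tv[OF tu(2)] by (auto simp: cap_def)
  \<comment> \<open>At most one of the two truncated differences is positive, so \<open>RES\<close>
    becomes 1 if the terms are equal and 0 otherwise.\<close>
  define R' where "R' = R(TMP := ?t, TMP2 := ?u, AD := ?t - ?u, RES := 1 - (?u - ?t + (?t - ?u)))"
  obtain w where w: "w \<le> cap M" "block (tcode t TMP) (cap M) R (R(AD := w, TMP := ?t))"
    using tcode_block[OF R M tu(1), of TMP] by auto
  define R1 where "R1 = R(AD := w, TMP := ?t)"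
  have R1: "rep (cap M) e m R1" unfolding R1_def using R le w by (auto intro!: rep_upd_hid)
  obtain w' where w': "w' \<le> cap M" "block (tcode u TMP2) (cap M) R1 (R1(AD := w', TMP2 := ?u))"
    using tcode_block[OF R1 M tu(2), of TMP2] by auto
  have "block ?c (cap M) (R1(AD := w', TMP2 := ?u)) R'"
    using R le by (auto simp: R'_def R1_def rep_def fun_eq_iff)
  with w(2) w'(2) have "block (tcode t TMP @ tcode u TMP2 @ ?c) (cap M) R R'"
    unfolding block_append R1_def by blast
  from run_block[OF this Eq.prems(1)[unfolded fcode.simps] rep_le[OF R] refl refl]
  have "run P (cap M) \<lparr>pc = p, regs = R, inp = I\<rparr> (length (fcode (Eq t u) k p))
      \<lparr>pc = p + length (fcode (Eq t u) k p), regs = R', inp = I\<rparr>" by simp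
  moreover have "length (fcode (Eq t u) k p) \<le> 40 * fsteps (Eq t u) e"
    using tcode_length[of t TMP] tcode_length[of u TMP2] by (cases t; simp)
  moreover have "rep (cap M) e m R'"
    unfolding R'_def using R le by (auto intro!: rep_upd_hid)
  moreover have "keeps k R R'" using Eq.prems(2) by (auto simp: keeps_def R'_def)
  moreover have "0 < R' RES \<longleftrightarrow> holds (Eq t u) e m" by (auto simp: R'_def)
  ultimately show ?case by (intro exI conjI)
next
  case (Neg f)
  obtain R1 j where 1: "run P (cap M) \<lparr>pc = p, regs = R, inp = I\<rparr> j
      \<lparr>pc = p + length (fcode f k p), regs = R1, inp = I\<rparr>"
    "j \<le> 40 * fsteps f e" "rep (cap M) e m R1" "keeps k R R1" "0 < R1 RES \<longleftrightarrow> holds f e m"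
    using Neg.IH[of p k e R] Neg.prems by auto
  define R2 where "R2 = R1(RES := 1 - R1 RES)"
  have r: "run P (cap M) \<lparr>pc = p + length (fcode f k p), regs = R1, inp = I\<rparr> 1
      \<lparr>pc = p + length (fcode (Neg f) k p), regs = R2, inp = I\<rparr>"
    by (rule run_block[where c = "[Sub RES ONE RES]"])
      (use Neg.prems 1(3) in \<open>auto simp: rep_def cap_def R2_def\<close>)
  have "rep (cap M) e m R2" unfolding R2_def using 1(3) by (auto intro!: rep_upd_hid simp: cap_def)
  moreover have "keeps k R R2" using 1(4) Neg.prems(2) by (auto simp: keeps_def R2_def)
  moreover have "0 < R2 RES \<longleftrightarrow> holds (Neg f) e m" using 1(5) by (auto simp: R2_def)
  ultimately show ?case
    using run_trans[OF 1(1) r] 1(2) by (intro exI[of _ R2] exI[of _ "j + 1"] conjI) auto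
next
  case (And f g)
  let ?q = "p + length (fcode f k p) + 2"
  have code: "code_at P p (fcode f k p)" "code_at P (p + length (fcode f k p)) [Jpos RES ?q]"
    "code_at P (p + length (fcode f k p) + 1) [Jpos ONE (?q + length (fcode g k ?q))]"
    "code_at P ?q (fcode g k ?q)"
    using And.prems(1) by (simp_all add: Let_def)
  have len: "p + length (fcode (And f g) k p) = ?q + length (fcode g k ?q)" by (simp add: Let_def)
  obtain R1 j where 1: "run P (cap M) \<lparr>pc = p, regs = R, inp = I\<rparr> j
      \<lparr>pc = p + length (fcode f k p), regs = R1, inp = I\<rparr>"
    "j \<le> 40 * fsteps f e" "rep (cap M) e m R1" "keeps k R R1" "0 < R1 RES \<longleftrightarrow> holds f e m"
    using And.IH(1)[of p k e R] code And.prems by auto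
  note Z = rep_le[OF 1(3)]
  show ?case
  proof (cases "holds f e m")
    case True
    have 2: "run P (cap M) \<lparr>pc = p + length (fcode f k p), regs = R1, inp = I\<rparr> 1
      \<lparr>pc = ?q, regs = R1, inp = I\<rparr>"
      by (rule run_Jpos[OF code(2) Z]) (use True 1 in simp)
    obtain R2 i where 3: "run P (cap M) \<lparr>pc = ?q, regs = R1, inp = I\<rparr> i
      \<lparr>pc = ?q + length (fcode g k ?q), regs = R2, inp = I\<rparr>"
      "i \<le> 40 * fsteps g e" "rep (cap M) e m R2" "keeps k R1 R2" "0 < R2 RES \<longleftrightarrow> holds g e m"
      using And.IH(2)[of ?q k e R1] code(4) And.prems 1(3) by auto
    show ?thesis unfolding len
      using run_trans[OF 1(1) run_trans[OF 2 3(1)]] 1 3 True keeps_trans[OF 1(4) 3(4)]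
      by (intro exI[of _ R2] exI[of _ "j + (1 + i)"] conjI) auto
  next
    case False
    have 2: "run P (cap M) \<lparr>pc = p + length (fcode f k p), regs = R1, inp = I\<rparr> 1
      \<lparr>pc = p + length (fcode f k p) + 1, regs = R1, inp = I\<rparr>"
      by (rule run_Jpos[OF code(2) Z]) (use False 1 in simp)
    have 3: "run P (cap M) \<lparr>pc = p + length (fcode f k p) + 1, regs = R1, inp = I\<rparr> 1
      \<lparr>pc = ?q + length (fcode g k ?q), regs = R1, inp = I\<rparr>"
      by (rule run_Jpos[OF code(3) Z]) (use 1(3) in \<open>simp add: rep_def\<close>)
    show ?thesis unfolding len
      using run_trans[OF 1(1) run_trans[OF 2 3(1)]] 1 False
      by (intro exI[of _ R1] exI[of _ "j + (1 + 1)"] conjI) auto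
  qed
next
  case (Ex x b f)
  have "\<exists>R' j. run P (cap M) \<lparr>pc = p, regs = R, inp = I\<rparr> j
      \<lparr>pc = p + length (ex_code x b k p (fcode f (k + 3) (p + 6))), regs = R', inp = I\<rparr> \<and>
    j \<le> 40 * Suc (\<Sum>i<e b. Suc (fsteps f (e(x := i)))) \<and> rep (cap M) e m R' \<and> keeps k R R' \<and>
    R' RES = last_wit (e b) (\<lambda>i. holds f (e(x := i)) m)"
  proof (rule ex_code_run[OF Ex.prems(1)[unfolded fcode.simps] Ex.prems(2-4)])
    fix i R assume i: "i < e b" "rep (cap M) (e(x := i)) m R"
    have b: "bounded_by M (e(x := i)) m"
      using i(1) Ex.prems(4) by (intro bounded_by_upd) (auto simp: bounded_by_def intro: less_imp_le less_le_trans)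
    have "fsteps f (e(x := i)) \<le> (\<Sum>i<e b. Suc (fsteps f (e(x := i))))"
      using member_le_sum[of i "{..<e b}" "\<lambda>i. Suc (fsteps f (e(x := i)))"] i(1) by simp
    then have s: "fsteps f (e(x := i)) \<le> M" using Ex.prems(5) by simp
    have "code_at P (p + 6) (fcode f (k + 3) (p + 6))"
      using Ex.prems(1) by (simp add: ex_code_def Let_def numeral_eq_Suc)
    from Ex.IH[OF this _ i(2) b s] Ex.prems(2)
    show "\<exists>R' j. run P (cap M) \<lparr>pc = p + 6, regs = R, inp = I\<rparr> j
        \<lparr>pc = p + 6 + length (fcode f (k + 3) (p + 6)), regs = R', inp = I\<rparr> \<and>
      j \<le> 40 * fsteps f (e(x := i)) \<and> rep (cap M) (e(x := i)) m R' \<and> keeps (k + 3) R R' \<and>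
      (0 < R' RES \<longleftrightarrow> holds f (e(x := i)) m)"
      by (simp del: fun_upd_apply)
  qed
  then show ?case unfolding fcode.simps fsteps.simps holds.simps
    by (elim exE conjE) (intro exI conjI, assumption+, simp add: last_wit_pos)
qed

section \<open>Growth of values and simulation of commands\<close>

definition store_le :: "nat \<Rightarrow> store \<Rightarrow> bool" where
  "store_le M S \<longleftrightarrow> bounded_by M (vars S) (arrs S) \<and> (\<forall>v\<in>set (ins S). v \<le> M)"

lemma store_le_mono: "store_le M S \<Longrightarrow> M \<le> M' \<Longrightarrow> store_le M' S"
  by (auto simp: store_le_def bounded_by_def intro: order_trans)

lemma store_le_setv: "store_le M S \<Longrightarrow> v \<le> M \<Longrightarrow> store_le M (setv x v S)"
  by (simp add: store_le_def bounded_by_upd)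

lemma next_input_le: "(\<forall>v\<in>set xs. v \<le> M) \<Longrightarrow> next_input xs \<le> M"
  by (cases xs) (auto simp: next_input_def)

lemma tval_le: "bounded_by M e m \<Longrightarrow> tval t e m \<le> M + tsteps t"
  by (cases t) (auto simp: bounded_by_def intro: le_SucI)

text \<open>The loop case of \<open>sem_le\<close>, with the induction hypothesis as an assumption.
  It is separate because \<open>ccode_run\<close> also has to bound the store in the middle of a
  loop.\<close>

lemma iter_le:
  assumes IH: "\<And>M S. store_le M S \<Longrightarrow> store_le (M + csteps c S) (sem c S)"
    and "store_le M S" "k \<le> vars S b"
  shows "store_le (M + (\<Sum>k<k. Suc (csteps c (setv x k (iter (\<lambda>i S. sem c (setv x i S)) k S)))))
    (iter (\<lambda>i S. sem c (setv x i S)) k S)"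
  using assms(3)
proof (induction k)
  case 0 then show ?case using assms(2) by simp
next
  case (Suc k)
  let ?I = "\<lambda>k. iter (\<lambda>i S. sem c (setv x i S)) k S"
  let ?m = "M + (\<Sum>k<k. Suc (csteps c (setv x k (?I k))))"
  have "vars S b \<le> M" using assms(2) by (simp add: store_le_def bounded_by_def)
  then have "store_le ?m (setv x k (?I k))" using Suc by (intro store_le_setv) auto
  from IH[OF this] show ?case by (auto intro: store_le_mono)
qed

lemma sem_le: "store_le M S \<Longrightarrow> store_le (M + csteps c S) (sem c S)"
proof (induction c arbitrary: M S)
  case Skip then show ?case by simp
next
  case (Assign x t)
  then show ?case
    using tval_le[of M "vars S" "arrs S" t]
    by (auto intro!: store_le_setv intro: store_le_mono[OF Assign] simp: store_le_def bounded_by_def trans_le_add1)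
next
  case (Inc x)
  then show ?case by (auto simp: store_le_def bounded_by_def intro: le_SucI)
next
  case (Put a x y)
  then show ?case by (auto simp: store_le_def bounded_by_def intro: le_SucI)
next
  case (Input x)
  then show ?case using next_input_le[of "ins S" M]
    by (cases "ins S") (auto simp: store_le_def bounded_by_def intro: le_SucI)
next
  case (Seq c d)
  from Seq.IH(2)[OF Seq.IH(1)[OF Seq.prems]] show ?case by (simp add: add.assoc)
next
  case (Cond f c d)
  show ?case
    using Cond.IH(1)[OF Cond.prems] Cond.IH(2)[OF Cond.prems] by (auto intro: store_le_mono)
next
  case (Loop x b c)
  show ?case
    by (rule store_le_mono[OF iter_le[of c, OF Loop.IH Loop.prems order_refl, where x = x and b = b, folded sem.simps]])
      simp_all
next
  case (Find x b f)
  have "vars S b \<le> M" using Find by (simp add: store_le_def bounded_by_def)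
  then show ?case
    using last_wit_le[of "vars S b" "\<lambda>i. holds f ((vars S)(x := i)) (arrs S)"]
    by (auto intro!: store_le_setv store_le_mono[OF Find])
qed

text \<open>\<open>M\<close> is fixed for the whole run, whereas \<open>N\<close> bounds the current
  store. As execution proceeds, the steps already made move from \<open>csteps\<close> into
  \<open>N\<close>, so their sum stays below \<open>M\<close>.\<close>

lemma ccode_run:
  assumes "code_at P p (ccode c k p)" "6 \<le> k" "rep (cap M) (vars S) (arrs S) R"
    "store_le N S" "N + csteps c S \<le> M"
  shows "\<exists>R' j. run P (cap M) \<lparr>pc = p, regs = R, inp = ins S\<rparr> j
      \<lparr>pc = p + length (ccode c k p), regs = R', inp = ins (sem c S)\<rparr> \<and>
    j \<le> 40 * csteps c S \<and> rep (cap M) (vars (sem c S)) (arrs (sem c S)) R' \<and> keeps k R R'"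
  using assms
proof (induction c arbitrary: k p S R N)
  case Skip
  then show ?case by (auto intro!: exI[of _ R] run_refl simp: keeps_def)
next
  case (Assign x t)
  note R = Assign.prems(3)
  have b: "bounded_by M (vars S) (arrs S)"
    using store_le_mono[OF Assign.prems(4)] Assign.prems(5) by (simp add: store_le_def)
  let ?v = "tval t (vars S) (arrs S)"
  have t: "tsteps t \<le> M" "?v \<le> M"
    using Assign.prems(4,5) tval_le[of N "vars S" "arrs S" t] by (auto simp: store_le_def)
  then have v: "?v \<le> cap M" by (simp add: cap_def)
  obtain w where w: "w \<le> cap M" "block (tcode t TMP) (cap M) R (R(AD := w, TMP := ?v))"
    using tcode_block[OF R b t(1), of TMP] by auto
  define R' where "R' = R(AD := w, TMP := ?v, vnum x := ?v)"
  have "block [Add (vnum x) TMP ZERO] (cap M) (R(AD := w, TMP := ?v)) R'"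
    using v R by (simp add: R'_def rep_def)
  with w(2) have "block (ccode (Assign x t) k p) (cap M) R R'"
    unfolding ccode.simps block_append by blast
  from run_block[OF this Assign.prems(1) rep_le[OF R] refl refl]
  have "run P (cap M) \<lparr>pc = p, regs = R, inp = ins S\<rparr> (length (ccode (Assign x t) k p))
      \<lparr>pc = p + length (ccode (Assign x t) k p), regs = R', inp = ins (sem (Assign x t) S)\<rparr>" by simp
  moreover have "length (ccode (Assign x t) k p) \<le> 40 * csteps (Assign x t) S"
    using tcode_length[of t TMP] by (cases t; simp)
  moreover have "rep (cap M) (vars (sem (Assign x t) S)) (arrs (sem (Assign x t) S)) R'"
    unfolding R'_def sem.simps setv_simps using w(1) v by (intro rep_upd_var rep_upd_hid R) auto
  moreover have "keeps k R R'" by (auto simp: keeps_def R'_def)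
  ultimately show ?case by (intro exI conjI)
next
  case (Inc x)
  have "Suc (vars S x) \<le> M"
    using sem_le[OF Inc.prems(4), of "Inc x"] Inc.prems(5)
    by (auto simp: store_le_def bounded_by_def dest!: spec[of _ x])
  then have v: "Suc (vars S x) \<le> cap M" by (simp add: cap_def)
  define R' where "R' = R(vnum x := Suc (vars S x))"
  have "run P (cap M) \<lparr>pc = p, regs = R, inp = ins S\<rparr> 1 \<lparr>pc = Suc p, regs = R', inp = ins S\<rparr>"
    by (rule run_block[OF _ Inc.prems(1)[unfolded ccode.simps] rep_le[OF Inc.prems(3)]])
      (use v Inc.prems(3) in \<open>auto simp: rep_def R'_def\<close>)
  moreover have "rep (cap M) (vars (sem (Inc x) S)) (arrs (sem (Inc x) S)) R'"
    unfolding R'_def sem.simps setv_simps by (intro rep_upd_var Inc v)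
  moreover have "keeps k R R'" by (simp add: keeps_def R'_def)
  ultimately show ?case by (intro exI[of _ R'] exI[of _ 1] conjI) (simp_all del: fun_upd_apply)
next
  case (Put a x y)
  note R = Put.prems(3)
  have b: "vars S x \<le> M" "vars S y \<le> M"
    using store_le_mono[OF Put.prems(4), of M] Put.prems(5) by (simp_all add: store_le_def bounded_by_def)
  then have v: "vars S y \<le> cap M" "anum a (vars S x) \<le> cap M" "acode a \<le> cap M"
    using acode_bounds[of a] by (simp_all add: cap_def anum_def)
  define R1 where "R1 = R(AD := anum a (vars S x), TMP := acode a)"
  define R' where "R' = R1(anum a (vars S x) := vars S y)"
  have "block (addr_code a (vnum x) TMP) (cap M) R R1"
    unfolding R1_def by (rule addr_code_block) (use R b in \<open>auto simp: rep_def\<close>)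
  moreover have "block [Store AD (vnum y)] (cap M) R1 R'"
    using v R by (simp add: R1_def R'_def rep_def)
  ultimately have "block (ccode (Put a x y) k p) (cap M) R R'"
    unfolding ccode.simps block_append by blast
  from run_block[OF this Put.prems(1) rep_le[OF R] refl refl]
  have "run P (cap M) \<lparr>pc = p, regs = R, inp = ins S\<rparr> (length (ccode (Put a x y) k p))
      \<lparr>pc = p + length (ccode (Put a x y) k p), regs = R', inp = ins (sem (Put a x y) S)\<rparr>" by simp
  moreover have "length (ccode (Put a x y) k p) \<le> 40 * csteps (Put a x y) S"
    by (simp add: addr_code_def)
  moreover have "rep (cap M) (vars (sem (Put a x y) S)) (arrs (sem (Put a x y) S)) R'"
    using R v by (auto simp: R'_def R1_def intro!: rep_upd_arr rep_upd_hid)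
  moreover have "keeps k R R'" by (auto simp: keeps_def R'_def R1_def)
  ultimately show ?case by (intro exI conjI)
next
  case (Input x)
  let ?v = "next_input (ins S)"
  have "?v \<le> M"
    using Input.prems next_input_le[of "ins S" N] by (auto simp: store_le_def)
  then have v: "?v \<le> cap M" by (simp add: cap_def)
  define R' where "R' = R(vnum x := ?v)"
  have "run P (cap M) \<lparr>pc = p, regs = R, inp = ins S\<rparr> 1
     \<lparr>pc = Suc p, regs = R', inp = tl (ins S)\<rparr>"
    using Input.prems(1) rep_le[OF Input.prems(3)] v
      run_step[OF _ _ _ run_refl, of "\<lparr>pc = p, regs = R, inp = ins S\<rparr>" P "cap M"] by (auto simp: R'_def)
  moreover have "rep (cap M) (vars (sem (Input x) S)) (arrs (sem (Input x) S)) R'"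
    unfolding R'_def by (simp del: fun_upd_apply) (intro rep_upd_var Input v)
  moreover have "keeps k R R'" by (simp add: keeps_def R'_def)
  ultimately show ?case by (intro exI[of _ R'] exI[of _ 1] conjI) (simp_all del: fun_upd_apply)
next
  case (Seq c d)
  let ?q = "p + length (ccode c k p)"
  have code: "code_at P p (ccode c k p)" "code_at P ?q (ccode d k ?q)"
    using Seq.prems(1) by (simp_all add: Let_def)
  obtain R1 j where 1: "run P (cap M) \<lparr>pc = p, regs = R, inp = ins S\<rparr> j
      \<lparr>pc = ?q, regs = R1, inp = ins (sem c S)\<rparr>"
    "j \<le> 40 * csteps c S" "rep (cap M) (vars (sem c S)) (arrs (sem c S)) R1" "keeps k R R1"
    using Seq.IH(1)[OF code(1) Seq.prems(2-4)] Seq.prems(5) by auto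
  obtain R2 i where 2: "run P (cap M) \<lparr>pc = ?q, regs = R1, inp = ins (sem c S)\<rparr> i
      \<lparr>pc = ?q + length (ccode d k ?q), regs = R2, inp = ins (sem d (sem c S))\<rparr>"
    "i \<le> 40 * csteps d (sem c S)" "rep (cap M) (vars (sem d (sem c S))) (arrs (sem d (sem c S))) R2"
    "keeps k R1 R2"
    using Seq.IH(2)[OF code(2) Seq.prems(2) 1(3) sem_le[OF Seq.prems(4)]] Seq.prems(5) by auto
  show ?case
    using run_trans[OF 1(1) 2(1)] 1 2 keeps_trans[OF 1(4) 2(4)]
    by (intro exI[of _ R2] exI[of _ "j + i"] conjI) (auto simp: Let_def add.assoc)
next
  case (Cond f c d)
  let ?n = "p + length (fcode f k p)"
  let ?q = "?n + 2"
  let ?r = "?q + length (ccode c k ?q) + 1"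
  let ?e = "?r + length (ccode d k ?r)"
  let ?end = "p + length (ccode (Cond f c d) k p)"
  have code: "code_at P p (fcode f k p)" "code_at P ?n [Jpos RES ?q]" "code_at P (?n + 1) [Jpos ONE ?r]"
    "code_at P ?q (ccode c k ?q)" "code_at P (?q + length (ccode c k ?q)) [Jpos ONE ?e]"
    "code_at P ?r (ccode d k ?r)"
    using Cond.prems(1) by (simp_all add: Let_def)
  have len: "?end = ?e" by (simp add: Let_def)
  have b: "bounded_by M (vars S) (arrs S)"
    using store_le_mono[OF Cond.prems(4), of M] Cond.prems(5) by (simp add: store_le_def)
  obtain R1 j where 1: "run P (cap M) \<lparr>pc = p, regs = R, inp = ins S\<rparr> j
      \<lparr>pc = ?n, regs = R1, inp = ins S\<rparr>"
    "j \<le> 40 * fsteps f (vars S)" "rep (cap M) (vars S) (arrs S) R1" "keeps k R R1"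
    "0 < R1 RES \<longleftrightarrow> holds f (vars S) (arrs S)"
    using fcode_run[OF code(1) Cond.prems(2,3) b, of "ins S"] Cond.prems(5) by auto
  note Z = rep_le[OF 1(3)]
  show ?case
  proof (cases "holds f (vars S) (arrs S)")
    case True
    have 2: "run P (cap M) \<lparr>pc = ?n, regs = R1, inp = ins S\<rparr> 1 \<lparr>pc = ?q, regs = R1, inp = ins S\<rparr>"
      by (rule run_Jpos[OF code(2) Z]) (use True 1 in simp)
    obtain R2 i where 3: "run P (cap M) \<lparr>pc = ?q, regs = R1, inp = ins S\<rparr> i
        \<lparr>pc = ?q + length (ccode c k ?q), regs = R2, inp = ins (sem c S)\<rparr>"
      "i \<le> 40 * csteps c S" "rep (cap M) (vars (sem c S)) (arrs (sem c S)) R2" "keeps k R1 R2"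
      using Cond.IH(1)[OF code(4) Cond.prems(2) 1(3) Cond.prems(4)] Cond.prems(5) True by auto
    have 4: "run P (cap M) \<lparr>pc = ?q + length (ccode c k ?q), regs = R2, inp = ins (sem c S)\<rparr> 1
        \<lparr>pc = ?e, regs = R2, inp = ins (sem c S)\<rparr>"
      by (rule run_Jpos[OF code(5) rep_le[OF 3(3)]]) (use 3 in \<open>simp add: rep_def\<close>)
    show ?thesis unfolding len
      using run_trans[OF 1(1) run_trans[OF 2 run_trans[OF 3(1) 4]]] 1 3 True keeps_trans[OF 1(4) 3(4)]
      by (intro exI[of _ R2] exI[of _ "j + (1 + (i + 1))"] conjI) auto
  next
    case False
    have 2: "run P (cap M) \<lparr>pc = ?n, regs = R1, inp = ins S\<rparr> 1 \<lparr>pc = ?n + 1, regs = R1, inp = ins S\<rparr>"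
      by (rule run_Jpos[OF code(2) Z]) (use False 1 in simp)
    have 3: "run P (cap M) \<lparr>pc = ?n + 1, regs = R1, inp = ins S\<rparr> 1 \<lparr>pc = ?r, regs = R1, inp = ins S\<rparr>"
      by (rule run_Jpos[OF code(3) Z]) (use 1(3) in \<open>simp add: rep_def\<close>)
    obtain R2 i where 4: "run P (cap M) \<lparr>pc = ?r, regs = R1, inp = ins S\<rparr> i
        \<lparr>pc = ?e, regs = R2, inp = ins (sem d S)\<rparr>"
      "i \<le> 40 * csteps d S" "rep (cap M) (vars (sem d S)) (arrs (sem d S)) R2" "keeps k R1 R2"
      using Cond.IH(2)[OF code(6) Cond.prems(2) 1(3) Cond.prems(4)] Cond.prems(5) False by auto
    show ?thesis unfolding len
      using run_trans[OF 1(1) run_trans[OF 2 run_trans[OF 3 4(1)]]] 1 4 False keeps_trans[OF 1(4) 4(4)]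
      by (intro exI[of _ R2] exI[of _ "j + (1 + (1 + i))"] conjI) auto
  qed
next
  case (Loop x b c)
  let ?cs = "ccode c (k + 2) (p + 5)" and ?Z = "cap M"
  let ?l = "length ?cs"
  let ?I = "\<lambda>i. iter (\<lambda>i S. sem c (setv x i S)) i S"
  let ?s = "\<lambda>i. csteps c (setv x i (?I i))"
  note R = Loop.prems(3) and k = Loop.prems(2)
  have SN: "store_le N S" by fact
  have MZ: "v \<le> M \<Longrightarrow> v \<le> cap M" for v by (simp add: cap_def)
  have eM: "vars S b \<le> M" using store_le_mono[OF SN, of M] Loop.prems(5) by (simp add: store_le_def bounded_by_def)
  have code: "code_at P p [Add (hid k) (vnum b) ZERO, Const (hid (k + 1)) 0]"
    "code_at P (p + 2) [Jpos (hid k) (p + 4)]" "code_at P (p + 3) [Jpos ONE (p + ?l + 8)]"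
    "code_at P (p + 4) [Add (vnum x) (hid (k + 1)) ZERO]" "code_at P (p + 5) ?cs"
    "code_at P (p + 5 + ?l) [Add (hid (k + 1)) (hid (k + 1)) ONE, Sub (hid k) (hid k) ONE]"
    "code_at P (p + ?l + 7) [Jpos ONE (p + 2)]"
    using Loop.prems(1) by (simp_all add: Let_def add.commute add.left_commute numeral_eq_Suc)
  have loop: "\<exists>R' j. run P ?Z \<lparr>pc = p + 2, regs = R, inp = ins (?I i)\<rparr> j
        \<lparr>pc = p + ?l + 8, regs = R', inp = ins (?I (vars S b))\<rparr> \<and>
      j \<le> 2 + (\<Sum>i\<in>{i..<i + r}. 40 * Suc (?s i)) \<and>
      rep ?Z (vars (?I (vars S b))) (arrs (?I (vars S b))) R' \<and> keeps k R R'"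
    if "i + r = vars S b" "rep ?Z (vars (?I i)) (arrs (?I i)) R" "R (hid k) = r" "R (hid (k + 1)) = i"
    for i r R
    using that
  proof (induction r arbitrary: i R)
    case 0
    note Z = rep_le[OF 0(2)]
    have 1: "run P ?Z \<lparr>pc = p + 2, regs = R, inp = ins (?I i)\<rparr> 1 \<lparr>pc = p + 3, regs = R, inp = ins (?I i)\<rparr>"
      by (rule run_Jpos[OF code(2) Z]) (use 0 in simp)
    have 2: "run P ?Z \<lparr>pc = p + 3, regs = R, inp = ins (?I i)\<rparr> 1 \<lparr>pc = p + ?l + 8, regs = R, inp = ins (?I i)\<rparr>"
      by (rule run_Jpos[OF code(3) Z]) (use 0 in \<open>simp add: rep_def\<close>)
    show ?case using run_trans[OF 1 2] 0
      by (intro exI[of _ R] exI[of _ "1 + 1"] conjI) (auto simp: keeps_def)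
  next
    case (Suc r)
    note Z = rep_le[OF Suc.prems(2)]
    have i: "i < vars S b" "i < M" using Suc.prems(1) eM by linarith+
    have 1: "run P ?Z \<lparr>pc = p + 2, regs = R, inp = ins (?I i)\<rparr> 1 \<lparr>pc = p + 4, regs = R, inp = ins (?I i)\<rparr>"
      by (rule run_Jpos[OF code(2) Z]) (use Suc in simp)
    define R1 where "R1 = R(vnum x := i)"
    have 2: "run P ?Z \<lparr>pc = p + 4, regs = R, inp = ins (?I i)\<rparr> 1 \<lparr>pc = p + 5, regs = R1, inp = ins (?I i)\<rparr>"
      by (rule run_block[OF _ code(4) Z]) (use Suc.prems i MZ[of i] in \<open>auto simp: R1_def rep_def\<close>)
    have R1: "rep ?Z (vars (setv x i (?I i))) (arrs (setv x i (?I i))) R1"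
      unfolding R1_def setv_simps by (intro rep_upd_var Suc.prems) (use i MZ[of i] in auto)
    \<comment> \<open>The first \<open>i\<close> rounds raise the values by at most their steps, and
      the steps of the next round still fit below \<open>M\<close>.\<close>
    have le: "store_le (N + (\<Sum>k<i. Suc (?s k))) (setv x i (?I i))"
      using iter_le[of c, OF sem_le SN, where b = b and k = i and x = x] i SN
      using le_trans[OF less_imp_le[OF i(1)], of N]
      by (intro store_le_setv) (auto simp: store_le_def bounded_by_def intro!: trans_le_add1)
    have "(\<Sum>k<Suc i. Suc (?s k)) \<le> (\<Sum>k<vars S b. Suc (?s k))"
      using i by (intro sum_mono2) auto
    then have bd: "N + (\<Sum>k<i. Suc (?s k)) + ?s i \<le> M"
      using Loop.prems(5) by simp
    have "6 \<le> k + 2" using k by simp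
    from Loop.IH[OF code(5) this R1 le bd]
    obtain R2 j where 3: "run P ?Z \<lparr>pc = p + 5, regs = R1, inp = ins (?I i)\<rparr> j
        \<lparr>pc = p + 5 + ?l, regs = R2, inp = ins (?I (Suc i))\<rparr>" "j \<le> 40 * ?s i"
      "rep ?Z (vars (?I (Suc i))) (arrs (?I (Suc i))) R2" "keeps (k + 2) R1 R2"
      by auto
    have R2: "R2 (hid k) = Suc r" "R2 (hid (k + 1)) = i" "R2 ONE = 1"
      using 3(3,4) Suc.prems k by (simp_all add: keeps_def rep_def R1_def)
    define R3 where "R3 = R2(hid (k + 1) := Suc i, hid k := r)"
    have 4: "run P ?Z \<lparr>pc = p + 5 + ?l, regs = R2, inp = ins (?I (Suc i))\<rparr> 2
        \<lparr>pc = p + ?l + 7, regs = R3, inp = ins (?I (Suc i))\<rparr>"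
      by (rule run_block[OF _ code(6) rep_le[OF 3(3)]])
        (use R2 k MZ[of "Suc i"] MZ[of r] i Suc.prems(1) eM in \<open>auto simp: R3_def\<close>)
    have R3: "rep ?Z (vars (?I (Suc i))) (arrs (?I (Suc i))) R3"
      unfolding R3_def
      by (intro rep_upd_hid 3) (use k MZ[of "Suc i"] MZ[of r] i Suc.prems(1) eM in auto)
    have R3': "R3 (hid k) = r" "R3 (hid (k + 1)) = Suc i" "R3 ONE = 1"
      using R2 k by (auto simp: R3_def)
    have 5: "run P ?Z \<lparr>pc = p + ?l + 7, regs = R3, inp = ins (?I (Suc i))\<rparr> 1
        \<lparr>pc = p + 2, regs = R3, inp = ins (?I (Suc i))\<rparr>"
      by (rule run_Jpos[OF code(7) rep_le[OF R3]]) (use R3' in simp)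
    have "Suc i + r = vars S b" using Suc.prems(1) by simp
    from Suc.IH[OF this R3 R3'(1,2)]
    obtain R4 j4 where 6: "run P ?Z \<lparr>pc = p + 2, regs = R3, inp = ins (?I (Suc i))\<rparr> j4
        \<lparr>pc = p + ?l + 8, regs = R4, inp = ins (?I (vars S b))\<rparr>"
      "j4 \<le> 2 + (\<Sum>i\<in>{Suc i..<Suc i + r}. 40 * Suc (?s i))"
      "rep ?Z (vars (?I (vars S b))) (arrs (?I (vars S b))) R4" "keeps k R3 R4"
      by (elim exE conjE) (rule that)
    have 7: "run P ?Z \<lparr>pc = p + 2, regs = R, inp = ins (?I i)\<rparr> (1 + (1 + (j + (2 + (1 + j4)))))
        \<lparr>pc = p + ?l + 8, regs = R4, inp = ins (?I (vars S b))\<rparr>"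
      by (intro run_trans[OF 1] run_trans[OF 2] run_trans[OF 3(1)] run_trans[OF 4] run_trans[OF 5] 6)
    have "keeps k R R4"
      using 3(4) 6(4) by (auto simp: keeps_def R1_def R3_def)
    moreover have "(\<Sum>i\<in>{i..<i + Suc r}. 40 * Suc (?s i)) = 40 * Suc (?s i) + (\<Sum>i\<in>{Suc i..<Suc i + r}. 40 * Suc (?s i))"
      by (subst sum.atLeast_Suc_lessThan) auto
    then have "1 + (1 + (j + (2 + (1 + j4)))) \<le> 2 + (\<Sum>i\<in>{i..<i + Suc r}. 40 * Suc (?s i))"
      using 6(2) 3(2) by (simp only: mult_Suc_right)
    ultimately show ?case using 6(3) 7 by (intro exI conjI)
  qed
  define R0 where "R0 = R(hid k := vars S b, hid (k + 1) := 0)"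
  have 1: "run P ?Z \<lparr>pc = p, regs = R, inp = ins S\<rparr> 2 \<lparr>pc = p + 2, regs = R0, inp = ins (?I 0)\<rparr>"
    unfolding iter.simps
    by (rule run_block[OF _ code(1) rep_le[OF R]])
      (use R k MZ[OF eM] in \<open>auto simp: R0_def rep_def\<close>)
  have R0: "rep ?Z (vars (?I 0)) (arrs (?I 0)) R0"
    unfolding R0_def using R k MZ[OF eM] by (auto intro!: rep_upd_hid)
  have R0': "R0 (hid k) = vars S b" "R0 (hid (k + 1)) = 0" by (simp_all add: R0_def)
  have len: "p + length (ccode (Loop x b c) k p) = p + ?l + 8" by (simp add: Let_def)
  from loop[OF _ R0 R0']
  obtain R' j where *: "run P ?Z \<lparr>pc = p + 2, regs = R0, inp = ins (?I 0)\<rparr> j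
        \<lparr>pc = p + ?l + 8, regs = R', inp = ins (?I (vars S b))\<rparr>"
      "j \<le> 2 + (\<Sum>i\<in>{0..<0 + vars S b}. 40 * Suc (?s i))"
      "rep ?Z (vars (?I (vars S b))) (arrs (?I (vars S b))) R'" "keeps k R0 R'"
    by auto
  have "keeps k R R'" using * by (auto simp: keeps_def R0_def)
  moreover have "2 + j \<le> 40 * csteps (Loop x b c) S"
    using *(2) by (simp add: atLeast0LessThan sum_distrib_left)
  ultimately show ?case unfolding len
    using run_trans[OF 1 *(1)] * by (intro exI[of _ R'] exI[of _ "2 + j"] conjI) auto
next
  case (Find x b f)
  let ?cs = "fcode f (k + 3) (p + 6)" and ?e = "vars S" and ?m = "arrs S"
  let ?ec = "ex_code x b k p ?cs"
  let ?v = "last_wit (?e b) (\<lambda>i. holds f (?e(x := i)) ?m)"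
  have b: "bounded_by M ?e ?m"
    using store_le_mono[OF Find.prems(4), of M] Find.prems(5) by (simp add: store_le_def)
  have code: "code_at P p (fcode (Ex x b f) k p)" "code_at P (p + length ?ec) [Sub (vnum x) RES ONE]"
    "code_at P p ?ec" using Find.prems(1) by simp_all
  have "\<exists>R' j. run P (cap M) \<lparr>pc = p, regs = R, inp = ins S\<rparr> j
      \<lparr>pc = p + length ?ec, regs = R', inp = ins S\<rparr> \<and>
    j \<le> 40 * Suc (\<Sum>i<?e b. Suc (fsteps f (?e(x := i)))) \<and> rep (cap M) ?e ?m R' \<and> keeps k R R' \<and>
    R' RES = ?v"
  proof (rule ex_code_run[OF code(3) Find.prems(2,3) b])
    fix i R assume i: "i < ?e b" "rep (cap M) (?e(x := i)) ?m R"
    have b: "bounded_by M (?e(x := i)) ?m"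
      using i(1) b by (intro bounded_by_upd) (auto simp: bounded_by_def intro: less_imp_le less_le_trans)
    have "fsteps f (?e(x := i)) \<le> (\<Sum>i<?e b. Suc (fsteps f (?e(x := i))))"
      using member_le_sum[of i "{..<?e b}" "\<lambda>i. Suc (fsteps f (?e(x := i)))"] i(1) by simp
    then have s: "fsteps f (?e(x := i)) \<le> M" using Find.prems(5) by simp
    have "code_at P (p + 6) ?cs"
      using code(3) by (simp add: ex_code_def Let_def numeral_eq_Suc)
    from fcode_run[OF this _ i(2) b s] Find.prems(2)
    show "\<exists>R' j. run P (cap M) \<lparr>pc = p + 6, regs = R, inp = ins S\<rparr> j
        \<lparr>pc = p + 6 + length ?cs, regs = R', inp = ins S\<rparr> \<and>
      j \<le> 40 * fsteps f (?e(x := i)) \<and> rep (cap M) (?e(x := i)) ?m R' \<and> keeps (k + 3) R R' \<and>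
      (0 < R' RES \<longleftrightarrow> holds f (?e(x := i)) ?m)"
      by (simp del: fun_upd_apply)
  qed
  then obtain R1 j where 1: "run P (cap M) \<lparr>pc = p, regs = R, inp = ins S\<rparr> j
      \<lparr>pc = p + length ?ec, regs = R1, inp = ins S\<rparr>"
    "j \<le> 40 * Suc (\<Sum>i<?e b. Suc (fsteps f (?e(x := i))))" "rep (cap M) ?e ?m R1" "keeps k R R1"
    "R1 RES = ?v" by (elim exE conjE) (rule that)
  have v: "?v - 1 \<le> cap M"
    using rep_le[OF 1(3)] 1(5) by (metis diff_le_self order_trans)
  define R2 where "R2 = R1(vnum x := ?v - 1)"
  have 2: "run P (cap M) \<lparr>pc = p + length ?ec, regs = R1, inp = ins S\<rparr> 1
      \<lparr>pc = p + length (ccode (Find x b f) k p), regs = R2, inp = ins (sem (Find x b f) S)\<rparr>"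
    using run_block[OF _ code(2) rep_le[OF 1(3)] refl refl, of R2 "ins S"] 1(3,5) v
    by (simp add: R2_def rep_def del: last_wit.simps)
  have "rep (cap M) (vars (sem (Find x b f) S)) (arrs (sem (Find x b f) S)) R2"
    unfolding R2_def sem.simps setv_simps by (intro rep_upd_var 1 v)
  moreover have "keeps k R R2" using 1(4) by (simp add: keeps_def R2_def)
  moreover have "j + 1 \<le> 40 * csteps (Find x b f) S" using 1(2) by simp
  ultimately show ?case using run_trans[OF 1(1) 2] by (intro exI conjI)
qed

text \<open>All registers start at 0, so \<open>ZERO\<close> is correct and only \<open>ONE\<close>
  must be set. Auxiliary registers below 6 are reserved, and the code starts behind the first
  instruction.\<close>

definition compile :: "com \<Rightarrow> instr list" where
  "compile c = Const ONE 1 # ccode c 6 1"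

definition init_store :: "nat list \<Rightarrow> store" where
  "init_store xs = \<lparr>vars = (\<lambda>_. 0), arrs = (\<lambda>_ _. 0), ins = xs\<rparr>"

text \<open>After \<open>T\<close> steps of the loop language every register is at most
  \<open>cap (N + T)\<close>. Only the bit length of this number multiplies the instruction count,
  so an exponential \<open>T\<close> loses a mere polynomial factor.\<close>

theorem compile_decides:
  assumes "\<forall>v\<in>set xs. v \<le> N" "vars (sem c (init_store xs)) VRes = of_bool b"
    "csteps c (init_store xs) \<le> T"
    "real ((40 * T + 1) * (2 * bits (cap (N + T)))) \<le> Tr"
  shows "decides_in_time (compile c) xs b Tr"
proof -
  let ?P = "compile c" and ?S = "init_store xs" and ?Z = "cap (N + T)"
  define R where "R = (\<lambda>_::nat. 0::nat)(ONE := 1)"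
  have 1: "run ?P ?Z (init_config xs) 1 \<lparr>pc = 1, regs = R, inp = xs\<rparr>"
    unfolding init_config_def
    by (rule run_block[where c = "[Const ONE 1]"]) (auto simp: compile_def cap_def R_def)
  have c: "code_at ?P 1 (ccode c 6 1)" by (auto simp: compile_def code_at_def)
  have R: "rep ?Z (vars ?S) (arrs ?S) R"
    by (auto simp: rep_def init_store_def R_def cap_def)
  have "store_le N ?S" using assms(1) by (simp add: store_le_def init_store_def bounded_by_def)
  from ccode_run[OF c _ R this] assms(3)
  obtain R' j where 2: "run ?P ?Z \<lparr>pc = 1, regs = R, inp = xs\<rparr> j
      \<lparr>pc = 1 + length (ccode c 6 1), regs = R', inp = ins (sem c ?S)\<rparr>"
    "j \<le> 40 * csteps c ?S" "rep ?Z (vars (sem c ?S)) (arrs (sem c ?S)) R'"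
    by (auto simp: init_store_def)
  obtain t where t: "exec ?P (init_config xs) t
      \<lparr>pc = 1 + length (ccode c 6 1), regs = R', inp = ins (sem c ?S)\<rparr>" "t \<le> (1 + j) * (2 * bits ?Z)"
    using run_exec[OF run_trans[OF 1 2(1)]] by (auto simp: compile_def)
  \<comment> \<open>The code of \<open>VRes\<close> is 0, so its register is the one where the
    answer is expected.\<close>
  have "R' 0 = of_bool b" using 2(3) assms(2) by (auto simp: rep_def vnum_def dest!: spec[of _ VRes])
  moreover have "t \<le> (40 * T + 1) * (2 * bits ?Z)"
    using 2(2) assms(3) by (intro order_trans[OF t(2)] mult_right_mono) auto
  then have "real t \<le> Tr" using assms(4) by (meson of_nat_le_iff order_trans)
  ultimately show ?thesis using t(1) unfolding decides_in_time_def 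
    by (intro exI[of _ t] exI[of _ "\<lparr>pc = 1 + length (ccode c 6 1), regs = R', inp = ins (sem c ?S)\<rparr>"] conjI)
      simp_all
qed


section \<open>Reasoning about loop programs\<close>

primrec mods :: "com \<Rightarrow> vr set" where
  "mods Skip = {}"
| "mods (Assign x t) = {x}"
| "mods (Inc x) = {x}"
| "mods (Put a x y) = {}"
| "mods (Input x) = {x}"
| "mods (Seq c d) = mods c \<union> mods d"
| "mods (Cond f c d) = mods c \<union> mods d"
| "mods (Loop x b c) = insert x (mods c)"
| "mods (Find x b f) = {x}"

primrec amods :: "com \<Rightarrow> arr set" where
  "amods Skip = {}"
| "amods (Assign x t) = {}"
| "amods (Inc x) = {}"
| "amods (Put a x y) = {a}"
| "amods (Input x) = {}"
| "amods (Seq c d) = amods c \<union> amods d"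
| "amods (Cond f c d) = amods c \<union> amods d"
| "amods (Loop x b c) = amods c"
| "amods (Find x b f) = {}"

lemma iter_invariant:
  assumes "I 0 S" "\<And>i S. i < k \<Longrightarrow> I i S \<Longrightarrow> I (Suc i) (f i S)"
  shows "I k (iter f k S)"
  using assms(2) by (induction k) (auto intro: assms(1))

lemma vars_sem: "x \<notin> mods c \<Longrightarrow> vars (sem c S) x = vars S x"
proof (induction c arbitrary: S)
  case (Loop y b c)
  have "vars (iter (\<lambda>i S. sem c (setv y i S)) k S) x = vars S x" for k
    by (rule iter_invariant) (use Loop in auto)
  then show ?case by simp
qed auto

lemma arrs_sem: "a \<notin> amods c \<Longrightarrow> arrs (sem c S) a = arrs S a"
proof (induction c arbitrary: S)
  case (Loop y b c)
  have "arrs (iter (\<lambda>i S. sem c (setv y i S)) k S) a = arrs S a" for k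
    by (rule iter_invariant) (use Loop in auto)
  then show ?case by simp
qed auto

section \<open>Step counts as polynomials in a common bound\<close>

primrec fbounds :: "fm \<Rightarrow> vr set" where
  "fbounds (Eq t u) = {}"
| "fbounds (Neg f) = fbounds f"
| "fbounds (And f g) = fbounds f \<union> fbounds g"
| "fbounds (Ex x b f) = insert b (fbounds f)"

primrec cbounds :: "com \<Rightarrow> vr set" where
  "cbounds Skip = {}"
| "cbounds (Assign x t) = {}"
| "cbounds (Inc x) = {}"
| "cbounds (Put a x y) = {}"
| "cbounds (Input x) = {}"
| "cbounds (Seq c d) = cbounds c \<union> cbounds d"
| "cbounds (Cond f c d) = fbounds f \<union> cbounds c \<union> cbounds d"
| "cbounds (Loop x b c) = insert b (cbounds c)"
| "cbounds (Find x b f) = insert b (fbounds f)"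

primrec fpoly :: "fm \<Rightarrow> nat \<Rightarrow> nat" where
  "fpoly (Eq t u) N = tsteps t + tsteps u"
| "fpoly (Neg f) N = Suc (fpoly f N)"
| "fpoly (And f g) N = Suc (fpoly f N + fpoly g N)"
| "fpoly (Ex x b f) N = Suc (N * Suc (fpoly f N))"

primrec cpoly :: "com \<Rightarrow> nat \<Rightarrow> nat" where
  "cpoly Skip N = 0"
| "cpoly (Assign x t) N = tsteps t"
| "cpoly (Inc x) N = 1"
| "cpoly (Put a x y) N = 1"
| "cpoly (Input x) N = 1"
| "cpoly (Seq c d) N = cpoly c N + cpoly d N"
| "cpoly (Cond f c d) N = Suc (fpoly f N + (cpoly c N + cpoly d N))"
| "cpoly (Loop x b c) N = Suc (N * Suc (cpoly c N))"
| "cpoly (Find x b f) N = Suc (Suc (N * Suc (fpoly f N)))"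

lemma sum_le_const: "k \<le> N \<Longrightarrow> (\<And>i. i < k \<Longrightarrow> s i \<le> c) \<Longrightarrow> (\<Sum>i<k. s i) \<le> N * (c::nat)"
  using sum_bounded_above[of "{..<k}" s c] mult_le_mono1[of k N c] by (simp add: order_trans)

lemma fsteps_le: "\<forall>b\<in>fbounds f. e b \<le> N \<Longrightarrow> fsteps f e \<le> fpoly f N"
proof (induction f arbitrary: e)
  case (Ex x b f)
  have "(\<Sum>i<e b. Suc (fsteps f (e(x := i)))) \<le> N * Suc (fpoly f N)"
    by (rule sum_le_const) (use Ex in \<open>auto intro!: Ex.IH\<close>)
  then show ?case by simp
qed (auto intro: add_mono)

text \<open>If no variable that bounds a loop or quantifier is ever assigned, all bounds keep their
  initial values, and nesting turns into multiplication by \<open>N\<close>. Parts that compute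
  their own bounds are counted separately.\<close>

lemma csteps_le:
  "cbounds c \<inter> mods c = {} \<Longrightarrow> \<forall>b\<in>cbounds c. vars S b \<le> N \<Longrightarrow> csteps c S \<le> cpoly c N"
proof (induction c arbitrary: S)
  case (Seq c d)
  have "csteps c S \<le> cpoly c N" by (rule Seq.IH) (use Seq.prems in auto)
  moreover have "csteps d (sem c S) \<le> cpoly d N"
    by (rule Seq.IH) (use Seq.prems vars_sem[of _ c S] in fastforce)+
  ultimately show ?case by simp
next
  case (Cond f c d)
  have "csteps c S \<le> cpoly c N" "csteps d S \<le> cpoly d N" "fsteps f (vars S) \<le> fpoly f N"
    by (intro Cond.IH fsteps_le; use Cond.prems in auto)+
  then show ?case by simp
next
  case (Loop x b c)
  let ?I = "\<lambda>k. iter (\<lambda>i S. sem c (setv x i S)) k S"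
  have v: "vars (?I k) y = vars S y" if "y \<notin> insert x (mods c)" for y k
    by (rule iter_invariant) (use that in \<open>auto simp: vars_sem\<close>)
  have "csteps c (setv x k (?I k)) \<le> cpoly c N" for k
  proof (rule Loop.IH)
    show "\<forall>b\<in>cbounds c. vars (setv x k (?I k)) b \<le> N"
    proof
      fix b' assume b: "b' \<in> cbounds c"
      then have "b' \<notin> insert x (mods c)" using Loop.prems by auto
      with b show "vars (setv x k (?I k)) b' \<le> N" using v Loop.prems(2) by auto
    qed
  qed (use Loop.prems in auto)
  then have "(\<Sum>k<vars S b. Suc (csteps c (setv x k (?I k)))) \<le> N * Suc (cpoly c N)"
    by (intro sum_le_const) (use Loop.prems in auto)
  then show ?case by simp
next
  case (Find x b f)
  then show ?case using fsteps_le[of "Ex x b f" "vars S" N] by simp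
qed auto

definition poly_bounded :: "(nat \<Rightarrow> nat) \<Rightarrow> bool" where
  "poly_bounded f \<longleftrightarrow> (\<exists>C d. \<forall>N. f N \<le> C * (N + 1) ^ d)"

lemma poly_bounded_const: "poly_bounded (\<lambda>_. c)"
  unfolding poly_bounded_def by (intro exI[of _ c] exI[of _ 0]) simp

lemma poly_bounded_id: "poly_bounded (\<lambda>N. N)"
  unfolding poly_bounded_def by (intro exI[of _ 1] exI[of _ 1]) simp

lemma poly_bounded_add:
  assumes "poly_bounded f" "poly_bounded g"
  shows "poly_bounded (\<lambda>N. f N + g N)"
proof -
  obtain C d C' d' where *: "\<And>N. f N \<le> C * (N + 1) ^ d" "\<And>N. g N \<le> C' * (N + 1) ^ d'"
    using assms by (auto simp: poly_bounded_def)
  have "f N + g N \<le> (C + C') * (N + 1) ^ (d + d')" for N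
  proof -
    have "f N \<le> C * (N + 1) ^ (d + d')" "g N \<le> C' * (N + 1) ^ (d + d')"
      by (rule order_trans[OF *(1)] order_trans[OF *(2)]; intro mult_left_mono power_increasing; simp)+
    then show ?thesis by (simp add: add_mult_distrib)
  qed
  then show ?thesis unfolding poly_bounded_def by blast
qed

lemma poly_bounded_mult:
  assumes "poly_bounded f" "poly_bounded g"
  shows "poly_bounded (\<lambda>N. f N * g N)"
proof -
  obtain C d C' d' where *: "\<And>N. f N \<le> C * (N + 1) ^ d" "\<And>N. g N \<le> C' * (N + 1) ^ d'"
    using assms by (auto simp: poly_bounded_def)
  have "f N * g N \<le> (C * C') * (N + 1) ^ (d + d')" for N
    using mult_mono[OF *[of N]] by (simp add: power_add mult_ac)
  then show ?thesis unfolding poly_bounded_def by blast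
qed

lemma poly_bounded_Suc: "poly_bounded f \<Longrightarrow> poly_bounded (\<lambda>N. Suc (f N))"
  using poly_bounded_add[OF poly_bounded_const[of 1]] by simp

lemmas poly_bounded_intros =
  poly_bounded_const poly_bounded_id poly_bounded_add poly_bounded_mult poly_bounded_Suc

lemma poly_bounded_fpoly: "poly_bounded (fpoly f)"
proof -
  have "poly_bounded (\<lambda>N. fpoly f N)" by (induction f) (auto intro!: poly_bounded_intros)
  then show ?thesis by simp
qed

lemma poly_bounded_cpoly: "poly_bounded (cpoly c)"
proof -
  have "poly_bounded (\<lambda>N. cpoly c N)"
    by (induction c) (auto intro!: poly_bounded_intros poly_bounded_fpoly)
  then show ?thesis by simp
qed

section \<open>Blocks of variables: overriding, quantifying, searching\<close>

fun upds :: "('a \<Rightarrow> 'b) \<Rightarrow> 'a list \<Rightarrow> 'b list \<Rightarrow> 'a \<Rightarrow> 'b" where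
  "upds f (x # xs) (y # ys) = upds (f(x := y)) xs ys"
| "upds f _ _ = f"

lemma upds_outside: "x \<notin> set xs \<Longrightarrow> upds f xs ys x = f x"
  by (induction f xs ys rule: upds.induct) auto

lemma upds_map: "upds f xs (map g xs) x = (if x \<in> set xs then g x else f x)"
  by (induction xs arbitrary: f) (auto simp: upds_outside)

lemma map_upds: "distinct xs \<Longrightarrow> length xs = length ys \<Longrightarrow> map (upds f xs ys) xs = ys"
  by (induction f xs ys rule: upds.induct) (auto simp: upds_outside cong: map_cong)

lemma upds_values: "length xs = length ys \<Longrightarrow> upds f xs ys x = f x \<and> x \<notin> set xs \<or> upds f xs ys x \<in> set ys"
  by (induction f xs ys rule: upds.induct) (auto split: if_splits)

definition tuples :: "nat \<Rightarrow> nat \<Rightarrow> nat list set" where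
  "tuples k b = {ys. length ys = k \<and> (\<forall>y\<in>set ys. y < b)}"

primrec exs :: "vr list \<Rightarrow> vr \<Rightarrow> fm \<Rightarrow> fm" where
  "exs [] b f = f"
| "exs (x # xs) b f = Ex x b (exs xs b f)"

lemma bex_tuples_Suc: "(\<exists>ys\<in>tuples (Suc k) b. P ys) \<longleftrightarrow> (\<exists>y<b. \<exists>ys\<in>tuples k b. P (y # ys))"
  by (fastforce simp: tuples_def length_Suc_conv)

lemma holds_exs:
  "b \<notin> set xs \<Longrightarrow>
    holds (exs xs b f) e m \<longleftrightarrow> (\<exists>ys\<in>tuples (length xs) (e b). holds f (upds e xs ys) m)"
  by (induction xs arbitrary: e) (auto simp: bex_tuples_Suc simp del: fun_upd_apply, auto simp: tuples_def)

primrec finds :: "vr list \<Rightarrow> vr \<Rightarrow> fm \<Rightarrow> com" where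
  "finds [] b f = Skip"
| "finds (x # xs) b f = Seq (Find x b (exs xs b f)) (finds xs b f)"

text \<open>The tuple computed by \<open>finds\<close>: coordinates are fixed one by one, each to
  the last value that can still be completed. With the choice given as a function, the branching
  process becomes a function too.\<close>

primrec wit :: "nat \<Rightarrow> nat \<Rightarrow> (nat list \<Rightarrow> bool) \<Rightarrow> nat list" where
  "wit 0 b P = []"
| "wit (Suc k) b P =
     (let y = last_wit b (\<lambda>y. \<exists>ys\<in>tuples k b. P (y # ys)) - 1 in y # wit k b (\<lambda>ys. P (y # ys)))"

lemma length_wit [simp]: "length (wit k b P) = k"
  by (induction k arbitrary: P) (auto simp: Let_def)

lemma wit_sat: "\<exists>ys\<in>tuples k b. P ys \<Longrightarrow> wit k b P \<in> tuples k b \<and> P (wit k b P)"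
proof (induction k arbitrary: P)
  case 0
  then show ?case by (auto simp: tuples_def)
next
  case (Suc k)
  then have "\<exists>y<b. \<exists>ys\<in>tuples k b. P (y # ys)" by (simp add: bex_tuples_Suc)
  from last_wit_sat[OF this] Suc.IH[of "\<lambda>ys. P (_ # ys)"]
  show ?case by (auto simp: Let_def tuples_def)
qed

text \<open>Lets a search evaluate a function that is given by its graph; it serves for the table of
  replacement colors.\<close>

lemma wit_unique:
  assumes "ys \<in> tuples k b" "\<And>zs. length zs = k \<Longrightarrow> P zs \<longleftrightarrow> zs = ys"
  shows "wit k b P = ys"
  using wit_sat[of k b P] assms by (auto simp: tuples_def)

lemma wit_cong: "(\<And>ys. length ys = k \<Longrightarrow> P ys = P' ys) \<Longrightarrow> wit k b P = wit k b P'"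
proof (induction k arbitrary: P P')
  case (Suc k)
  have "(\<exists>ys\<in>tuples k b. P (y # ys)) = (\<exists>ys\<in>tuples k b. P' (y # ys))" for y
    using Suc.prems by (auto simp: tuples_def)
  moreover have "wit k b (\<lambda>ys. P (y # ys)) = wit k b (\<lambda>ys. P' (y # ys))" for y
    by (rule Suc.IH) (use Suc.prems in auto)
  ultimately show ?case by (simp add: Let_def)
qed simp

lemma sem_finds:
  "b \<notin> set xs \<Longrightarrow> sem (finds xs b f) S = S\<lparr>vars := upds (vars S) xs
    (wit (length xs) (vars S b) (\<lambda>ys. holds f (upds (vars S) xs ys) (arrs S)))\<rparr>"
proof (induction xs arbitrary: S)
  case (Cons x xs)
  let ?y = "last_wit (vars S b) (\<lambda>y. \<exists>ys\<in>tuples (length xs) (vars S b).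
     holds f (upds ((vars S)(x := y)) xs ys) (arrs S)) - 1"
  have "sem (Find x b (exs xs b f)) S = setv x ?y S"
    using Cons.prems by (simp add: holds_exs)
  then show ?case using Cons by (simp add: Let_def setv_def)
qed simp

lemma mods_finds [simp]: "mods (finds xs b f) = set xs"
  by (induction xs) auto

lemma amods_finds [simp]: "amods (finds xs b f) = {}"
  by (induction xs) auto

lemma fbounds_exs: "fbounds (exs xs b f) \<subseteq> insert b (fbounds f)"
  by (induction xs) auto

lemma cbounds_finds: "cbounds (finds xs b f) \<subseteq> insert b (fbounds f)"
  using fbounds_exs by (induction xs) fastforce+

section \<open>Derived formulas and array writes\<close>

primrec conjs :: "fm list \<Rightarrow> fm" where
  "conjs [] = Eq (TN 0) (TN 0)"
| "conjs (f # fs) = And f (conjs fs)"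

definition Or :: "fm \<Rightarrow> fm \<Rightarrow> fm" where "Or f g = Neg (And (Neg f) (Neg g))"

definition disjs :: "fm list \<Rightarrow> fm" where "disjs fs = Neg (conjs (map Neg fs))"

lemma holds_conjs [simp]: "holds (conjs fs) e m \<longleftrightarrow> (\<forall>f\<in>set fs. holds f e m)"
  by (induction fs) auto

lemma holds_disjs [simp]: "holds (disjs fs) e m \<longleftrightarrow> (\<exists>f\<in>set fs. holds f e m)"
  by (auto simp: disjs_def)

lemma holds_Or [simp]: "holds (Or f g) e m \<longleftrightarrow> holds f e m \<or> holds g e m"
  by (auto simp: Or_def)

lemma fbounds_conjs [simp]: "fbounds (conjs fs) = (\<Union>f\<in>set fs. fbounds f)"
  by (induction fs) auto

lemma fbounds_disjs [simp]: "fbounds (disjs fs) = (\<Union>f\<in>set fs. fbounds f)"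
  by (simp add: disjs_def)

lemma fbounds_Or [simp]: "fbounds (Or f g) = fbounds f \<union> fbounds g"
  by (simp add: Or_def)

fun puts :: "arr \<Rightarrow> vr list \<Rightarrow> vr list \<Rightarrow> com" where
  "puts a (x # xs) (y # ys) = Seq (Put a x y) (puts a xs ys)"
| "puts a _ _ = Skip"

lemma sem_puts:
  "sem (puts a xs ys) S =
     S\<lparr>arrs := (arrs S)(a := upds (arrs S a) (map (vars S) xs) (map (vars S) ys))\<rparr>"
  by (induction a xs ys arbitrary: S rule: puts.induct) auto

lemma puts_simps [simp]:
  "mods (puts a xs ys) = {}" "amods (puts a xs ys) \<subseteq> {a}" "cbounds (puts a xs ys) = {}"
  by (induction a xs ys rule: puts.induct) auto

text \<open>Base \<open>B\<close> expansion: one counter below \<open>B ^ k\<close> meets every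
  sequence of \<open>k\<close> choices. The lowest digit is split off, and the induction shifts
  \<open>g\<close>.\<close>

lemma digits_surj:
  assumes "\<And>i. i < k \<Longrightarrow> g i < B"
  shows "\<exists>t<B ^ k. \<forall>i<k. t div B ^ i mod B = (g i :: nat)"
  using assms
proof (induction k arbitrary: g)
  case (Suc k)
  obtain t where t: "t < B ^ k" "\<And>i. i < k \<Longrightarrow> t div B ^ i mod B = g (Suc i)"
    using Suc.IH[of "\<lambda>i. g (Suc i)"] Suc.prems by auto
  have g: "g 0 < B" using Suc.prems by simp
  have "B * t + g 0 < B * Suc t" using g by simp
  also have "\<dots> \<le> B * B ^ k" using t(1) by (intro mult_left_mono) auto
  finally have "B * t + g 0 < B ^ Suc k" by simp
  moreover have "(B * t + g 0) div B ^ i mod B = g i" if "i < Suc k" for i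
  proof (cases i)
    case 0 then show ?thesis using g by simp
  next
    case (Suc j)
    have "(B * t + g 0) div B ^ i = (B * t + g 0) div B div B ^ j"
      by (simp add: Suc div_mult2_eq)
    also have "\<dots> = t div B ^ j" using g by simp
    finally show ?thesis using t(2)[of j] Suc that by simp
  qed
  ultimately show ?case by blast
qed simp


section \<open>Branching on violated constraints\<close>

text \<open>
  Partial colorings of the vertices \<open>0, \<dots>, n - 1\<close> are functions \<open>A\<close> with \<open>A v = 0\<close> for uncolored \<open>v\<close>.
\<close>

definition local_ok ::
  "nat \<Rightarrow> (nat \<Rightarrow> nat \<Rightarrow> bool) \<Rightarrow> (nat \<Rightarrow> nat set) \<Rightarrow> (nat \<Rightarrow> nat) \<Rightarrow> nat list \<Rightarrow> nat list \<Rightarrow> bool" where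
  "local_ok n E L A ws ds \<longleftrightarrow> (\<forall>i<length ws.
     ds ! i \<in> L (ws ! i) \<and> (A (ws ! i) = 0 \<or> A (ws ! i) = ds ! i) \<and>
     (\<forall>y<n. E (ws ! i) y \<longrightarrow> A y \<noteq> ds ! i) \<and>
     (\<forall>j<length ws. E (ws ! i) (ws ! j) \<longrightarrow> ds ! i \<noteq> ds ! j))"

text \<open>Tuples with repetition stand for all nonempty sets of at most \<open>s\<close> vertices,
  connected or not. A repeated vertex may get different colors in \<open>ds\<close>; this does no
  harm, since the constraints hold between all positions and any of these colors can be
  selected.\<close>

definition viol ::
  "nat \<Rightarrow> nat \<Rightarrow> (nat \<Rightarrow> nat \<Rightarrow> bool) \<Rightarrow> (nat \<Rightarrow> nat set) \<Rightarrow> nat \<Rightarrow> (nat \<Rightarrow> nat) \<Rightarrow> bool" where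
  "viol q n E L s A \<longleftrightarrow> (\<exists>ws\<in>tuples s n. \<not> (\<exists>ds\<in>tuples s (Suc q). local_ok n E L A ws ds))"

text \<open>The \<open>g\<close>-th way to color the chosen vertices differently from the violating
  colors \<open>cs\<close>. Removing this one entry makes the base \<open>q ^ k - 1\<close> instead
  of \<open>q ^ k\<close>.\<close>

definition color_table :: "nat \<Rightarrow> nat \<Rightarrow> nat list \<Rightarrow> nat \<Rightarrow> nat list" where
  "color_table q k cs g = remove1 cs (List.n_lists k [1..<Suc q]) ! g"

lemma enumerate_set:
  assumes "finite C" "C \<noteq> {}" "card C \<le> k"
  shows "\<exists>ws. length ws = k \<and> set ws = C"
proof -
  obtain xs where xs: "set xs = C" "distinct xs" using finite_distinct_list assms(1) by blast
  then have "length xs \<le> k" using assms(3) distinct_card by fastforce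
  then have "length (xs @ replicate (k - length xs) (hd xs)) = k" by simp
  moreover have "set (xs @ replicate (k - length xs) (hd xs)) = C" using xs assms(2) by auto
  ultimately show ?thesis by blast
qed

locale hub_instance =
  fixes q n \<sigma> \<delta> :: nat and G :: "nat graph" and L :: "nat \<Rightarrow> nat set" and Q :: "nat set"
  assumes inst: "list_coloring_instance q G L" and verts: "verts G = {0..<n}"
    and hub: "hub \<sigma> \<delta> G Q"
begin

definition E :: "nat \<Rightarrow> nat \<Rightarrow> bool" where "E u v \<longleftrightarrow> {u, v} \<in> edges G"

abbreviation "D \<equiv> max \<delta> 2"
abbreviation "table \<equiv> color_table q D"
abbreviation "vi \<equiv> viol q n E L (Suc \<sigma>)"

definition coloring :: "(nat \<Rightarrow> nat) \<Rightarrow> bool" where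
  "coloring \<psi> \<longleftrightarrow> (\<forall>v<n. \<psi> v \<in> L v) \<and> (\<forall>u v. E u v \<longrightarrow> \<psi> u \<noteq> \<psi> v)"

lemma colorable_iff: "list_colorable G L \<longleftrightarrow> (\<exists>\<psi>. coloring \<psi>)"
  by (simp add: list_colorable_def coloring_def verts E_def Ball_def)

lemma E_sym: "E u v \<Longrightarrow> E v u"
  by (simp add: E_def insert_commute)

lemma E_less: "E u v \<Longrightarrow> u < n \<and> v < n"
  using inst verts by (auto simp: E_def list_coloring_instance_def simple_graph_def)

lemma L_range: "v < n \<Longrightarrow> c \<in> L v \<Longrightarrow> 0 < c \<and> c \<le> q"
  using inst verts by (fastforce simp: list_coloring_instance_def)

lemma Q_less: "y \<in> Q \<Longrightarrow> y < n"
  using hub verts by (auto simp: hub_def)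

lemma finite_Q: "finite Q"
  using Q_less by (meson finite_lessThan finite_subset lessThan_iff subsetI)

lemma not_viol_of_coloring:
  assumes "coloring \<psi>" "\<And>y. y < n \<Longrightarrow> A y \<noteq> 0 \<Longrightarrow> \<psi> y = A y"
  shows "\<not> vi A"
proof -
  have "map \<psi> ws \<in> tuples (Suc \<sigma>) (Suc q)" "local_ok n E L A ws (map \<psi> ws)"
    if ws: "ws \<in> tuples (Suc \<sigma>) n" for ws
  proof -
    have \<psi>: "\<psi> v \<in> L v" "0 < \<psi> v" "\<psi> v \<le> q" if "v < n" for v
      using assms(1) L_range that by (auto simp: coloring_def)
    show "map \<psi> ws \<in> tuples (Suc \<sigma>) (Suc q)"
      using ws \<psi> by (auto simp: tuples_def less_Suc_eq_le)
    show "local_ok n E L A ws (map \<psi> ws)"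
      unfolding local_ok_def
    proof (intro allI impI conjI)
      fix i assume i: "i < length ws"
      then have wi: "ws ! i < n" using ws by (auto simp: tuples_def)
      show "map \<psi> ws ! i \<in> L (ws ! i)" using i wi \<psi> by simp
      show "A (ws ! i) = 0 \<or> A (ws ! i) = map \<psi> ws ! i" using i wi assms(2)[of "ws ! i"] by (cases "A (ws ! i) = 0") auto
      show "A y \<noteq> map \<psi> ws ! i" if "y < n" "E (ws ! i) y" for y
        using that i wi assms \<psi>(2)[of "ws ! i"] by (cases "A y = 0") (auto simp: coloring_def, metis)
      show "map \<psi> ws ! i \<noteq> map \<psi> ws ! j" if "j < length ws" "E (ws ! i) (ws ! j)" for j
        using that i assms(1) by (auto simp: coloring_def)
    qed
  qed
  then show ?thesis by (auto simp: viol_def)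
qed

text \<open>Coloring more vertices only adds constraints to the local tests. Read contrapositively,
  an unviolated coloring has unviolated restrictions.\<close>

lemma viol_mono:
  assumes "vi A" "\<And>y. y < n \<Longrightarrow> A y \<noteq> 0 \<Longrightarrow> A' y = A y"
  shows "vi A'"
proof -
  have "local_ok n E L A ws ds"
    if ok: "local_ok n E L A' ws ds" and ws: "ws \<in> tuples (Suc \<sigma>) n" for ws ds
    unfolding local_ok_def
  proof (intro allI impI conjI)
    fix i assume i: "i < length ws"
    then have wi: "ws ! i < n" using ws by (auto simp: tuples_def)
    show "ds ! i \<in> L (ws ! i)" using ok i by (auto simp: local_ok_def)
    show "A (ws ! i) = 0 \<or> A (ws ! i) = ds ! i" using ok i wi assms(2)[of "ws ! i"]
      by (cases "A (ws ! i) = 0") (auto simp: local_ok_def)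
    show "A y \<noteq> ds ! i" if "y < n" "E (ws ! i) y" for y
    proof (cases "A y = 0")
      \<comment> \<open>The value 0 marks an uncolored neighbor, and no list contains 0.\<close>
      case True
      then show ?thesis using ok i L_range[OF wi] by (auto simp: local_ok_def)
    next
      case False
      then show ?thesis using ok i that assms(2)[OF that(1) False] by (auto simp: local_ok_def)
    qed
    show "ds ! i \<noteq> ds ! j" if "j < length ws" "E (ws ! i) (ws ! j)" for j
      using ok i that by (auto simp: local_ok_def)
  qed
  then show ?thesis using assms(1) by (auto simp: viol_def)
qed

section \<open>Extending hub colorings over the components\<close>

abbreviation "conn \<equiv> connected_rel (delete_verts G Q)"

lemma equiv_conn: "equiv ({0..<n} - Q) conn"
proof (rule equivI)
  let ?R = "{(u, v). {u, v} \<in> edges (delete_verts G Q)}"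
  have "sym (?R\<^sup>*)" by (rule sym_rtrancl) (auto simp: sym_def insert_commute)
  then show "sym conn" by (auto simp: connected_rel_def sym_def)
  show "trans conn" unfolding connected_rel_def
    by (rule transI) (auto intro: rtrancl_trans)
  show "refl_on ({0..<n} - Q) conn"
    by (auto simp: refl_on_def connected_rel_def delete_verts_def verts)
  show "conn \<subseteq> ({0..<n} - Q) \<times> ({0..<n} - Q)"
    by (auto simp: connected_rel_def delete_verts_def verts)
qed

text \<open>A component sees at most \<delta> hub vertices, so the test with \<open>A\<close>
  restricted to these already yields a coloring of it that respects the hub. Different components
  are not adjacent, hence the pieces fit together. The hypothesis speaks of restrictions to
  \<open>D\<close> vertices, which is all that is known in the stuck case.\<close>

lemma glue:
  assumes A: "\<And>y. y \<in> Q \<Longrightarrow> A y \<noteq> 0"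
    and ok: "\<And>Y. Y \<subseteq> Q \<Longrightarrow> card Y \<le> D \<Longrightarrow> \<not> vi (\<lambda>y. if y \<in> Y then A y else 0)"
  shows "\<exists>\<psi>. coloring \<psi> \<and> (\<forall>y\<in>Q. \<psi> y = A y)"
proof -
  define cls where "cls v = conn `` {v}" for v
  define nice where "nice C f \<longleftrightarrow> (\<forall>v\<in>C. f v \<in> L v \<and> (\<forall>y\<in>Q. E v y \<longrightarrow> A y \<noteq> f v) \<and>
      (\<forall>w\<in>C. E v w \<longrightarrow> f v \<noteq> f w))" for C and f :: "nat \<Rightarrow> nat"
  have cls: "v \<in> cls v" "cls v \<subseteq> {0..<n} - Q" "\<exists>f. nice (cls v) f" if v: "v < n" "v \<notin> Q" for v
  proof -
    let ?C = "cls v" and ?Y = "{x\<in>Q. \<exists>c\<in>cls v. {c, x} \<in> edges G}"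
    show vC: "v \<in> ?C" unfolding cls_def by (rule equiv_class_self[OF equiv_conn]) (use v in auto)
    show CV: "?C \<subseteq> {0..<n} - Q" using equiv_conn by (auto simp: cls_def equiv_def refl_on_def)
    have "?C \<in> components (delete_verts G Q)"
      using v by (auto simp: components_def cls_def delete_verts_def verts intro: quotientI)
    then have C: "card ?C \<le> \<sigma>" "card ?Y \<le> \<delta>" using hub by (auto simp: hub_def)
    have "finite ?C" using CV finite_subset by blast
    then obtain ws where ws: "length ws = Suc \<sigma>" "set ws = ?C"
      using enumerate_set[of ?C "Suc \<sigma>"] vC C(1) by auto
    then have "ws \<in> tuples (Suc \<sigma>) n" using CV by (auto simp: tuples_def)
    moreover have "\<not> vi (\<lambda>y. if y \<in> ?Y then A y else 0)" by (rule ok) (use C(2) in auto)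
    ultimately obtain ds where ds: "local_ok n E L (\<lambda>y. if y \<in> ?Y then A y else 0) ws ds"
      by (auto simp: viol_def)
    \<comment> \<open>A vertex can occur in \<open>ws\<close> with several colors; its first
      occurrence decides.\<close>
    define f where "f u = ds ! (LEAST i. ws ! i = u \<and> i < Suc \<sigma>)" for u
    have f: "\<exists>i<length ws. ws ! i = u \<and> f u = ds ! i" if "u \<in> ?C" for u
    proof -
      have "\<exists>i. ws ! i = u \<and> i < Suc \<sigma>" using that ws by (metis in_set_conv_nth)
      from LeastI_ex[OF this] show ?thesis using ws by (auto simp: f_def)
    qed
    have "nice ?C f" unfolding nice_def
    proof (intro ballI conjI impI)
      fix u assume u: "u \<in> ?C"
      then obtain i where i: "i < length ws" "ws ! i = u" "f u = ds ! i" using f by blast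
      show "f u \<in> L u" using ds i by (auto simp: local_ok_def)
      show "A y \<noteq> f u" if "y \<in> Q" "E u y" for y
      proof -
        have "y \<in> ?Y" using that u by (auto simp: E_def)
        moreover have "(if y \<in> ?Y then A y else 0) \<noteq> ds ! i"
          using ds i that Q_less[of y] unfolding local_ok_def by blast
        ultimately show ?thesis using i by simp
      qed
      show "f u \<noteq> f w" if "w \<in> ?C" "E u w" for w
        using f[OF that(1)] ds i that(2) by (auto simp: local_ok_def)
    qed
    then show "\<exists>f. nice ?C f" by blast
  qed
  \<comment> \<open>The choice depends on the class as a set, so adjacent vertices outside the hub
    use the same local coloring.\<close>
  define h where "h C = (SOME f. nice C f)" for C
  have h: "nice (cls v) (h (cls v))" if "v < n" "v \<notin> Q" for v
    using someI_ex[OF cls(3)[OF that]] by (simp add: h_def)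
  define \<psi> where "\<psi> v = (if v \<in> Q then A v else h (cls v) v)" for v
  have hubv: "A y \<in> L y" "\<And>z. z \<in> Q \<Longrightarrow> E y z \<Longrightarrow> A y \<noteq> A z" if y: "y \<in> Q" for y
  proof -
    have *: "A y \<in> L y \<and> (z \<in> Q \<longrightarrow> E y z \<longrightarrow> A y \<noteq> A z)" for z
    proof -
      \<comment> \<open>A constant tuple tests the single vertex \<open>y\<close>: its color must be
        \<open>A y\<close>, lie in its list and differ from the color of \<open>z\<close>. This
        involves two hub vertices, hence the maximum with 2 in \<open>D\<close>.\<close>
      let ?Y = "{y, z} \<inter> Q"
      have "card ?Y \<le> card {y, z}" by (rule card_mono) auto
      also have "\<dots> \<le> 2" by (simp add: card_insert_if)
      finally have "\<not> vi (\<lambda>x. if x \<in> ?Y then A x else 0)" by (intro ok) auto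
      moreover have "replicate (Suc \<sigma>) y \<in> tuples (Suc \<sigma>) n" using Q_less[OF y] by (simp add: tuples_def)
      ultimately obtain ds where "local_ok n E L (\<lambda>x. if x \<in> ?Y then A x else 0) (replicate (Suc \<sigma>) y) ds"
        unfolding viol_def by blast
      then have "ds ! 0 \<in> L y" "A y = ds ! 0" "\<forall>x<n. E y x \<longrightarrow> (if x \<in> ?Y then A x else 0) \<noteq> ds ! 0"
        using A[OF y] y unfolding local_ok_def by (auto dest!: spec[of _ "0::nat"])
      then show ?thesis using Q_less[of z] by auto
    qed
    show "A y \<in> L y" using * by blast
    show "\<And>z. z \<in> Q \<Longrightarrow> E y z \<Longrightarrow> A y \<noteq> A z" using * by blast
  qed
  have "coloring \<psi>" unfolding coloring_def
  proof (intro conjI allI impI)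
    fix v assume v: "v < n"
    show "\<psi> v \<in> L v"
    proof (cases "v \<in> Q")
      case True then show ?thesis using hubv by (simp add: \<psi>_def)
    next
      case False
      then show ?thesis using h[OF v False] cls(1)[OF v False] by (auto simp: nice_def \<psi>_def)
    qed
  next
    fix u v assume e: "E u v"
    then have n: "u < n" "v < n" and e': "E v u" using E_less E_sym by auto
    have *: "A y \<noteq> h (cls w) w" if "w < n" "w \<notin> Q" "y \<in> Q" "E w y" for w y
      using h[OF that(1,2)] cls(1)[OF that(1,2)] that(3,4) by (auto simp: nice_def)
    consider "u \<in> Q" "v \<in> Q" | "u \<in> Q" "v \<notin> Q" | "u \<notin> Q" "v \<in> Q" | "u \<notin> Q" "v \<notin> Q" by blast
    then show "\<psi> u \<noteq> \<psi> v"
    proof cases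
      case 1 then show ?thesis using hubv(2) e by (simp add: \<psi>_def)
    next
      case 2 then show ?thesis using *[OF n(2) 2(2,1) e'] by (simp add: \<psi>_def)
    next
      case 3 then show ?thesis using *[OF n(1) 3 e] by (simp add: \<psi>_def)
    next
      case 4
      then have "(u, v) \<in> conn"
        using e n by (auto simp: connected_rel_def delete_verts_def verts E_def)
      then have eq: "cls u = cls v" using equiv_conn by (simp add: cls_def equiv_class_eq)
      have "u \<in> cls u" "v \<in> cls u" using cls(1) n 4 eq by auto
      then show ?thesis using h[OF n(1) 4(1)] e eq 4 by (auto simp: nice_def \<psi>_def)
    qed
  qed
  then show ?thesis by (auto simp: \<psi>_def)
qed

lemma colorable_of_not_viol:
  assumes "\<And>y. y \<in> Q \<Longrightarrow> A y \<noteq> 0" "\<not> vi A"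
  shows "list_colorable G L"
proof -
  have "\<exists>\<psi>. coloring \<psi> \<and> (\<forall>y\<in>Q. \<psi> y = A y)"
  proof (rule glue)
    fix Y show "\<not> vi (\<lambda>y. if y \<in> Y then A y else 0)"
      using viol_mono[of "\<lambda>y. if y \<in> Y then A y else 0" A] assms(2) by (metis (full_types))
  qed (rule assms)
  then show ?thesis using colorable_iff by blast
qed

section \<open>The branching rule and its completeness\<close>

definition pat :: "(nat \<Rightarrow> nat) \<Rightarrow> nat list \<Rightarrow> nat list \<Rightarrow> bool" where
  "pat A xs cs \<longleftrightarrow> distinct xs \<and> (\<forall>x\<in>set xs. x \<in> Q \<and> A x = 0) \<and> 0 \<notin> set cs \<and> vi (upds A xs cs)"

text \<open>The color 1 is arbitrary: in the stuck case every completion works, and otherwise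
  \<open>final\<close> overrides the default.\<close>

definition fill :: "(nat \<Rightarrow> nat) \<Rightarrow> nat \<Rightarrow> nat" where
  "fill A y = (if y \<in> Q \<and> A y = 0 then 1 else A y)"

text \<open>One test for both ways in which branching can end. The vertices range up to
  \<open>n\<close>, which is not in the graph: it pads the tuple, so that any number of vertices up
  to \<open>D\<close> can be recolored, including none.\<close>

definition final :: "(nat \<Rightarrow> nat) \<Rightarrow> bool" where
  "final A \<longleftrightarrow> (\<exists>xs\<in>tuples D (Suc n). \<exists>cs\<in>tuples D (Suc q). 0 \<notin> set cs \<and> \<not> vi (upds (fill A) xs cs))"

definition stuck :: "(nat \<Rightarrow> nat) \<Rightarrow> bool" where
  "stuck A \<longleftrightarrow> \<not> (\<exists>xs\<in>tuples D n. \<exists>cs\<in>tuples D (Suc q). pat A xs cs)"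

definition free :: "(nat \<Rightarrow> nat) \<Rightarrow> nat set" where
  "free A = {y \<in> Q. A y = 0}"

lemma finite_free: "finite (free A)"
  using finite_Q by (simp add: free_def)

text \<open>The default and the nonzero overriding colors leave no hub vertex uncolored, so the test
  certifies its answer by itself, wherever \<open>A\<close> comes from.\<close>

lemma final_sound:
  assumes "final A"
  shows "list_colorable G L"
proof -
  obtain xs cs where *: "xs \<in> tuples D (Suc n)" "cs \<in> tuples D (Suc q)" "0 \<notin> set cs"
    "\<not> vi (upds (fill A) xs cs)"
    using assms by (auto simp: final_def)
  have "upds (fill A) xs cs y \<noteq> 0" if "y \<in> Q" for y
  proof
    assume "upds (fill A) xs cs y = 0"
    then show False
      using that upds_values[of xs cs "fill A" y] *(1-3) by (auto simp: tuples_def fill_def split: if_splits)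
  qed
  then show ?thesis using colorable_of_not_viol *(4) by blast
qed

text \<open>Suppose the completion violates a test when restricted to some \<open>Y\<close> of at
  most \<open>D\<close> hub vertices. The uncolored part of \<open>Y\<close> lies in a set of
  exactly \<open>D\<close> uncolored vertices, and their default colors then form a pattern,
  contrary to \<open>stuck\<close>.\<close>

lemma final_of_stuck:
  assumes q: "1 \<le> q" and A: "\<And>y. A y \<noteq> 0 \<Longrightarrow> y \<in> Q \<and> A y \<le> q" and st: "stuck A" and fr: "D \<le> card (free A)"
  shows "final A"
proof -
  have "\<exists>\<psi>. coloring \<psi> \<and> (\<forall>y\<in>Q. \<psi> y = fill A y)"
  proof (rule glue)
    fix Y assume Y: "Y \<subseteq> Q" "card Y \<le> D"
    show "\<not> vi (\<lambda>y. if y \<in> Y then fill A y else 0)"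
    proof
      assume v: "vi (\<lambda>y. if y \<in> Y then fill A y else 0)"
      have "card (Y \<inter> free A) \<le> D"
        using Y finite_subset[OF Y(1) finite_Q] card_mono[of Y "Y \<inter> free A"] by auto
      then obtain X where X: "Y \<inter> free A \<subseteq> X" "X \<subseteq> free A" "card X = D"
        using exists_subset_between[of "Y \<inter> free A" D "free A"] fr finite_free by auto
      then obtain xs where xs: "set xs = X" "distinct xs"
        using finite_distinct_list finite_subset finite_free by metis
      then have len: "length xs = D" using X(3) distinct_card by fastforce
      let ?cs = "map (fill A) xs"
      have fX: "x \<in> Q" "A x = 0" "x < n" "fill A x = 1" if "x \<in> X" for x
        using that X(2) Q_less by (auto simp: free_def fill_def)
      have "xs \<in> tuples D n" "?cs \<in> tuples D (Suc q)"
        using len xs fX q by (auto simp: tuples_def)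
      moreover have "vi (upds A xs ?cs)"
        by (rule viol_mono[OF v]) (use X(1) Y(1) in \<open>auto simp: upds_map xs free_def fill_def split: if_splits\<close>)
      then have "pat A xs ?cs" using xs fX by (auto simp: pat_def)
      ultimately show False using st by (auto simp: stuck_def)
    qed
  qed (auto simp: fill_def)
  then obtain \<psi> where \<psi>: "coloring \<psi>" "\<And>y. y \<in> Q \<Longrightarrow> \<psi> y = fill A y" by blast
  \<comment> \<open>Overriding only the dummy vertex leaves the completion as it is on the
    graph.\<close>
  let ?xs = "replicate D n" and ?cs = "replicate D (1::nat)"
  have "\<not> vi (upds (fill A) ?xs ?cs)"
  proof (rule not_viol_of_coloring[OF \<psi>(1)])
    fix y assume y: "y < n" "upds (fill A) ?xs ?cs y \<noteq> 0"
    then have "upds (fill A) ?xs ?cs y = fill A y" by (intro upds_outside) auto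
    then show "\<psi> y = upds (fill A) ?xs ?cs y" using y(2) \<psi>(2) A by (auto simp: fill_def split: if_splits)
  qed
  then show ?thesis using q unfolding final_def tuples_def by (intro bexI[of _ ?xs] bexI[of _ ?cs]) auto
qed

text \<open>The remaining vertices fit into one tuple, so the test tries, among others, their colors
  under \<open>\<psi>\<close>.\<close>

lemma final_of_few_free:
  assumes \<psi>: "coloring \<psi>" and q: "1 \<le> q" and A: "\<And>y. A y \<noteq> 0 \<Longrightarrow> y \<in> Q \<and> A y = \<psi> y"
    and fr: "card (free A) < D"
  shows "final A"
proof -
  \<comment> \<open>The dummy \<open>n\<close> makes the set nonempty, so that it can be enumerated
    with repetitions; the strict bound on \<open>free A\<close> leaves room for it.\<close>
  have "card (insert n (free A)) \<le> D" using fr finite_free[of A] by (simp add: card_insert_if)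
  then obtain xs where xs: "length xs = D" "set xs = insert n (free A)"
    using enumerate_set[of "insert n (free A)" D] finite_free[of A] by auto
  let ?g = "\<lambda>x. if x < n then \<psi> x else 1"
  let ?cs = "map ?g xs"
  have \<psi>': "0 < \<psi> v \<and> \<psi> v \<le> q" if "v < n" for v
    using \<psi> L_range that by (auto simp: coloring_def)
  have "\<not> vi (upds (fill A) xs ?cs)"
    by (rule not_viol_of_coloring[OF \<psi>])
      (use A xs in \<open>auto simp: upds_map fill_def free_def split: if_splits\<close>)
  moreover have "xs \<in> tuples D (Suc n)" "?cs \<in> tuples D (Suc q)"
    using xs \<psi>' q Q_less by (auto simp: tuples_def free_def less_Suc_eq_le intro: less_imp_le)
  moreover have "0 \<notin> set ?cs" using \<psi>' by (auto simp: image_iff)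
  ultimately show ?thesis unfolding final_def by blast
qed

definition pickX :: "(nat \<Rightarrow> nat) \<Rightarrow> nat list" where
  "pickX A = wit D n (\<lambda>xs. \<exists>cs\<in>tuples D (Suc q). pat A xs cs)"

definition pickC :: "(nat \<Rightarrow> nat) \<Rightarrow> nat list" where
  "pickC A = wit D (Suc q) (\<lambda>cs. pat A (pickX A) cs)"

text \<open>A stuck coloring stays as it is, whatever the digit. So all paths have the same number
  of rounds and a counter with a fixed number of digits can drive them.\<close>

definition branch :: "(nat \<Rightarrow> nat) \<Rightarrow> nat \<Rightarrow> nat \<Rightarrow> nat" where
  "branch A g = (if stuck A then A else upds A (pickX A) (table (pickC A) g))"

primrec path :: "(nat \<Rightarrow> nat) \<Rightarrow> nat \<Rightarrow> nat \<Rightarrow> nat" where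
  "path g 0 = (\<lambda>_. 0)"
| "path g (Suc j) = branch (path g j) (g j)"

lemma path_cong: "(\<And>i. i < j \<Longrightarrow> g i = g' i) \<Longrightarrow> path g j = path g' j"
  by (induction j) auto

lemma pick:
  assumes "\<not> stuck A"
  shows "pickX A \<in> tuples D n" "pickC A \<in> tuples D (Suc q)" "pat A (pickX A) (pickC A)"
proof -
  have "\<exists>xs\<in>tuples D n. \<exists>cs\<in>tuples D (Suc q). pat A xs cs" using assms by (simp add: stuck_def)
  from wit_sat[OF this] have X: "pickX A \<in> tuples D n" "\<exists>cs\<in>tuples D (Suc q). pat A (pickX A) cs"
    by (auto simp: pickX_def)
  show "pickX A \<in> tuples D n" by (rule X)
  from wit_sat[OF X(2)] show "pickC A \<in> tuples D (Suc q)" "pat A (pickX A) (pickC A)"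
    by (auto simp: pickC_def)
qed

lemma color_tuple_iff: "cs \<in> tuples D (Suc q) \<and> 0 \<notin> set cs \<longleftrightarrow> cs \<in> set (List.n_lists D [1..<Suc q])"
proof -
  have "0 \<notin> set cs \<longleftrightarrow> (\<forall>y\<in>set cs. 1 \<le> y)" by (metis One_nat_def Suc_leI gr0I not_one_le_zero)
  then show ?thesis by (auto simp: tuples_def set_n_lists simp del: upt_Suc)
qed

lemma table_surj:
  assumes "cs \<in> set (List.n_lists D [1..<Suc q])" "ys \<in> set (List.n_lists D [1..<Suc q])" "ys \<noteq> cs"
  shows "\<exists>g<q ^ D - 1. table cs g = ys"
proof -
  have "ys \<in> set (remove1 cs (List.n_lists D [1..<Suc q]))"
    using assms(2,3) by (simp add: in_set_remove1)
  then obtain g where "g < length (remove1 cs (List.n_lists D [1..<Suc q]))" "table cs g = ys"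
    by (auto simp: in_set_conv_nth color_table_def)
  then show ?thesis using assms(1) by (auto simp: length_remove1 length_n_lists simp del: upt_Suc)
qed

text \<open>A coloring of the graph violates no test, so on the picked vertices it differs from the
  violating colors and occurs in the table.\<close>

lemma branch_complete:
  assumes \<psi>: "coloring \<psi>" and A: "\<And>y. A y \<noteq> 0 \<Longrightarrow> y \<in> Q \<and> A y = \<psi> y" and st: "\<not> stuck A"
  shows "\<exists>g<q ^ D - 1. branch A g = upds A (pickX A) (map \<psi> (pickX A))"
proof -
  note p = pick[OF st]
  let ?xs = "pickX A"
  have len: "length ?xs = D" "\<And>x. x \<in> set ?xs \<Longrightarrow> x < n" using p(1) by (auto simp: tuples_def)
  have \<psi>': "0 < \<psi> v \<and> \<psi> v \<le> q" if "v < n" for v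
    using \<psi> L_range that by (auto simp: coloring_def)
  have "\<not> vi (upds A ?xs (map \<psi> ?xs))"
    by (rule not_viol_of_coloring[OF \<psi>]) (use A in \<open>auto simp: upds_map split: if_splits\<close>)
  then have "map \<psi> ?xs \<noteq> pickC A" using p(3) by (auto simp: pat_def)
  moreover have "map \<psi> ?xs \<in> set (List.n_lists D [1..<Suc q])"
    unfolding color_tuple_iff[symmetric] using len \<psi>' by (auto simp: tuples_def less_Suc_eq_le) fastforce
  moreover have "pickC A \<in> set (List.n_lists D [1..<Suc q])"
    unfolding color_tuple_iff[symmetric] using p by (auto simp: pat_def)
  ultimately show ?thesis using table_surj[of "pickC A" "map \<psi> ?xs"] st by (auto simp: branch_def)
qed

text \<open>The digits are chosen so that the path agrees with \<open>\<psi>\<close>. Picked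
  vertices are distinct and uncolored, so a round that is not stuck consumes exactly
  \<open>D\<close> of them; the bound on \<open>j\<close> guarantees that \<open>D\<close> are left
  before each round.\<close>

lemma path_complete:
  assumes q: "2 \<le> q" and \<psi>: "coloring \<psi>" and j: "j \<le> card Q div D"
  shows "\<exists>g. (\<forall>i<j. g i < q ^ D - 1) \<and> (\<forall>y. path g j y \<noteq> 0 \<longrightarrow> y \<in> Q \<and> path g j y = \<psi> y) \<and>
    (stuck (path g j) \<and> D \<le> card (free (path g j)) \<or> card (free (path g j)) + j * D = card Q)"
  using j
proof (induction j)
  case 0
  have "free (path g 0) = Q" for g by (auto simp: free_def)
  then show ?case by auto
next
  case (Suc j)
  then obtain g where g: "\<And>i. i < j \<Longrightarrow> g i < q ^ D - 1"
    "\<And>y. path g j y \<noteq> 0 \<Longrightarrow> y \<in> Q \<and> path g j y = \<psi> y"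
    "stuck (path g j) \<and> D \<le> card (free (path g j)) \<or> card (free (path g j)) + j * D = card Q"
    by auto
  let ?A = "path g j"
  have "j < card Q div D" using Suc.prems by simp
  then have "Suc j * D \<le> card Q" by (metis Suc_leI div_le_mono le_trans mult.commute mult_le_mono1 times_div_less_eq_dividend)
  then have fr: "D \<le> card (free ?A)" using g(3) by auto
  show ?case
  proof (cases "stuck ?A")
    case True
    \<comment> \<open>At a stuck coloring any admissible digit will do; 0 is one because
      \<open>q ^ D\<close> exceeds 1.\<close>
    let ?g = "g(j := 0)"
    have "path ?g j = ?A" by (rule path_cong) auto
    then have p: "path ?g (Suc j) = ?A" using True by (simp add: branch_def)
    have "1 < q ^ D" using q by (intro one_less_power) auto
    then have "\<forall>i<Suc j. ?g i < q ^ D - 1" using g(1) by (auto simp: less_Suc_eq)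
    then show ?thesis using g(2) True fr by (intro exI[of _ ?g] conjI) (auto simp only: p)
  next
    case False
    from branch_complete[OF \<psi> g(2) False] obtain d where
      d: "d < q ^ D - 1" "branch ?A d = upds ?A (pickX ?A) (map \<psi> (pickX ?A))" by blast
    let ?g = "g(j := d)"
    have "path ?g j = ?A" by (rule path_cong) auto
    then have p: "path ?g (Suc j) = upds ?A (pickX ?A) (map \<psi> (pickX ?A))" using d(2) by simp
    note pk = pick[OF False]
    have X: "set (pickX ?A) \<subseteq> free ?A" "card (set (pickX ?A)) = D"
      using pk(1,3) by (auto simp: pat_def free_def tuples_def distinct_card)
    have \<psi>': "\<psi> v = 0 \<longleftrightarrow> False" if "v \<in> Q" for v
      using \<psi> L_range[OF Q_less[OF that], of "\<psi> v"] Q_less[OF that] by (auto simp: coloring_def)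
    have "free (path ?g (Suc j)) = free ?A - set (pickX ?A)"
      unfolding p free_def upds_map by (auto simp: \<psi>')
    then have "card (free (path ?g (Suc j))) = card (free ?A) - D"
      using X by (simp add: card_Diff_subset finite_subset[OF X(1) finite_free])
    moreover have "card (free ?A) + j * D = card Q" using False g(3) by blast
    ultimately have "card (free (path ?g (Suc j))) + Suc j * D = card Q" using fr by simp
    moreover have "\<forall>y. path ?g (Suc j) y \<noteq> 0 \<longrightarrow> y \<in> Q \<and> path ?g (Suc j) y = \<psi> y"
      unfolding p upds_map using X(1) g(2) by (auto simp: free_def)
    moreover have "\<forall>i<Suc j. ?g i < q ^ D - 1" using g(1) d(1) by (auto simp: less_Suc_eq)
    ultimately show ?thesis by blast
  qed
qed

text \<open>If the path never gets stuck, \<open>card Q mod D\<close> hub vertices remain, fewer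
  than \<open>D\<close>. In both cases the final test succeeds.\<close>

lemma final_complete:
  assumes q: "2 \<le> q" and "list_colorable G L"
  shows "\<exists>g. (\<forall>i<card Q div D. g i < q ^ D - 1) \<and> final (path g (card Q div D))"
proof -
  obtain \<psi> where \<psi>: "coloring \<psi>" using assms(2) colorable_iff by blast
  let ?R = "card Q div D"
  obtain g where g: "\<forall>i<?R. g i < q ^ D - 1"
    "\<And>y. path g ?R y \<noteq> 0 \<Longrightarrow> y \<in> Q \<and> path g ?R y = \<psi> y"
    "stuck (path g ?R) \<and> D \<le> card (free (path g ?R)) \<or> card (free (path g ?R)) + ?R * D = card Q"
    using path_complete[OF q \<psi> order_refl] by auto
  have "final (path g ?R)"
    using g(3)
  proof
    assume "stuck (path g ?R) \<and> D \<le> card (free (path g ?R))"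
    moreover have "y \<in> Q \<and> path g ?R y \<le> q" if "path g ?R y \<noteq> 0" for y
      using g(2)[OF that] \<psi> L_range[OF Q_less, of y "\<psi> y"] Q_less[of y] by (auto simp: coloring_def)
    ultimately show ?thesis using q by (intro final_of_stuck) auto
  next
    assume "card (free (path g ?R)) + ?R * D = card Q"
    then have "card (free (path g ?R)) = card Q mod D" by (metis add_diff_cancel_right' minus_div_mult_eq_mod)
    then have "card (free (path g ?R)) < D" by simp
    then show ?thesis using q g(2) by (intro final_of_few_free[OF \<psi>]) auto
  qed
  with g(1) show ?thesis by blast
qed

text \<open>Needed for resetting the array between passes: \<open>clearC\<close> only clears
  positions below \<open>n\<close>.\<close>

lemma path_outside: "n \<le> y \<Longrightarrow> path g j y = 0"
proof (induction j)
  case (Suc j)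
  show ?case
  proof (cases "stuck (path g j)")
    case False
    have "y \<notin> set (pickX (path g j))" using pick(1)[OF False] Suc.prems by (auto simp: tuples_def)
    then show ?thesis using Suc False by (simp add: branch_def upds_outside)
  qed (use Suc in \<open>simp add: branch_def\<close>)
qed simp

end


section \<open>The program\<close>

definition adjF :: "vr \<Rightarrow> vr \<Rightarrow> fm" where
  "adjF u v = Eq (Rd2 Adj Row u v) (TN 1)"

text \<open>Color 0 has no entry of its own: its position holds the last entry of the preceding row,
  or nothing in the first row. Hence the explicit exclusion.\<close>

definition listF :: "vr \<Rightarrow> vr \<Rightarrow> fm" where
  "listF w d = And (Neg (Eq (TV d) (TN 0))) (Eq (Rd2 Lst LRow w d) (TN 1))"

text \<open>Tests an overridden coloring without writing to the array. The recursion puts later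
  pairs outermost, so they take precedence, as in \<open>upds\<close>.\<close>

fun overrideF :: "vr list \<Rightarrow> vr list \<Rightarrow> vr \<Rightarrow> vr \<Rightarrow> fm \<Rightarrow> fm" where
  "overrideF (x # xs) (c # cs) y d f = overrideF xs cs y d
     (Or (And (Eq (TV y) (TV x)) (Eq (TV c) (TV d))) (And (Neg (Eq (TV y) (TV x))) f))"
| "overrideF _ _ y d f = f"

definition colorF :: "vr list \<Rightarrow> vr list \<Rightarrow> vr \<Rightarrow> vr \<Rightarrow> fm" where
  "colorF xs cs y d = overrideF xs cs y d (Eq (Rd Col y) (TV d))"

definition okF :: "vr list \<Rightarrow> vr list \<Rightarrow> vr list \<Rightarrow> vr list \<Rightarrow> fm" where
  "okF xs cs ws ds = conjs (map (\<lambda>(w, d). conjs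
     [listF w d, Or (colorF xs cs w VZ) (colorF xs cs w d),
      Neg (Ex VV VN (And (adjF w VV) (colorF xs cs VV d))),
      conjs (map (\<lambda>(w', d'). Neg (And (adjF w w') (Eq (TV d) (TV d')))) (zip ws ds))]) (zip ws ds))"

abbreviation "Xs k \<equiv> map VX [0..<k]"
abbreviation "Cs k \<equiv> map VC [0..<k]"
abbreviation "Ys k \<equiv> map VY [0..<k]"
abbreviation "Ws s \<equiv> map VW [0..<s]"
abbreviation "Ds s \<equiv> map VD [0..<s]"

definition violF :: "nat \<Rightarrow> nat \<Rightarrow> fm" where
  "violF k s = exs (Ws s) VN (Neg (exs (Ds s) VQ1 (okF (Xs k) (Cs k) (Ws s) (Ds s))))"

primrec distinctF :: "vr list \<Rightarrow> fm" where
  "distinctF [] = conjs []"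
| "distinctF (x # xs) = And (conjs (map (\<lambda>y. Neg (Eq (TV x) (TV y))) xs)) (distinctF xs)"

definition nonzeroF :: "vr list \<Rightarrow> fm" where
  "nonzeroF cs = conjs (map (\<lambda>c. Neg (Eq (TV c) (TN 0))) cs)"

definition freeF :: "vr \<Rightarrow> fm" where
  "freeF x = And (Eq (Rd Hub x) (TN 1)) (Eq (Rd Col x) (TN 0))"

definition patF :: "nat \<Rightarrow> nat \<Rightarrow> fm" where
  "patF k s = conjs [distinctF (Xs k), conjs (map freeF (Xs k)), nonzeroF (Cs k), violF k s]"

definition finalF :: "nat \<Rightarrow> nat \<Rightarrow> fm" where
  "finalF k s = exs (Xs k) VN1 (exs (Cs k) VQ1 (And (nonzeroF (Cs k)) (Neg (violF k s))))"

definition eqsF :: "vr list \<Rightarrow> nat list \<Rightarrow> fm" where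
  "eqsF vs ks = conjs (map (\<lambda>(v, c). Eq (TV v) (TN c)) (zip vs ks))"

text \<open>For fixed \<open>q\<close> and \<open>k\<close> the table is finite, so it is written
  into the program as a disjunction over all its entries.\<close>

definition tableF :: "nat \<Rightarrow> nat \<Rightarrow> fm" where
  "tableF q k = disjs (map (\<lambda>(cs, g).
      conjs [Eq (TV VG) (TN g), eqsF (Cs k) cs, eqsF (Ys k) (color_table q k cs g)])
     (List.product (List.n_lists k [1..<Suc q]) [0..<q ^ k - 1]))"

primrec seqs :: "com list \<Rightarrow> com" where
  "seqs [] = Skip"
| "seqs (c # cs) = Seq c (seqs cs)"

section \<open>Commands for branching, counting and input\<close>

definition roundC :: "nat \<Rightarrow> nat \<Rightarrow> nat \<Rightarrow> com" where
  "roundC q k s = Cond (exs (Xs k) VN (exs (Cs k) VQ1 (patF k s)))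
     (seqs [finds (Xs k) VN (exs (Cs k) VQ1 (patF k s)), finds (Cs k) VQ1 (patF k s),
        Assign VG (Rd Dig VJ), finds (Ys k) VQ1 (tableF q k), puts Col (Xs k) (Ys k)])
     Skip"

definition clearC :: com where
  "clearC = Loop VU VN (Put Col VU VZ)"

definition fillC :: com where
  "fillC = Loop VU VN (Cond (freeF VU) (seqs [Assign VG (TN 1), Put Col VU VG]) Skip)"

text \<open>Increment of a number in base \<open>B\<close>, lowest digit first. \<open>VK\<close> is
  the carry; a carry out of the last digit is dropped.\<close>

definition advanceC :: "nat \<Rightarrow> com" where
  "advanceC B = Seq (Assign VK (TN 1)) (Loop VI VR (Cond (Eq (TV VK) (TN 1))
     (seqs [Assign VG (Rd Dig VI), Inc VG,
        Cond (Eq (TV VG) (TN B)) (Put Dig VI VZ) (Seq (Put Dig VI VG) (Assign VK (TN 0)))])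
     Skip))"

definition bodyC :: "nat \<Rightarrow> nat \<Rightarrow> nat \<Rightarrow> com" where
  "bodyC q k s = seqs [clearC, Loop VJ VR (roundC q k s), fillC,
     Cond (finalF k s) (Assign VRes (TN 1)) Skip, advanceC (q ^ k - 1)]"

text \<open>
  With \<open>late\<close> set, entry \<open>v\<close> of a row is stored one place later, as colors are numbered from 1.
\<close>

definition readC :: "arr \<Rightarrow> arr \<Rightarrow> vr \<Rightarrow> bool \<Rightarrow> com" where
  "readC a r b late = Seq (Assign VP (TN 0)) (Loop VU VN (Seq (Put r VU VP) (Loop VV b
     (seqs [Input VA, if late then Inc VP else Skip, Put a VP VA, if late then Skip else Inc VP]))))"

definition loadC :: "nat \<Rightarrow> com" where
  "loadC q = seqs [Assign VQ (TN q), Assign VQ1 (TN (Suc q)), Assign VN1 (TV VN), Inc VN1,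
     readC Adj Row VN False, readC Lst LRow VQ True, Loop VU VN (Seq (Input VA) (Put Hub VU VA))]"

text \<open>Division by counting: \<open>VK\<close> counts the hub vertices modulo \<open>k\<close>,
  and every wrap-around adds one to the quotient in \<open>VR\<close>.\<close>

definition roundsC :: "nat \<Rightarrow> com" where
  "roundsC k = seqs [Assign VR (TN 0), Assign VK (TN 0), Loop VU VN (Cond (Eq (Rd Hub VU) (TN 1))
     (Seq (Inc VK) (Cond (Eq (TV VK) (TN k)) (Seq (Assign VK (TN 0)) (Inc VR)) Skip)) Skip)]"

text \<open>Each multiplication by \<open>B\<close> is carried out by increments. This takes time
  proportional to the power itself, up to a polynomial factor, which is affordable since the search
  makes that many passes.\<close>

definition powerC :: "nat \<Rightarrow> com" where
  "powerC B = Seq (Assign VT (TN 1)) (Loop VI VR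
     (seqs [Assign VM (TN 0), Loop VJ VT (seqs (replicate B (Inc VM))), Assign VT (TV VM)]))"

definition mainC :: "nat \<Rightarrow> nat \<Rightarrow> nat \<Rightarrow> com" where
  "mainC q k s = seqs [Input VN, loadC q, roundsC k, powerC (q ^ k - 1), Loop VL VT (bodyC q k s)]"


section \<open>Correctness of the program\<close>

lemma holds_colorF:
  "length xs = length cs \<Longrightarrow>
    holds (colorF xs cs y d) e m \<longleftrightarrow> upds (m Col) (map e xs) (map e cs) (e y) = e d"
proof -
  have "length xs = length cs \<Longrightarrow> (holds f e m \<longleftrightarrow> A (e y) = e d) \<Longrightarrow>
    holds (overrideF xs cs y d f) e m \<longleftrightarrow> upds A (map e xs) (map e cs) (e y) = e d" for f A
    by (induction xs cs y d f arbitrary: A rule: overrideF.induct) auto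
  then show "length xs = length cs \<Longrightarrow>
    holds (colorF xs cs y d) e m \<longleftrightarrow> upds (m Col) (map e xs) (map e cs) (e y) = e d"
    by (simp add: colorF_def)
qed

lemma holds_distinctF: "holds (distinctF xs) e m \<longleftrightarrow> distinct (map e xs)"
  by (induction xs) auto

lemma holds_eqsF: "length vs = length ks \<Longrightarrow> holds (eqsF vs ks) e m \<longleftrightarrow> map e vs = ks"
  by (induction vs ks rule: list_induct2) (auto simp: eqsF_def)

lemma holds_nonzeroF: "holds (nonzeroF cs) e m \<longleftrightarrow> 0 \<notin> e ` set cs"
  by (auto simp: nonzeroF_def)

lemma fbounds_overrideF: "fbounds (overrideF xs cs y d f) = fbounds f"
  by (induction xs cs y d f rule: overrideF.induct) auto

lemma fbounds_distinctF: "fbounds (distinctF xs) = {}"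
  by (induction xs) auto

lemma fbounds_violF: "fbounds (violF k s) \<subseteq> {VN, VQ1}"
proof -
  have "fbounds (okF xs cs ws ds) \<subseteq> {VN}" for xs cs ws ds
    by (auto simp: okF_def listF_def colorF_def adjF_def fbounds_overrideF)
  then show ?thesis
    unfolding violF_def
    using fbounds_exs[of "Ds s" VQ1 "okF (Xs k) (Cs k) (Ws s) (Ds s)"]
      fbounds_exs[of "Ws s" VN "Neg (exs (Ds s) VQ1 (okF (Xs k) (Cs k) (Ws s) (Ds s)))"] by fastforce
qed

lemma fbounds_patF: "fbounds (patF k s) \<subseteq> {VN, VQ1}"
  using fbounds_violF[of k s] by (auto simp: patF_def fbounds_distinctF nonzeroF_def freeF_def)

lemma fbounds_finalF: "fbounds (finalF k s) \<subseteq> {VN, VN1, VQ1}"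
  using fbounds_violF[of k s]
    fbounds_exs[of "Cs k" VQ1 "And (nonzeroF (Cs k)) (Neg (violF k s))"]
    fbounds_exs[of "Xs k" VN1 "exs (Cs k) VQ1 (And (nonzeroF (Cs k)) (Neg (violF k s)))"]
  by (fastforce simp: finalF_def nonzeroF_def)

lemma fbounds_tableF: "fbounds (tableF q k) = {}"
  by (auto simp: tableF_def eqsF_def)

lemma roundC_sets:
  "mods (roundC q k s) \<subseteq> insert VG (set (Xs k) \<union> set (Cs k) \<union> set (Ys k))"
  "amods (roundC q k s) \<subseteq> {Col}" "cbounds (roundC q k s) \<subseteq> {VN, VQ1}"
proof -
  show "mods (roundC q k s) \<subseteq> insert VG (set (Xs k) \<union> set (Cs k) \<union> set (Ys k))"
    by (auto simp: roundC_def)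
  show "amods (roundC q k s) \<subseteq> {Col}"
    using puts_simps(2)[of Col "Xs k" "Ys k"] by (auto simp: roundC_def)
  let ?f = "exs (Cs k) VQ1 (patF k s)"
  have "fbounds ?f \<subseteq> {VN, VQ1}" using fbounds_exs[of "Cs k" VQ1 "patF k s"] fbounds_patF[of k s] by auto
  then show "cbounds (roundC q k s) \<subseteq> {VN, VQ1}"
    using fbounds_exs[of "Xs k" VN ?f] cbounds_finds[of "Xs k" VN ?f] fbounds_patF[of k s]
      cbounds_finds[of "Cs k" VQ1 "patF k s"] cbounds_finds[of "Ys k" VQ1 "tableF q k"]
    by (auto simp: roundC_def fbounds_tableF)
qed

lemma seq_inc:
  "sem (seqs (replicate B (Inc x))) S = setv x (vars S x + B) S"
  "csteps (seqs (replicate B (Inc x))) S = B"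
proof -
  show "sem (seqs (replicate B (Inc x))) S = setv x (vars S x + B) S"
    by (induction B arbitrary: S) (auto simp: setv_def)
  show "csteps (seqs (replicate B (Inc x))) S = B"
    by (induction B arbitrary: S) auto
qed

lemma sem_readC:
  assumes b: "b \<notin> {VU, VV, VA, VP}" and ar: "a \<noteq> r"
    and S: "vars S VN = n" "vars S b = w"
      "ins S = concat (map (\<lambda>u. map (f u) [0..<w]) [0..<n]) @ rest"
  shows "ins (sem (readC a r b late) S) = rest"
    "\<And>u. u < n \<Longrightarrow> arrs (sem (readC a r b late) S) r u = u * w"
    "\<And>u v. u < n \<Longrightarrow> v < w \<Longrightarrow> arrs (sem (readC a r b late) S) a (u * w + v + of_bool late) = f u v"
proof -
  let ?c = "seqs [Input VA, if late then Inc VP else Skip, Put a VP VA, if late then Skip else Inc VP]"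
  \<comment> \<open>Invariant within row \<open>u\<close> after \<open>j\<close> entries; positions
    belonging to earlier rows keep the contents \<open>a0\<close>.\<close>
  define J where "J u r0 a0 rest' j S \<longleftrightarrow> vars S b = w \<and> vars S VP = u * w + j \<and>
      ins S = map (f u) [j..<w] @ rest' \<and> arrs S r = r0 \<and>
      (\<forall>i<u * w + of_bool late. arrs S a i = a0 i) \<and>
      (\<forall>v<j. arrs S a (u * w + v + of_bool late) = f u v)" for u r0 a0 rest' j and S :: store
  have J: "J u r0 a0 rest' (Suc j) (sem ?c (setv VV j S))" if "J u r0 a0 rest' j S" "j < w" for u r0 a0 rest' j S
    using that b ar
    by (cases late) (auto simp: J_def upt_conv_Cons next_input_def less_Suc_eq)
  \<comment> \<open>Invariant between rows: the first \<open>i\<close> rows are stored and the rest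
    of the input is unread.\<close>
  define K where "K i S \<longleftrightarrow> vars S b = w \<and> vars S VP = i * w \<and>
      ins S = concat (map (\<lambda>u. map (f u) [0..<w]) [i..<n]) @ rest \<and>
      (\<forall>u<i. arrs S r u = u * w \<and> (\<forall>v<w. arrs S a (u * w + v + of_bool late) = f u v))" for i and S :: store
  let ?d = "Seq (Put r VU VP) (Loop VV b ?c)"
  have K: "K (Suc i) (sem ?d (setv VU i S))" if KS: "K i S" and i: "i < n" for i S
  proof -
    let ?S = "sem (Put r VU VP) (setv VU i S)"
    let ?rest = "concat (map (\<lambda>u. map (f u) [0..<w]) [Suc i..<n]) @ rest"
    have "J i (arrs ?S r) (arrs ?S a) ?rest 0 ?S"
      using KS i b ar by (auto simp: J_def K_def upt_conv_Cons)
    then have "J i (arrs ?S r) (arrs ?S a) ?rest w (iter (\<lambda>j S. sem ?c (setv VV j S)) w ?S)"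
      by (rule iter_invariant) (use J in auto)
    moreover have "vars ?S b = w" using KS b by (auto simp: K_def)
    ultimately have J': "J i (arrs ?S r) (arrs ?S a) ?rest w (sem ?d (setv VU i S))" by simp
    \<comment> \<open>Earlier rows occupy smaller positions, so storing row \<open>i\<close> does
      not damage them.\<close>
    have less: "u * w + v < i * w" if "u < i" "v < w" for u v
    proof -
      have "u * w + v < Suc u * w" using that(2) by simp
      also have "\<dots> \<le> i * w" using that(1) by (intro mult_right_mono) auto
      finally show ?thesis .
    qed
    show ?thesis unfolding K_def
    proof (intro conjI allI impI)
      fix u assume u: "u < Suc i"
      show "arrs (sem ?d (setv VU i S)) r u = u * w"
        using J' KS u b by (auto simp: J_def K_def less_Suc_eq)
      fix v assume v: "v < w"
      show "arrs (sem ?d (setv VU i S)) a (u * w + v + of_bool late) = f u v"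
      proof (cases "u = i")
        case True then show ?thesis using J' v by (auto simp: J_def)
      next
        case False
        then have "u < i" using u by simp
        then show ?thesis using J' KS less[of u v] v ar by (auto simp: J_def K_def)
      qed
    qed (use J' in \<open>auto simp: J_def\<close>)
  qed
  let ?S = "setv VP 0 S"
  have "K n (iter (\<lambda>i S. sem ?d (setv VU i S)) n ?S)"
    by (rule iter_invariant) (use K S b in \<open>auto simp: K_def\<close>)
  then have "K n (sem (readC a r b late) S)" using S by (simp add: readC_def)
  then show "ins (sem (readC a r b late) S) = rest"
    "\<And>u. u < n \<Longrightarrow> arrs (sem (readC a r b late) S) r u = u * w"
    "\<And>u v. u < n \<Longrightarrow> v < w \<Longrightarrow> arrs (sem (readC a r b late) S) a (u * w + v + of_bool late) = f u v"
    by (auto simp: K_def)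
qed

section \<open>Evaluation of formulas and rounds on a loaded instance\<close>

context hub_instance
begin

definition loaded :: "(vr \<Rightarrow> nat) \<Rightarrow> (arr \<Rightarrow> nat \<Rightarrow> nat) \<Rightarrow> bool" where
  "loaded e m \<longleftrightarrow> e VN = n \<and> e VN1 = Suc n \<and> e VQ1 = Suc q \<and> e VZ = 0 \<and>
     (\<forall>u<n. \<forall>v<n. m Adj (m Row u + v) = of_bool (E u v)) \<and>
     (\<forall>u<n. \<forall>c. 0 < c \<longrightarrow> c \<le> q \<longrightarrow> m Lst (m LRow u + c) = of_bool (c \<in> L u)) \<and>
     (\<forall>u. m Hub u = of_bool (u \<in> Q))"

lemma loaded_cong:
  assumes "loaded e m" "\<And>x. x \<in> {VN, VN1, VQ1, VZ} \<Longrightarrow> e' x = e x"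
    "\<And>a. a \<in> {Adj, Row, Lst, LRow, Hub} \<Longrightarrow> m' a = m a"
  shows "loaded e' m'"
  using assms by (simp add: loaded_def)

lemma loaded_upds:
  assumes "loaded e m" "set xs \<inter> {VN, VN1, VQ1, VZ} = {}"
  shows "loaded (upds e xs ys) m"
  by (rule loaded_cong[OF assms(1)]) (use assms(2) in \<open>auto intro!: upds_outside\<close>)

lemma loaded_sem:
  assumes "loaded (vars S) (arrs S)" "mods c \<inter> {VN, VN1, VQ1, VZ} = {}"
    "amods c \<inter> {Adj, Row, Lst, LRow, Hub} = {}"
  shows "loaded (vars (sem c S)) (arrs (sem c S))"
  by (rule loaded_cong[OF assms(1)]) (use assms(2,3) in \<open>auto intro!: vars_sem arrs_sem\<close>)

text \<open>\<open>VV\<close> is bound in the test of neighbors, so its freshness rules out capture.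
  \<open>VZ\<close> holds 0, so comparing a color with it asks whether a vertex is
  uncolored.\<close>

lemma holds_okF:
  assumes e: "loaded e m" and len: "length xs = length cs" "length ws = length ds"
    and ws: "\<And>w. w \<in> set ws \<Longrightarrow> e w < n" and ds: "\<And>d. d \<in> set ds \<Longrightarrow> e d \<le> q"
    and VV: "VV \<notin> set xs \<union> set cs \<union> set ws \<union> set ds"
  shows "holds (okF xs cs ws ds) e m \<longleftrightarrow>
    local_ok n E L (upds (m Col) (map e xs) (map e cs)) (map e ws) (map e ds)"
proof -
  let ?A = "upds (m Col) (map e xs) (map e cs)"
  have col: "holds (colorF xs cs y d) e m \<longleftrightarrow> ?A (e y) = e d" for y d
    by (rule holds_colorF[OF len(1)])
  have colV: "holds (colorF xs cs VV d) (e(VV := y)) m \<longleftrightarrow> ?A y = e d" if "d \<noteq> VV" for y d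
  proof -
    have "map (e(VV := y)) xs = map e xs" "map (e(VV := y)) cs = map e cs" using VV by auto
    then show ?thesis using that by (simp add: holds_colorF[OF len(1)] del: map_eq_conv)
  qed
  have adj: "holds (adjF u v) e' m \<longleftrightarrow> E (e' u) (e' v)" if "e' u < n" "e' v < n" for u v e'
    using that e by (auto simp: adjF_def loaded_def)
  have lst: "holds (listF w d) e m \<longleftrightarrow> e d \<in> L (e w)" if "e w < n" "e d \<le> q" for w d
    using that e L_range[of "e w" "e d"] by (cases "e d \<in> L (e w)") (auto simp: listF_def loaded_def)
  have nn: "e VN = n" "e VZ = 0" using e by (simp_all add: loaded_def)
  have "holds (okF xs cs ws ds) e m \<longleftrightarrow> (\<forall>i<length ws. let w = ws ! i; d = ds ! i in
      e d \<in> L (e w) \<and> (?A (e w) = 0 \<or> ?A (e w) = e d) \<and> (\<forall>y<n. E (e w) y \<longrightarrow> ?A y \<noteq> e d) \<and>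
      (\<forall>j<length ws. E (e w) (e (ws ! j)) \<longrightarrow> e d \<noteq> e (ds ! j)))" (is "_ \<longleftrightarrow> ?R")
  proof -
    have zip: "(\<forall>z\<in>set (zip ws ds). P z) \<longleftrightarrow> (\<forall>i<length ws. P (ws ! i, ds ! i))" for P
      using len(2) by (auto simp: set_zip)
    have "holds (conjs [listF w d, Or (colorF xs cs w VZ) (colorF xs cs w d),
        Neg (Ex VV VN (And (adjF w VV) (colorF xs cs VV d))),
        conjs (map (\<lambda>(w', d'). Neg (And (adjF w w') (Eq (TV d) (TV d')))) (zip ws ds))]) e m \<longleftrightarrow>
      e d \<in> L (e w) \<and> (?A (e w) = 0 \<or> ?A (e w) = e d) \<and> (\<forall>y<n. E (e w) y \<longrightarrow> ?A y \<noteq> e d) \<and>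
      (\<forall>j<length ws. E (e w) (e (ws ! j)) \<longrightarrow> e d \<noteq> e (ds ! j))"
      if wd: "w \<in> set ws" "d \<in> set ds" for w d
    proof -
      have v: "w \<noteq> VV" "d \<noteq> VV" "e w < n" "e d \<le> q" using wd VV ws ds by auto
      have "holds (Neg (Ex VV VN (And (adjF w VV) (colorF xs cs VV d)))) e m \<longleftrightarrow>
          (\<forall>y<n. E (e w) y \<longrightarrow> ?A y \<noteq> e d)"
        using v by (auto simp: nn colV adj)
      moreover have "holds (conjs (map (\<lambda>(w', d'). Neg (And (adjF w w') (Eq (TV d) (TV d')))) (zip ws ds))) e m \<longleftrightarrow>
          (\<forall>j<length ws. E (e w) (e (ws ! j)) \<longrightarrow> e d \<noteq> e (ds ! j))"
        using v ws by (simp add: zip adj)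
      ultimately show ?thesis using v by (simp add: lst col nn del: holds.simps(2) holds_conjs)
    qed
    then show ?thesis unfolding okF_def Let_def using len(2)
      by (simp add: zip del: conjs.simps)
  qed
  then show ?thesis using len(2) by (simp add: local_ok_def Let_def)
qed

lemma holds_violF:
  assumes e: "loaded e m"
  shows "holds (violF k (Suc \<sigma>)) e m \<longleftrightarrow> vi (upds (m Col) (map e (Xs k)) (map e (Cs k)))"
proof -
  let ?W = "Ws (Suc \<sigma>)" and ?D = "Ds (Suc \<sigma>)" and ?A = "upds (m Col) (map e (Xs k)) (map e (Cs k))"
  have nn: "e VN = n" "e VQ1 = Suc q" using e by (simp_all add: loaded_def)
  have ok: "holds (okF (Xs k) (Cs k) ?W ?D) (upds (upds e ?W ws) ?D ds) m \<longleftrightarrow> local_ok n E L ?A ws ds"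
    if t: "ws \<in> tuples (Suc \<sigma>) n" "ds \<in> tuples (Suc \<sigma>) (Suc q)" for ws ds
  proof -
    let ?e = "upds (upds e ?W ws) ?D ds"
    have 1: "map ?e ?D = ds" using t(2) by (intro map_upds) (auto simp: tuples_def distinct_map inj_on_def)
    have "map ?e ?W = map (upds e ?W ws) ?W" by (intro map_cong refl upds_outside) auto
    also have "\<dots> = ws" using t(1) by (intro map_upds) (auto simp: tuples_def distinct_map inj_on_def)
    finally have 2: "map ?e ?W = ws" .
    have 3: "map ?e (Xs k) = map e (Xs k)" "map ?e (Cs k) = map e (Cs k)"
      by (intro map_cong refl; subst upds_outside, force, subst upds_outside, force, rule refl)+
    have 4: "loaded ?e m" by (intro loaded_upds e) auto
    have "?e ` set ?W = set ws" "?e ` set ?D = set ds" using 1 2 by (metis list.set_map)+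
    then have "?e w < n" if "w \<in> set ?W" for w using that t(1) by (auto simp: tuples_def)
    moreover have "?e d \<le> q" if "d \<in> set ?D" for d
      using that t(2) \<open>?e ` set ?D = set ds\<close> by (auto simp: tuples_def less_Suc_eq_le)
    ultimately show ?thesis
      using holds_okF[OF 4, of "Xs k" "Cs k" ?W ?D] unfolding 1 2 3 by auto
  qed
  have "holds (exs ?D VQ1 (okF (Xs k) (Cs k) ?W ?D)) (upds e ?W ws) m \<longleftrightarrow>
      (\<exists>ds\<in>tuples (Suc \<sigma>) (Suc q). local_ok n E L ?A ws ds)" if "ws \<in> tuples (Suc \<sigma>) n" for ws
  proof -
    have "upds e ?W ws VQ1 = Suc q" using nn by (subst upds_outside) auto
    then show ?thesis using ok[OF that] by (subst holds_exs) (auto simp del: upt_Suc map_map)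
  qed
  then show ?thesis
    unfolding violF_def viol_def by (subst holds_exs) (auto simp: nn simp del: upt_Suc)
qed

lemma map_e_upds:
  assumes "length xs = k" "length cs = k"
  shows "map (upds (upds e (Xs k) xs) (Cs k) cs) (Xs k) = xs"
    "map (upds (upds e (Xs k) xs) (Cs k) cs) (Cs k) = cs"
proof -
  show "map (upds (upds e (Xs k) xs) (Cs k) cs) (Cs k) = cs"
    using assms(2) by (intro map_upds) (auto simp: distinct_map inj_on_def)
  have "map (upds (upds e (Xs k) xs) (Cs k) cs) (Xs k) = map (upds e (Xs k) xs) (Xs k)"
    by (intro map_cong refl upds_outside) auto
  also have "\<dots> = xs" using assms(1) by (intro map_upds) (auto simp: distinct_map inj_on_def)
  finally show "map (upds (upds e (Xs k) xs) (Cs k) cs) (Xs k) = xs" .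
qed

lemma holds_patF:
  assumes e: "loaded e m" "length xs = D" "length cs = D"
  shows "holds (patF D (Suc \<sigma>)) (upds (upds e (Xs D) xs) (Cs D) cs) m \<longleftrightarrow> pat (m Col) xs cs"
proof -
  let ?e = "upds (upds e (Xs D) xs) (Cs D) cs"
  note mp = map_e_upds[OF e(2,3), of e]
  have l: "loaded ?e m" by (intro loaded_upds e) auto
  have im: "?e ` set (Xs D) = set xs" "?e ` set (Cs D) = set cs" using mp by (metis list.set_map)+
  have fr: "holds (freeF x) ?e m \<longleftrightarrow> ?e x \<in> Q \<and> m Col (?e x) = 0" for x
    using l by (auto simp: freeF_def loaded_def)
  have "(\<forall>x\<in>set (Xs D). holds (freeF x) ?e m) \<longleftrightarrow> (\<forall>x\<in>set (Xs D). ?e x \<in> Q \<and> m Col (?e x) = 0)"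
    using fr by blast
  also have "\<dots> \<longleftrightarrow> (\<forall>x\<in>?e ` set (Xs D). x \<in> Q \<and> m Col x = 0)" by (simp only: ball_simps)
  finally have "(\<forall>x\<in>set (Xs D). holds (freeF x) ?e m) \<longleftrightarrow> (\<forall>x\<in>set xs. x \<in> Q \<and> m Col x = 0)"
    unfolding im .
  moreover have "holds (patF D (Suc \<sigma>)) ?e m \<longleftrightarrow> holds (distinctF (Xs D)) ?e m \<and>
      (\<forall>x\<in>set (Xs D). holds (freeF x) ?e m) \<and> holds (nonzeroF (Cs D)) ?e m \<and>
      holds (violF D (Suc \<sigma>)) ?e m"
    unfolding patF_def by simp
  ultimately show ?thesis
    unfolding holds_distinctF holds_nonzeroF holds_violF[OF l] mp im pat_def by blast
qed

lemma holds_finalF: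
  assumes e: "loaded e m" "m Col = fill A"
  shows "holds (finalF D (Suc \<sigma>)) e m \<longleftrightarrow> final A"
proof -
  have nn: "e VN1 = Suc n" "e VQ1 = Suc q" using e by (simp_all add: loaded_def)
  have *: "holds (And (nonzeroF (Cs D)) (Neg (violF D (Suc \<sigma>)))) (upds (upds e (Xs D) xs) (Cs D) cs) m \<longleftrightarrow>
      0 \<notin> set cs \<and> \<not> vi (upds (fill A) xs cs)"
    if t: "xs \<in> tuples D (Suc n)" "cs \<in> tuples D (Suc q)" for xs cs
  proof -
    have len: "length xs = D" "length cs = D" using t by (auto simp: tuples_def)
    note mp = map_e_upds[OF len, of e]
    have l: "loaded (upds (upds e (Xs D) xs) (Cs D) cs) m" by (intro loaded_upds e) auto
    have "upds (upds e (Xs D) xs) (Cs D) cs ` set (Cs D) = set cs" using mp by (metis list.set_map)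
    then show ?thesis unfolding holds.simps holds_nonzeroF holds_violF[OF l] mp e(2) by simp
  qed
  have "holds (exs (Cs D) VQ1 (And (nonzeroF (Cs D)) (Neg (violF D (Suc \<sigma>))))) (upds e (Xs D) xs) m \<longleftrightarrow>
      (\<exists>cs\<in>tuples D (Suc q). 0 \<notin> set cs \<and> \<not> vi (upds (fill A) xs cs))" if "xs \<in> tuples D (Suc n)" for xs
  proof -
    have "upds e (Xs D) xs VQ1 = Suc q" using nn by (subst upds_outside) auto
    then show ?thesis using *[OF that] by (subst holds_exs) (auto simp del: holds.simps)
  qed
  then show ?thesis
    unfolding finalF_def final_def by (subst holds_exs) (auto simp: nn)
qed

lemma holds_exs_patF:
  assumes e: "loaded e m" and xs: "length xs = D"
  shows "holds (exs (Cs D) VQ1 (patF D (Suc \<sigma>))) (upds e (Xs D) xs) m \<longleftrightarrow>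
    (\<exists>cs\<in>tuples D (Suc q). pat (m Col) xs cs)"
proof -
  have "upds e (Xs D) xs VQ1 = Suc q" using e by (subst upds_outside) (auto simp: loaded_def)
  then show ?thesis
    using holds_patF[OF e xs] by (subst holds_exs) (auto simp: tuples_def)
qed

lemma holds_tableF:
  assumes "length (map e (Cs D)) = D" "length ys = D" "e VG < q ^ D - 1"
    "map e (Cs D) \<in> set (List.n_lists D [1..<Suc q])"
  shows "holds (tableF q D) (upds e (Ys D) ys) m \<longleftrightarrow> ys = table (map e (Cs D)) (e VG)"
proof -
  let ?e = "upds e (Ys D) ys" and ?T = "List.n_lists D [1..<Suc q]"
  have 1: "map ?e (Ys D) = ys" using assms(2) by (intro map_upds) (auto simp: distinct_map inj_on_def)
  have 2: "map ?e (Cs D) = map e (Cs D)" by (intro map_cong refl upds_outside) auto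
  have 3: "?e VG = e VG" by (rule upds_outside) auto
  have len: "length cs = D" "length (table cs g) = D" if "cs \<in> set ?T" "g < q ^ D - 1" for cs g
  proof -
    show "length cs = D" using that by (simp add: set_n_lists)
    have "g < length (remove1 cs ?T)"
      using that by (simp add: length_remove1 length_n_lists del: upt_Suc)
    then have "table cs g \<in> set (remove1 cs ?T)" unfolding color_table_def by (rule nth_mem)
    then have "table cs g \<in> set ?T" using notin_set_remove1 by metis
    then show "length (table cs g) = D" by (simp add: set_n_lists)
  qed
  have "holds (conjs [Eq (TV VG) (TN g), eqsF (Cs D) cs, eqsF (Ys D) (table cs g)]) ?e m \<longleftrightarrow>
      e VG = g \<and> map e (Cs D) = cs \<and> ys = table cs g" if "cs \<in> set ?T" "g < q ^ D - 1" for cs g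
  proof -
    have "holds (eqsF (Cs D) cs) ?e m \<longleftrightarrow> map e (Cs D) = cs"
      using len(1)[OF that] by (subst holds_eqsF) (simp_all only: 2 length_map length_upt)
    moreover have "holds (eqsF (Ys D) (table cs g)) ?e m \<longleftrightarrow> ys = table cs g"
      using len(2)[OF that] by (subst holds_eqsF) (simp_all only: 1 length_map length_upt)
    ultimately show ?thesis using 3 by simp
  qed
  then have "holds (tableF q D) ?e m \<longleftrightarrow>
      (\<exists>cs\<in>set ?T. \<exists>g<q ^ D - 1. e VG = g \<and> map e (Cs D) = cs \<and> ys = table cs g)"
    unfolding tableF_def holds_disjs by (auto simp del: conjs.simps holds_conjs upt_Suc map_map)
  then show ?thesis using assms(3,4) by blast
qed

lemma sem_roundC:
  assumes l: "loaded (vars S) (arrs S)" and g: "arrs S Dig (vars S VJ) < q ^ D - 1"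
  shows "arrs (sem (roundC q D (Suc \<sigma>)) S) Col = branch (arrs S Col) (arrs S Dig (vars S VJ))"
proof -
  let ?A = "arrs S Col" and ?e = "vars S" and ?m = "arrs S" and ?f = "patF D (Suc \<sigma>)"
  have nn: "?e VN = n" "?e VQ1 = Suc q" using l by (simp_all add: loaded_def)
  have st: "holds (exs (Xs D) VN (exs (Cs D) VQ1 ?f)) ?e ?m \<longleftrightarrow> \<not> stuck ?A"
    using holds_exs_patF[OF l] by (subst holds_exs) (auto simp: nn stuck_def tuples_def)
  show ?thesis
  proof (cases "stuck ?A")
    case True
    then show ?thesis using st by (simp add: roundC_def branch_def)
  next
    case False
    note pk = pick[OF False]
    have pX: "length (pickX ?A) = D" using pk(1) by (auto simp: tuples_def)
    have pC: "length (pickC ?A) = D" using pk(2) by (auto simp: tuples_def)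
    have "wit D n (\<lambda>ys. holds (exs (Cs D) VQ1 ?f) (upds ?e (Xs D) ys) ?m) = pickX ?A"
      unfolding pickX_def by (rule wit_cong) (rule holds_exs_patF[OF l])
    then have 1: "sem (finds (Xs D) VN (exs (Cs D) VQ1 ?f)) S = S\<lparr>vars := upds ?e (Xs D) (pickX ?A)\<rparr>"
      by (subst sem_finds) (auto simp: nn)
    let ?e1 = "upds ?e (Xs D) (pickX ?A)"
    have "?e1 VQ1 = Suc q" using nn by (subst upds_outside) auto
    moreover have "wit D (Suc q) (\<lambda>ys. holds ?f (upds ?e1 (Cs D) ys) ?m) = pickC ?A"
      unfolding pickC_def by (rule wit_cong) (rule holds_patF[OF l pX])
    ultimately have 2: "sem (finds (Cs D) VQ1 ?f) (S\<lparr>vars := ?e1\<rparr>) = S\<lparr>vars := upds ?e1 (Cs D) (pickC ?A)\<rparr>"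
      by (subst sem_finds) auto
    let ?e2 = "upds ?e1 (Cs D) (pickC ?A)"
    let ?d = "arrs S Dig (vars S VJ)"
    let ?e3 = "?e2(VG := ?d)"
    have J: "?e2 VJ = ?e VJ" by (subst upds_outside, force, subst upds_outside, force, rule refl)
    then have 3: "sem (Assign VG (Rd Dig VJ)) (S\<lparr>vars := ?e2\<rparr>) = S\<lparr>vars := ?e3\<rparr>"
      by (simp add: setv_def)
    have mp: "map ?e3 (Xs D) = pickX ?A" "map ?e3 (Cs D) = pickC ?A"
      using map_e_upds[OF pX pC, of ?e] by (simp_all cong: map_cong)
    have T: "pickC ?A \<in> set (List.n_lists D [1..<Suc q])"
      unfolding color_tuple_iff[symmetric] using pk by (auto simp: pat_def)
    have tb: "table (pickC ?A) ?d \<in> tuples D (Suc q)"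
    proof -
      have "?d < length (remove1 (pickC ?A) (List.n_lists D [1..<Suc q]))"
        using g T by (simp add: length_remove1 length_n_lists del: upt_Suc)
      then have "table (pickC ?A) ?d \<in> set (remove1 (pickC ?A) (List.n_lists D [1..<Suc q]))"
        unfolding color_table_def by (rule nth_mem)
      then have "table (pickC ?A) ?d \<in> set (List.n_lists D [1..<Suc q])" using notin_set_remove1 by metis
      then show ?thesis using color_tuple_iff by blast
    qed
    have "?e3 VQ1 = Suc q"
      using nn by simp (subst upds_outside, force, subst upds_outside, force, simp)
    \<comment> \<open>The table formula has exactly one solution, so the search returns the entry
      for this digit.\<close>
    moreover have "wit D (Suc q) (\<lambda>ys. holds (tableF q D) (upds ?e3 (Ys D) ys) ?m) = table (pickC ?A) ?d"
    proof (rule wit_unique[OF tb])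
      fix zs :: "nat list" assume "length zs = D"
      then show "holds (tableF q D) (upds ?e3 (Ys D) zs) ?m \<longleftrightarrow> zs = table (pickC ?A) ?d"
        using holds_tableF[of ?e3 zs ?m] g T pC unfolding mp by (simp del: upt_Suc)
    qed
    ultimately have 4: "sem (finds (Ys D) VQ1 (tableF q D)) (S\<lparr>vars := ?e3\<rparr>) =
        S\<lparr>vars := upds ?e3 (Ys D) (table (pickC ?A) ?d)\<rparr>"
      by (subst sem_finds) auto
    let ?e4 = "upds ?e3 (Ys D) (table (pickC ?A) ?d)"
    have "map ?e4 (Xs D) = map ?e3 (Xs D)" by (intro map_cong refl upds_outside) auto
    then have mX: "map ?e4 (Xs D) = pickX ?A" using mp(1) by (rule trans)
    have mY: "map ?e4 (Ys D) = table (pickC ?A) ?d"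
      using tb by (intro map_upds) (auto simp: tuples_def distinct_map inj_on_def)
    have "sem (roundC q D (Suc \<sigma>)) S = sem (puts Col (Xs D) (Ys D)) (S\<lparr>vars := ?e4\<rparr>)"
      using False st by (simp only: roundC_def sem.simps(6,7) seqs.simps 1 2 3 4 not_False_eq_True if_True sem.simps(1))
    then have "arrs (sem (roundC q D (Suc \<sigma>)) S) Col = upds ?A (map ?e4 (Xs D)) (map ?e4 (Ys D))"
      by (simp add: sem_puts del: map_map)
    then show ?thesis unfolding mX mY branch_def using False by simp
  qed
qed

lemma sem_clearC:
  assumes "vars S VN = n" "vars S VZ = 0" "\<forall>y\<ge>n. arrs S Col y = 0"
  shows "arrs (sem clearC S) Col = (\<lambda>_. 0)"
proof -
  let ?I = "\<lambda>i (S :: store). vars S VZ = 0 \<and> (\<forall>y. y < i \<or> n \<le> y \<longrightarrow> arrs S Col y = 0)"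
  have "?I n (iter (\<lambda>i S. sem (Put Col VU VZ) (setv VU i S)) n S)"
    by (rule iter_invariant[where I = ?I]) (use assms in auto)
  then have "arrs (sem clearC S) Col y = 0" for y using assms(1) by (cases "y < n") (auto simp: clearC_def)
  then show ?thesis by auto
qed

lemma sem_fillC:
  assumes "vars S VN = n" "arrs S Hub = (\<lambda>u. of_bool (u \<in> Q))" "arrs S Col = A"
  shows "arrs (sem fillC S) Col = fill A"
proof -
  let ?I = "\<lambda>i (S :: store). arrs S Hub = (\<lambda>u. of_bool (u \<in> Q)) \<and>
    arrs S Col = (\<lambda>y. if y < i then fill A y else A y)"
  have "?I n (iter (\<lambda>i S. sem (Cond (freeF VU) (seqs [Assign VG (TN 1), Put Col VU VG]) Skip) (setv VU i S)) n S)"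
    by (rule iter_invariant[where I = ?I]) (use assms in \<open>auto simp: freeF_def fill_def fun_eq_iff less_Suc_eq\<close>)
  then have "arrs (sem fillC S) Col = (\<lambda>y. if y < n then fill A y else A y)"
    using assms(1) by (simp add: fillC_def)
  also have "\<dots> = fill A" using Q_less by (fastforce simp: fill_def fun_eq_iff)
  finally show ?thesis .
qed

end

section \<open>The counter, powers and complete passes\<close>

lemma sem_advanceC:
  assumes B: "2 \<le> B" and "vars S VZ = 0" "vars S VR = k" "\<forall>i<k. arrs S Dig i = t div B ^ i mod B"
  shows "\<forall>i<k. arrs (sem (advanceC B) S) Dig i = Suc t div B ^ i mod B"
proof -
  let ?c = "Cond (Eq (TV VK) (TN 1))
     (seqs [Assign VG (Rd Dig VI), Inc VG,
        Cond (Eq (TV VG) (TN B)) (Put Dig VI VZ) (Seq (Put Dig VI VG) (Assign VK (TN 0)))])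
     Skip"
  \<comment> \<open>The carry reaches digit \<open>i\<close> iff all lower digits of
    \<open>t\<close> equal \<open>B - 1\<close>, that is, iff \<open>B ^ i\<close> divides
    \<open>Suc t\<close>.\<close>
  let ?I = "\<lambda>i (S :: store). vars S VZ = 0 \<and> vars S VK = of_bool (B ^ i dvd Suc t) \<and>
    (\<forall>j<k. arrs S Dig j = (if j < i then Suc t else t) div B ^ j mod B)"
  let ?S = "setv VK 1 S"
  have "?I k (iter (\<lambda>i S. sem ?c (setv VI i S)) k ?S)"
  proof (rule iter_invariant[where I = ?I])
    show "?I 0 ?S" using assms by simp
    fix i S assume i: "i < k" and I: "?I i S"
    show "?I (Suc i) (sem ?c (setv VI i S))"
    proof (cases "B ^ i dvd Suc t")
      case False
      then have "Suc t div B ^ i = t div B ^ i" by (simp add: div_Suc dvd_eq_mod_eq_0)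
      moreover have "\<not> B ^ Suc i dvd Suc t" using False dvd_mult_right by (metis power_Suc)
      ultimately show ?thesis using False I by (auto simp: less_Suc_eq)
    next
      case True
      then have d: "Suc t div B ^ i = Suc (t div B ^ i)" by (simp add: div_Suc dvd_eq_mod_eq_0)
      have dv: "B ^ Suc i dvd Suc t \<longleftrightarrow> B dvd Suc (t div B ^ i)"
        unfolding d[symmetric] using True B dvd_div_iff_mult[of "B ^ i" "Suc t" B] by simp
      have md: "Suc (t div B ^ i) mod B = (if Suc (t div B ^ i mod B) = B then 0 else Suc (t div B ^ i mod B))"
        by (rule mod_Suc)
      have "B dvd Suc (t div B ^ i) \<longleftrightarrow> Suc (t div B ^ i mod B) = B"
        unfolding dvd_eq_mod_eq_0 md by simp
      then show ?thesis using True I i d dv md by (auto simp: less_Suc_eq)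
    qed
  qed
  then show ?thesis using assms(3) by (simp add: advanceC_def)
qed


lemma powerC_inner:
  "vars (sem (Loop VJ VT (seqs (replicate B (Inc VM)))) S) VM = vars S VM + vars S VT * B"
  "csteps (Loop VJ VT (seqs (replicate B (Inc VM)))) S = Suc (vars S VT * Suc B)"
proof -
  have "vars (iter (\<lambda>j S. sem (seqs (replicate B (Inc VM))) (setv VJ j S)) k S) VM = vars S VM + k * B" for k
    by (induction k) (auto simp: seq_inc)
  then show "vars (sem (Loop VJ VT (seqs (replicate B (Inc VM)))) S) VM = vars S VM + vars S VT * B"
    by simp
  show "csteps (Loop VJ VT (seqs (replicate B (Inc VM)))) S = Suc (vars S VT * Suc B)"
    by (simp add: seq_inc)
qed

lemma sem_powerC:
  assumes "vars S VR = r"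
  shows "vars (sem (powerC B) S) VT = B ^ r"
    "1 \<le> B \<Longrightarrow> csteps (powerC B) S \<le> 3 + r * (4 + B ^ r * Suc B)"
proof -
  let ?c = "seqs [Assign VM (TN 0), Loop VJ VT (seqs (replicate B (Inc VM))), Assign VT (TV VM)]"
  let ?I = "\<lambda>k. iter (\<lambda>i S. sem ?c (setv VI i S)) k (setv VT 1 S)"
  have step: "vars (sem ?c S) VT = vars S VT * B" for S
    by (simp add: powerC_inner del: sem.simps(8))
  have I: "vars (?I k) VT = B ^ k" for k
    by (induction k) (simp_all add: step del: seqs.simps sem.simps)
  then show "vars (sem (powerC B) S) VT = B ^ r" using assms by (simp add: powerC_def)
  assume B: "1 \<le> B"
  have c: "csteps ?c (setv VI k (?I k)) = 3 + B ^ k * Suc B" for k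
    using I[of k] by (simp add: powerC_inner del: sem.simps(8) csteps.simps(8))
  have "(\<Sum>k<r. Suc (csteps ?c (setv VI k (?I k)))) \<le> r * (4 + B ^ r * Suc B)"
  proof (rule sum_le_const)
    fix k assume "k < r"
    then have "B ^ k * Suc B \<le> B ^ r * Suc B" using B by (intro mult_right_mono power_increasing) auto
    then show "Suc (csteps ?c (setv VI k (?I k))) \<le> 4 + B ^ r * Suc B" unfolding c by simp
  qed simp
  then show "csteps (powerC B) S \<le> 3 + r * (4 + B ^ r * Suc B)"
    using assms by (simp only: powerC_def csteps.simps(6,2,8) sem.simps(2)) simp
qed

definition digit :: "nat \<Rightarrow> nat \<Rightarrow> nat \<Rightarrow> nat" where
  "digit B t i = t div B ^ i mod B"

lemma bodyC_sets:
  "mods (bodyC q k s) \<subseteq> {VU, VJ, VG, VI, VK, VRes} \<union> set (Xs k) \<union> set (Cs k) \<union> set (Ys k)"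
  "amods (bodyC q k s) \<subseteq> {Col, Dig}" "cbounds (bodyC q k s) \<subseteq> {VN, VN1, VQ1, VR}"
  using roundC_sets[of q k s] fbounds_finalF[of k s]
  by (auto simp: bodyC_def clearC_def fillC_def advanceC_def freeF_def)

context hub_instance
begin

abbreviation "B \<equiv> q ^ D - 1"
abbreviation "R \<equiv> card Q div D"

lemma sem_roundsC:
  assumes "vars S VN = n" "arrs S Hub = (\<lambda>u. of_bool (u \<in> Q))"
  shows "vars (sem (roundsC D) S) VR = R"
proof -
  let ?c = "Cond (Eq (Rd Hub VU) (TN 1))
     (Seq (Inc VK) (Cond (Eq (TV VK) (TN D)) (Seq (Assign VK (TN 0)) (Inc VR)) Skip)) Skip"
  let ?I = "\<lambda>i (S :: store). arrs S Hub = (\<lambda>u. of_bool (u \<in> Q)) \<and>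
    vars S VR * D + vars S VK = card (Q \<inter> {..<i}) \<and> vars S VK < D"
  let ?S = "setv VK 0 (setv VR 0 S)"
  have card: "card (Q \<inter> {..<Suc i}) = (if i \<in> Q then Suc (card (Q \<inter> {..<i})) else card (Q \<inter> {..<i}))" for i
    by (simp add: lessThan_Suc)
  have "?I n (iter (\<lambda>i S. sem ?c (setv VU i S)) n ?S)"
    by (rule iter_invariant[where I = ?I]) (use assms in \<open>auto simp: card\<close>)
  moreover have "Q \<inter> {..<n} = Q" using Q_less by auto
  ultimately have "?I n (sem (roundsC D) S)" "Q \<inter> {..<n} = Q"
    using assms(1) by (simp_all add: roundsC_def)
  then have *: "card Q = vars (sem (roundsC D) S) VK + vars (sem (roundsC D) S) VR * D"
    "vars (sem (roundsC D) S) VK < D" by auto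
  then show ?thesis by (simp add: *(1))
qed

text \<open>Each pass replays its path from the empty coloring. This costs only a polynomial factor
  and spares a stack for backtracking. \<open>VRes\<close> is never reset, so one success is
  remembered.\<close>

lemma sem_bodyC:
  assumes q: "2 \<le> q" and l: "loaded (vars S) (arrs S)" and R: "vars S VR = R"
    and C: "\<forall>y\<ge>n. arrs S Col y = 0" and Dg: "\<forall>i<R. arrs S Dig i = digit B t i"
  defines "S' \<equiv> sem (bodyC q D (Suc \<sigma>)) S"
  shows "loaded (vars S') (arrs S')" "vars S' VR = R" "\<forall>y\<ge>n. arrs S' Col y = 0"
    "\<forall>i<R. arrs S' Dig i = digit B (Suc t) i"
    "vars S' VRes = (if final (path (digit B t) R) then 1 else vars S VRes)"
proof -
  have "2 ^ 2 \<le> q ^ 2" using q by (intro power_mono) auto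
  also have "q ^ 2 \<le> q ^ D" using q by (intro power_increasing) auto
  finally have B: "2 \<le> B" by simp
  let ?c = "roundC q D (Suc \<sigma>)"
  have lS: "loaded (vars (sem c S)) (arrs (sem c S))"
    if "loaded (vars S) (arrs S)" "mods c \<subseteq> mods (bodyC q D (Suc \<sigma>)) \<union> {VU, VJ, VG, VI, VK, VRes}"
      "amods c \<subseteq> {Col, Dig}" for c S
    using that bodyC_sets[of q D "Suc \<sigma>"] by (intro loaded_sem) auto
  define S1 where "S1 = sem clearC S"
  have S1: "loaded (vars S1) (arrs S1)" "vars S1 VR = R" "arrs S1 Col = path (digit B t) 0"
    "arrs S1 Dig = arrs S Dig" "vars S1 VRes = vars S VRes"
    unfolding S1_def
    using sem_clearC[OF _ _ C] l R lS[OF l, of clearC]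
    by (auto simp: loaded_def vars_sem arrs_sem clearC_def simp del: sem.simps)
  let ?I = "\<lambda>j (S :: store). loaded (vars S) (arrs S) \<and> vars S VR = R \<and>
    arrs S Col = path (digit B t) j \<and> (\<forall>i<R. arrs S Dig i = digit B t i) \<and> vars S VRes = vars S1 VRes"
  define S2 where "S2 = sem (Loop VJ VR ?c) S1"
  have "?I R (iter (\<lambda>j S. sem ?c (setv VJ j S)) R S1)"
  proof (rule iter_invariant[where I = ?I])
    show "?I 0 S1" using S1 Dg by simp
    fix j S assume j: "j < R" and I: "?I j S"
    let ?S = "setv VJ j S"
    have l: "loaded (vars ?S) (arrs ?S)" by (rule loaded_cong[of "vars S" "arrs S"]) (use I in auto)
    have d: "arrs ?S Dig (vars ?S VJ) = digit B t j" using I j by simp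
    then have "arrs ?S Dig (vars ?S VJ) < B" using B by (simp add: digit_def)
    from sem_roundC[OF l this] have "arrs (sem ?c ?S) Col = path (digit B t) (Suc j)"
      unfolding d using I by simp
    moreover have "loaded (vars (sem ?c ?S)) (arrs (sem ?c ?S))"
      by (rule loaded_sem[OF l]) (use roundC_sets[of q D "Suc \<sigma>"] in auto)
    moreover have "vars (sem ?c ?S) VR = R" "vars (sem ?c ?S) VRes = vars S1 VRes" "arrs (sem ?c ?S) Dig = arrs S Dig"
      using I roundC_sets[of q D "Suc \<sigma>"] by (subst vars_sem arrs_sem; force)+
    ultimately show "?I (Suc j) (sem ?c ?S)" using I by simp
  qed
  then have S2: "?I R S2" using S1 by (simp add: S2_def)
  define S3 where "S3 = sem fillC S2"
  have hub2: "arrs S2 Hub = (\<lambda>u. of_bool (u \<in> Q))" "vars S2 VN = n" using S2 by (auto simp: loaded_def)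
  have S3: "loaded (vars S3) (arrs S3)" "vars S3 VR = R" "arrs S3 Col = fill (path (digit B t) R)"
    "\<forall>i<R. arrs S3 Dig i = digit B t i" "vars S3 VRes = vars S1 VRes"
    unfolding S3_def
    using sem_fillC[OF hub2(2,1)] S2 lS[of S2 fillC]
    by (auto simp: vars_sem arrs_sem fillC_def simp del: sem.simps)
  define S4 where "S4 = sem (Cond (finalF D (Suc \<sigma>)) (Assign VRes (TN 1)) Skip) S3"
  have S4: "loaded (vars S4) (arrs S4)" "vars S4 VR = R" "arrs S4 = arrs S3"
    "vars S4 VRes = (if final (path (digit B t) R) then 1 else vars S1 VRes)"
    using S3 lS[of S3 "Cond (finalF D (Suc \<sigma>)) (Assign VRes (TN 1)) Skip"] holds_finalF[OF S3(1,3)]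
    by (auto simp: S4_def)
  have S': "S' = sem (advanceC B) S4"
    by (simp only: S'_def S4_def S3_def S2_def S1_def bodyC_def seqs.simps sem.simps(6,1))
  show "loaded (vars S') (arrs S')" unfolding S' by (rule lS[OF S4(1)]) (auto simp: advanceC_def)
  show "vars S' VR = R" unfolding S' using S4(2) by (subst vars_sem) (auto simp: advanceC_def)
  show "vars S' VRes = (if final (path (digit B t) R) then 1 else vars S VRes)"
    unfolding S' using S4(4) S1(5) by (subst vars_sem) (auto simp: advanceC_def)
  have "arrs S' Col = fill (path (digit B t) R)"
    unfolding S' using S4(3) S3(3) by (subst arrs_sem) (auto simp: advanceC_def)
  then show "\<forall>y\<ge>n. arrs S' Col y = 0" using path_outside Q_less by (fastforce simp: fill_def)
  have "\<forall>i<R. arrs S4 Dig i = t div B ^ i mod B" using S3(4) S4(3) by (simp add: digit_def)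
  moreover have "vars S4 VZ = 0" using S4(1) by (simp add: loaded_def)
  ultimately show "\<forall>i<R. arrs S' Dig i = digit B (Suc t) i"
    unfolding S' using sem_advanceC[OF B _ S4(2)] by (simp add: digit_def)
qed

text \<open>A success at any counter value is sound by \<open>final_sound\<close>. Conversely, the
  digits given by \<open>final_complete\<close> are those of some counter value by
  \<open>digits_surj\<close>.\<close>

lemma sem_search:
  assumes q: "2 \<le> q" and l: "loaded (vars S) (arrs S)" and R: "vars S VR = R"
    and C: "\<forall>y\<ge>n. arrs S Col y = 0" and Dg: "\<forall>i<R. arrs S Dig i = 0" and T: "vars S VT = B ^ R"
    and r: "vars S VRes = 0"
  shows "vars (sem (Loop VL VT (bodyC q D (Suc \<sigma>))) S) VRes = of_bool (list_colorable G L)"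
    "vars S VN + vars S VN1 + vars S VQ1 + vars S VR \<le> N \<Longrightarrow>
      csteps (Loop VL VT (bodyC q D (Suc \<sigma>))) S \<le> Suc (B ^ R * Suc (cpoly (bodyC q D (Suc \<sigma>)) N))"
proof -
  let ?c = "bodyC q D (Suc \<sigma>)"
  let ?I = "\<lambda>t (S :: store). loaded (vars S) (arrs S) \<and> vars S VR = R \<and>
    (\<forall>y\<ge>n. arrs S Col y = 0) \<and> (\<forall>i<R. arrs S Dig i = digit B t i) \<and>
    vars S VRes = of_bool (\<exists>t'<t. final (path (digit B t') R))"
  have I: "?I k (iter (\<lambda>t S. sem ?c (setv VL t S)) k S)" for k
  proof (rule iter_invariant[where I = ?I])
    show "?I 0 S" using assms by (simp add: digit_def)
    fix t S assume I: "?I t S"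
    let ?S = "setv VL t S"
    have l: "loaded (vars ?S) (arrs ?S)" by (rule loaded_cong[of "vars S" "arrs S"]) (use I in auto)
    have "vars ?S VR = R" "\<forall>y\<ge>n. arrs ?S Col y = 0" "\<forall>i<R. arrs ?S Dig i = digit B t i"
      using I by auto
    from sem_bodyC[OF q l this] I show "?I (Suc t) (sem ?c ?S)" by (auto simp: less_Suc_eq)
  qed
  have "(\<exists>t<B ^ R. final (path (digit B t) R)) \<longleftrightarrow> list_colorable G L"
  proof
    assume "list_colorable G L"
    then obtain g where g: "\<forall>i<R. g i < B" "final (path g R)" using final_complete[OF q] by blast
    obtain t where t: "t < B ^ R" "\<forall>i<R. t div B ^ i mod B = g i" using digits_surj[of R g B] g(1) by blast
    have "path (digit B t) R = path g R" by (rule path_cong) (use t in \<open>simp add: digit_def\<close>)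
    then show "\<exists>t<B ^ R. final (path (digit B t) R)" using t(1) g(2) by auto
  qed (use final_sound in blast)
  then show "vars (sem (Loop VL VT ?c) S) VRes = of_bool (list_colorable G L)"
    using I[of "B ^ R"] T by simp
  assume N: "vars S VN + vars S VN1 + vars S VQ1 + vars S VR \<le> N"
  have "csteps ?c (setv VL k (iter (\<lambda>t S. sem ?c (setv VL t S)) k S)) \<le> cpoly ?c N" for k
  proof (rule csteps_le)
    show "cbounds ?c \<inter> mods ?c = {}" using bodyC_sets[of q D "Suc \<sigma>"] by auto
    define S' where "S' = iter (\<lambda>t S. sem ?c (setv VL t S)) k S"
    have "loaded (vars S') (arrs S')" "vars S' VR = R" unfolding S'_def using I[of k] by blast+
    then have "vars S' b \<le> N" if "b \<in> {VN, VN1, VQ1, VR}" for b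
      using that l R N by (auto simp: loaded_def)
    then show "\<forall>b\<in>cbounds ?c. vars (setv VL k (iter (\<lambda>t S. sem ?c (setv VL t S)) k S)) b \<le> N"
      using bodyC_sets(3)[of q D "Suc \<sigma>"] unfolding S'_def[symmetric] by auto
  qed
  then have "(\<Sum>k<B ^ R. Suc (csteps ?c (setv VL k (iter (\<lambda>t S. sem ?c (setv VL t S)) k S)))) \<le>
      B ^ R * Suc (cpoly ?c N)" by (intro sum_le_const) auto
  then show "csteps (Loop VL VT ?c) S \<le> Suc (B ^ R * Suc (cpoly ?c N))" using T by simp
qed

section \<open>Loading the encoded instance\<close>

definition xs_adj where "xs_adj = concat (map (\<lambda>u. map (\<lambda>v. of_bool (E u v) :: nat) [0..<n]) [0..<n])"
definition xs_list where "xs_list = concat (map (\<lambda>u. map (\<lambda>c. of_bool (Suc c \<in> L u) :: nat) [0..<q]) [0..<n])"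
definition xs_hub where "xs_hub = map (\<lambda>u. of_bool (u \<in> Q) :: nat) [0..<n]"

lemma encode_eq: "encode q G L Q = n # xs_adj @ xs_list @ xs_hub"
proof -
  have "[1..<Suc q] = map Suc [0..<q]" by (simp add: map_Suc_upt)
  then show ?thesis
    by (simp add: encode_def verts xs_adj_def xs_list_def xs_hub_def E_def Let_def comp_def del: upt_Suc)
qed

lemma sem_loadC:
  assumes S: "vars S VN = n" "vars S VZ = 0" "arrs S Hub = (\<lambda>_. 0)" "ins S = xs_adj @ xs_list @ xs_hub"
  shows "loaded (vars (sem (loadC q) S)) (arrs (sem (loadC q) S))"
proof -
  define S1 where "S1 = sem (Inc VN1) (sem (Assign VN1 (TV VN)) (sem (Assign VQ1 (TN (Suc q))) (sem (Assign VQ (TN q)) S)))"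
  define S2 where "S2 = sem (readC Adj Row VN False) S1"
  define S3 where "S3 = sem (readC Lst LRow VQ True) S2"
  let ?c = "Seq (Input VA) (Put Hub VU VA)"
  define S4 where "S4 = sem (Loop VU VN ?c) S3"
  have S1: "vars S1 VN = n" "vars S1 VN1 = Suc n" "vars S1 VQ = q" "vars S1 VQ1 = Suc q" "vars S1 VZ = 0"
    "arrs S1 Hub = (\<lambda>_. 0)" "ins S1 = xs_adj @ xs_list @ xs_hub"
    using S by (simp_all add: S1_def)
  have rd: "mods (readC a r b late) \<subseteq> {VP, VU, VV, VA}" "amods (readC a r b late) \<subseteq> {a, r}" for a r b late
    by (auto simp: readC_def)
  have v2: "vars S2 x = vars S1 x" if "x \<notin> {VP, VU, VV, VA}" for x
    unfolding S2_def using that rd[of Adj Row VN False] by (intro vars_sem) auto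
  have v3: "vars S3 x = vars S2 x" if "x \<notin> {VP, VU, VV, VA}" for x
    unfolding S3_def using that rd[of Lst LRow VQ True] by (intro vars_sem) auto
  have v4: "vars S4 x = vars S3 x" if "x \<notin> {VU, VA}" for x
    unfolding S4_def using that by (intro vars_sem) auto
  have a2: "arrs S2 x = arrs S1 x" if "x \<notin> {Adj, Row}" for x
    unfolding S2_def using that rd[of Adj Row VN False] by (intro arrs_sem) auto
  have a3: "arrs S3 x = arrs S2 x" if "x \<notin> {Lst, LRow}" for x
    unfolding S3_def using that rd[of Lst LRow VQ True] by (intro arrs_sem) auto
  have a4: "arrs S4 x = arrs S3 x" if "x \<noteq> Hub" for x
    unfolding S4_def using that by (intro arrs_sem) auto
  have S2: "ins S2 = xs_list @ xs_hub" "\<And>u. u < n \<Longrightarrow> arrs S2 Row u = u * n"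
    "\<And>u v. u < n \<Longrightarrow> v < n \<Longrightarrow> arrs S2 Adj (u * n + v) = of_bool (E u v)"
    using sem_readC[where b = VN and a = Adj and r = Row and S = S1 and n = n and w = n and
        f = "\<lambda>u v. of_bool (E u v)" and rest = "xs_list @ xs_hub" and late = False] S1
    by (simp_all add: S2_def xs_adj_def)
  have S3: "ins S3 = xs_hub" "\<And>u. u < n \<Longrightarrow> arrs S3 LRow u = u * q"
    "\<And>u v. u < n \<Longrightarrow> v < q \<Longrightarrow> arrs S3 Lst (u * q + v + 1) = of_bool (Suc v \<in> L u)"
    using sem_readC[where b = VQ and a = Lst and r = LRow and S = S2 and n = n and w = q and
        f = "\<lambda>u c. of_bool (Suc c \<in> L u)" and rest = xs_hub and late = True] S1 S2 v2
    by (simp_all add: S3_def xs_list_def)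
  let ?I = "\<lambda>i (S :: store). ins S = map (\<lambda>u. of_bool (u \<in> Q)) [i..<n] \<and>
    arrs S Hub = (\<lambda>u. of_bool (u < i \<and> u \<in> Q))"
  have "?I n (iter (\<lambda>i S. sem ?c (setv VU i S)) n S3)"
    by (rule iter_invariant[where I = ?I])
      (use S1 S3 a2 a3 in \<open>auto simp: xs_hub_def upt_conv_Cons next_input_def fun_eq_iff less_Suc_eq\<close>)
  then have "arrs S4 Hub = (\<lambda>u. of_bool (u < n \<and> u \<in> Q))" using S1 v2 v3 by (simp add: S4_def)
  also have "\<dots> = (\<lambda>u. of_bool (u \<in> Q))" using Q_less by (fastforce simp: fun_eq_iff)
  finally have hub: "arrs S4 Hub = (\<lambda>u. of_bool (u \<in> Q))" .
  have "arrs S4 Lst (arrs S4 LRow u + c) = of_bool (c \<in> L u)" if "u < n" "0 < c" "c \<le> q" for u c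
    using S3(2)[OF that(1)] S3(3)[OF that(1), of "c - 1"] that a4 by simp
  moreover have "arrs S4 Adj (arrs S4 Row u + v) = of_bool (E u v)" if "u < n" "v < n" for u v
    using S2(2)[OF that(1)] S2(3)[OF that] a3 a4 by simp
  ultimately have "loaded (vars S4) (arrs S4)"
    unfolding loaded_def using S1 v2 v3 v4 hub by simp
  moreover have "S4 = sem (loadC q) S"
    by (simp only: S4_def S3_def S2_def S1_def loadC_def seqs.simps sem.simps(6,1))
  ultimately show ?thesis by simp
qed

end


section \<open>Running time\<close>

text \<open>The part of \<open>loadC\<close> that assigns none of its own loop bounds, so that
  \<open>csteps_le\<close> applies to it.\<close>

definition readAllC :: com where
  "readAllC = seqs [readC Adj Row VN False, readC Lst LRow VQ True, Loop VU VN (Seq (Input VA) (Put Hub VU VA))]"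

text \<open>The factor in front of the number of passes. The summand with \<open>q ^ k\<close> comes
  from \<open>powerC\<close>, where \<open>q ^ k\<close> is the successor of the base; the additive
  constant is rounded up.\<close>

definition main_poly :: "nat \<Rightarrow> nat \<Rightarrow> nat \<Rightarrow> nat \<Rightarrow> nat" where
  "main_poly q k s N = 2 * q + 12 + cpoly readAllC N + cpoly (roundsC k) N +
     N * (4 + q ^ k) + cpoly (bodyC q k s) N"

lemma poly_bounded_main_poly: "poly_bounded (main_poly q k s)"
proof -
  have "poly_bounded (\<lambda>N. main_poly q k s N)"
    unfolding main_poly_def by (intro poly_bounded_intros poly_bounded_cpoly)
  then show ?thesis by simp
qed

lemma poly_bounded_comp_linear:
  assumes "poly_bounded f"
  shows "poly_bounded (\<lambda>n. f (a * n + b))"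
proof -
  obtain C d where *: "\<And>N. f N \<le> C * (N + 1) ^ d" using assms by (auto simp: poly_bounded_def)
  have "f (a * n + b) \<le> (C * (a + b + 1) ^ d) * (n + 1) ^ d" for n
  proof -
    have "a * n + b + 1 \<le> (a + b + 1) * (n + 1)" by (simp add: algebra_simps)
    then have "C * (a * n + b + 1) ^ d \<le> C * ((a + b + 1) * (n + 1)) ^ d"
      by (intro mult_left_mono power_mono) auto
    with *[of "a * n + b"] have "f (a * n + b) \<le> C * ((a + b + 1) * (n + 1)) ^ d" by (rule order_trans)
    then show ?thesis by (simp only: power_mult_distrib mult.assoc)
  qed
  then show ?thesis unfolding poly_bounded_def by blast
qed

text \<open>The crude estimates \<open>a < 2 ^ a\<close> and \<open>b \<le> 2 ^ b\<close> suffice: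
  the length of an exponentially large number is linear in the exponent.\<close>

lemma bits_mult_power: "bits (a * b ^ r) \<le> Suc (a + b * r)"
proof -
  have "a * b ^ r < 2 ^ (a + b * r)"
  proof -
    have "b ^ r \<le> (2 ^ b) ^ r" by (intro power_mono) (auto intro: less_imp_le)
    then have "a * b ^ r \<le> a * 2 ^ (b * r)" by (simp add: power_mult)
    also have "\<dots> < 2 ^ a * 2 ^ (b * r)" by simp
    finally show ?thesis by (simp add: power_add)
  qed
  then have "floorlog 2 (a * b ^ r) \<le> a + b * r" by (intro floorlog_leI) auto
  then show ?thesis by (simp add: bits_def)
qed

context hub_instance
begin

lemma rounds_le: "R \<le> n"
proof -
  have "card Q \<le> card {..<n}" using Q_less by (intro card_mono) auto
  then show ?thesis by (intro le_trans[OF div_le_dividend]) simp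
qed

lemma mainC_correct:
  assumes q: "2 \<le> q"
  defines "S \<equiv> init_store (encode q G L Q)"
  shows "vars (sem (mainC q D (Suc \<sigma>)) S) VRes = of_bool (list_colorable G L)"
    "csteps (mainC q D (Suc \<sigma>)) S \<le> main_poly q D (Suc \<sigma>) (3 * n + (q + 2)) * B ^ R"
proof -
  \<comment> \<open>The sum of the bounding variables \<open>VN\<close>, \<open>VN1\<close>,
    \<open>VQ1\<close> and \<open>VR\<close>, that is \<open>n\<close>, \<open>n + 1\<close>,
    \<open>q + 1\<close> and at most \<open>n\<close>.\<close>
  let ?N = "3 * n + (q + 2)"
  define S1 where "S1 = sem (Input VN) S"
  define S2 where "S2 = sem (loadC q) S1"
  define S3 where "S3 = sem (roundsC D) S2"
  define S4 where "S4 = sem (powerC B) S3"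
  let ?s = "Loop VL VT (bodyC q D (Suc \<sigma>))"
  note Rn = rounds_le
  have S1: "vars S1 = (\<lambda>_. 0)(VN := n)" "arrs S1 = (\<lambda>_ _. 0)" "ins S1 = xs_adj @ xs_list @ xs_hub"
    by (simp_all add: S1_def S_def init_store_def encode_eq next_input_def)
  have l2: "loaded (vars S2) (arrs S2)" unfolding S2_def by (rule sem_loadC) (use S1 in auto)
  have s2: "arrs S2 Col = (\<lambda>_. 0)" "arrs S2 Dig = (\<lambda>_. 0)" "vars S2 VRes = 0"
    unfolding S2_def using S1 by (subst arrs_sem vars_sem; force simp: loadC_def readC_def)+
  have l3: "loaded (vars S3) (arrs S3)"
    unfolding S3_def by (rule loaded_sem[OF l2]) (auto simp: roundsC_def)
  have R3: "vars S3 VR = R"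
    unfolding S3_def using l2 by (intro sem_roundsC) (auto simp: loaded_def)
  have s3: "arrs S3 Col = (\<lambda>_. 0)" "arrs S3 Dig = (\<lambda>_. 0)" "vars S3 VRes = 0"
    unfolding S3_def using s2 by (subst arrs_sem vars_sem; force simp: roundsC_def)+
  have pm: "mods (seqs (replicate b (Inc x))) \<subseteq> {x}" "amods (seqs (replicate b (Inc x))) = {}" for b x
    by (induction b) auto
  have pC: "mods (powerC B) \<subseteq> {VT, VI, VM, VJ}" "amods (powerC B) = {}"
    using pm[of B VM] by (auto simp: powerC_def)
  have l4: "loaded (vars S4) (arrs S4)"
    unfolding S4_def by (rule loaded_sem[OF l3]) (use pC in auto)
  have s4: "arrs S4 Col = (\<lambda>_. 0)" "arrs S4 Dig = (\<lambda>_. 0)" "vars S4 VRes = 0" "vars S4 VR = R"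
    unfolding S4_def using s3 R3 pC by (subst arrs_sem vars_sem; force)+
  have T4: "vars S4 VT = B ^ R" unfolding S4_def by (rule sem_powerC(1)[OF R3])
  have sem: "sem (mainC q D (Suc \<sigma>)) S = sem ?s S4"
    by (simp only: S4_def S3_def S2_def S1_def mainC_def seqs.simps sem.simps(6,1))
  have search: "vars (sem ?s S4) VRes = of_bool (list_colorable G L)"
    "csteps ?s S4 \<le> Suc (B ^ R * Suc (cpoly (bodyC q D (Suc \<sigma>)) ?N))"
    using sem_search(1)[OF q l4 s4(4) _ _ T4 s4(3)] sem_search(2)[OF q l4 s4(4) _ _ T4 s4(3), of ?N]
      s4 l4 Rn by (auto simp: loaded_def)
  show "vars (sem (mainC q D (Suc \<sigma>)) S) VRes = of_bool (list_colorable G L)"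
    unfolding sem by (rule search)
  have "1 < q ^ D" using q by (intro one_less_power) auto
  then have B: "1 \<le> B" "Suc B = q ^ D" by auto
  then have BR: "1 \<le> B ^ R" by simp
  define S1' where "S1' = sem (Inc VN1) (sem (Assign VN1 (TV VN)) (sem (Assign VQ1 (TN (Suc q))) (sem (Assign VQ (TN q)) S1)))"
  have "csteps (loadC q) S1 = 2 * q + 5 + csteps readAllC S1'"
    unfolding loadC_def readAllC_def S1'_def seqs.simps csteps.simps(6)
    by (simp del: sem.simps csteps.simps(1,6,7,8))
  moreover have "csteps readAllC S1' \<le> cpoly readAllC ?N"
    by (rule csteps_le) (use S1 in \<open>auto simp: readAllC_def readC_def S1'_def\<close>)
  ultimately have c2: "csteps (loadC q) S1 \<le> 2 * q + 5 + cpoly readAllC ?N" by simp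
  have c3: "csteps (roundsC D) S2 \<le> cpoly (roundsC D) ?N"
    by (rule csteps_le) (use l2 in \<open>auto simp: roundsC_def loaded_def\<close>)
  have c4: "csteps (powerC B) S3 \<le> 3 + R * (4 + B ^ R * q ^ D)"
    using sem_powerC(2)[OF R3 B(1)] unfolding B(2) .
  have "csteps (mainC q D (Suc \<sigma>)) S =
      1 + (csteps (loadC q) S1 + (csteps (roundsC D) S2 + (csteps (powerC B) S3 + csteps ?s S4)))"
    unfolding mainC_def seqs.simps csteps.simps(1,6) S4_def S3_def S2_def S1_def by simp
  also have "\<dots> \<le> (2 * q + 10 + cpoly readAllC ?N + cpoly (roundsC D) ?N) +
      R * (4 + B ^ R * q ^ D) + B ^ R * Suc (cpoly (bodyC q D (Suc \<sigma>)) ?N)"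
    using c2 c3 c4 search(2) by linarith
  also have "\<dots> \<le> (2 * q + 10 + cpoly readAllC ?N + cpoly (roundsC D) ?N) * B ^ R +
      ?N * (4 + q ^ D) * B ^ R + Suc (cpoly (bodyC q D (Suc \<sigma>)) ?N) * B ^ R"
  proof (intro add_mono)
    have "x \<le> x * B ^ R" for x using BR by (cases "B ^ R") auto
    then show "2 * q + 10 + cpoly readAllC ?N + cpoly (roundsC D) ?N \<le>
        (2 * q + 10 + cpoly readAllC ?N + cpoly (roundsC D) ?N) * B ^ R" .
    have "4 + B ^ R * q ^ D \<le> (4 + q ^ D) * B ^ R" using BR by (simp add: algebra_simps)
    then have "R * (4 + B ^ R * q ^ D) \<le> ?N * ((4 + q ^ D) * B ^ R)" using Rn by (intro mult_mono) auto
    then show "R * (4 + B ^ R * q ^ D) \<le> ?N * (4 + q ^ D) * B ^ R" by (simp only: mult.assoc)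
  qed (simp add: mult.commute)
  also have "\<dots> \<le> main_poly q D (Suc \<sigma>) ?N * B ^ R"
    unfolding main_poly_def add_mult_distrib[symmetric] by (intro mult_right_mono) auto
  finally show "csteps (mainC q D (Suc \<sigma>)) S \<le> main_poly q D (Suc \<sigma>) ?N * B ^ R" .
qed

lemma encode_le: "\<forall>v\<in>set (encode q G L Q). v \<le> n + 1"
  by (auto simp: encode_eq xs_adj_def xs_list_def xs_hub_def)

end

text \<open>At most \<open>41 * F\<close> instructions per unit of the power, each costing twice the
  bit length of the largest register. The second factor is \<open>bits_mult_power\<close> with base
  at most \<open>q ^ k\<close> and exponent at most \<open>n\<close>.\<close>

definition time_poly :: "nat \<Rightarrow> nat \<Rightarrow> nat \<Rightarrow> nat \<Rightarrow> nat" where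
  "time_poly q k s n = (let F = main_poly q k s (3 * n + (q + 2)) in
     (41 * F) * (2 * Suc (32 * (n + 2 + F) + q ^ k * n)))"

lemma poly_bounded_time_poly: "poly_bounded (time_poly q k s)"
proof -
  have "poly_bounded (\<lambda>n. time_poly q k s n)"
    unfolding time_poly_def Let_def
    by (intro poly_bounded_intros poly_bounded_comp_linear poly_bounded_main_poly)
  then show ?thesis by simp
qed

context hub_instance
begin

lemma mainC_decides:
  assumes q: "2 \<le> q" and T: "real (time_poly q D (Suc \<sigma>) n * B ^ R) \<le> Tr"
  shows "decides_in_time (compile (mainC q D (Suc \<sigma>))) (encode q G L Q) (list_colorable G L) Tr"
proof (rule compile_decides[OF encode_le mainC_correct[OF q]])
  let ?F = "main_poly q D (Suc \<sigma>) (3 * n + (q + 2))"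
  have "1 < q ^ D" using q by (intro one_less_power) auto
  then have BR: "1 \<le> B ^ R" by simp
  have F: "1 \<le> ?F" by (simp add: main_poly_def)
  have xB: "x \<le> x * B ^ R" for x using BR by (cases "B ^ R") auto
  \<comment> \<open>The power is pulled out of the sum, so that \<open>bits_mult_power\<close>
    applies.\<close>
  have "cap (n + 1 + ?F * B ^ R) \<le> 32 * (n + 2 + ?F) * B ^ R"
    using xB[of "n + 2"] by (simp add: cap_def algebra_simps)
  then have "bits (cap (n + 1 + ?F * B ^ R)) \<le> bits (32 * (n + 2 + ?F) * B ^ R)" by (rule bits_mono)
  also have "\<dots> \<le> Suc (32 * (n + 2 + ?F) + B * R)" by (rule bits_mult_power)
  also have "\<dots> \<le> Suc (32 * (n + 2 + ?F) + q ^ D * n)" using rounds_le by (intro Suc_le_mono[THEN iffD2] add_left_mono mult_mono) auto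
  finally have b: "bits (cap (n + 1 + ?F * B ^ R)) \<le> Suc (32 * (n + 2 + ?F) + q ^ D * n)" .
  have "1 \<le> ?F * B ^ R" using F BR by (metis mult_le_mono nat_mult_1)
  then have "40 * (?F * B ^ R) + 1 \<le> 41 * ?F * B ^ R" by simp
  then have "(40 * (?F * B ^ R) + 1) * (2 * bits (cap (n + 1 + ?F * B ^ R))) \<le>
      (41 * ?F * B ^ R) * (2 * Suc (32 * (n + 2 + ?F) + q ^ D * n))"
    using b by (intro mult_mono) auto
  also have "\<dots> = time_poly q D (Suc \<sigma>) n * B ^ R" by (simp only: time_poly_def Let_def mult_ac)
  finally show "real ((40 * (?F * B ^ R) + 1) * (2 * bits (cap (n + 1 + ?F * B ^ R)))) \<le> Tr"
    using T by (meson of_nat_le_iff order_trans)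
qed

end

text \<open>The root is at least 1, so raising the exponent from the multiple
  \<open>k * (p div k)\<close> to \<open>p\<close> cannot decrease the power.\<close>

lemma power_div_le_root_power:
  fixes b k p :: nat
  assumes "1 \<le> b" "0 < k"
  shows "real (b ^ (p div k)) \<le> root k (real b) ^ p"
proof -
  have "real (b ^ (p div k)) = root k (real b) ^ (k * (p div k))"
    using assms by (simp add: power_mult)
  also have "\<dots> \<le> root k (real b) ^ p"
    using assms by (intro power_increasing) auto
  finally show ?thesis .
qed

theorem theorem7p1:
  "\<forall>q::nat. q \<ge> 3 \<longrightarrow> (\<forall>\<delta>::nat. \<exists>\<epsilon>::real. \<epsilon> > 0 \<and>
     (\<forall>\<sigma>::nat. \<exists>(P::instr list) (C::nat) (d::nat).
        \<forall>(n::nat) (p::nat) (G::nat graph) (L::nat \<Rightarrow> nat set) (Q::nat set).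
          list_coloring_instance q G L \<and> verts G = {0..<n} \<and> hub \<sigma> \<delta> G Q \<and> card Q = p \<longrightarrow>
          decides_in_time P (encode q G L Q) (list_colorable G L)
            ((real q - \<epsilon>) ^ p * real (C * (n + 1) ^ d))))"
proof (intro allI impI)
  fix q \<delta> :: nat assume q: "3 \<le> q"
  let ?D = "max \<delta> 2"
  let ?B = "q ^ ?D - 1"
  \<comment> \<open>Depends on \<open>q\<close> and \<delta> only, as required; \<sigma> is
    introduced after it. It is positive since the root of \<open>q ^ D - 1\<close> is less than
    \<open>q\<close>.\<close>
  define \<epsilon> where "\<epsilon> = real q - root ?D (real ?B)"
  have "1 < q ^ ?D" using q by (intro one_less_power) auto
  then have B: "1 \<le> ?B" "real ?B < real q ^ ?D" by (auto simp: of_nat_diff)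
  have "root ?D (real ?B) < root ?D (real q ^ ?D)" using B(2) by (intro real_root_less_mono) auto
  also have "\<dots> = real q" by (intro real_root_power_cancel) auto
  finally have \<epsilon>: "0 < \<epsilon>" by (simp add: \<epsilon>_def)
  show "\<exists>\<epsilon>::real. \<epsilon> > 0 \<and>
     (\<forall>\<sigma>::nat. \<exists>(P::instr list) (C::nat) (d::nat).
        \<forall>(n::nat) (p::nat) (G::nat graph) (L::nat \<Rightarrow> nat set) (Q::nat set).
          list_coloring_instance q G L \<and> verts G = {0..<n} \<and> hub \<sigma> \<delta> G Q \<and> card Q = p \<longrightarrow>
          decides_in_time P (encode q G L Q) (list_colorable G L)
            ((real q - \<epsilon>) ^ p * real (C * (n + 1) ^ d)))"
  proof (intro exI[of _ \<epsilon>] conjI allI)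
    fix \<sigma> :: nat
    obtain C d where Cd: "\<And>n. time_poly q ?D (Suc \<sigma>) n \<le> C * (n + 1) ^ d"
      using poly_bounded_time_poly[of q ?D "Suc \<sigma>"] unfolding poly_bounded_def by blast
    have "decides_in_time (compile (mainC q ?D (Suc \<sigma>))) (encode q G L Q) (list_colorable G L)
        ((real q - \<epsilon>) ^ p * real (C * (n + 1) ^ d))"
      if "list_coloring_instance q G L \<and> verts G = {0..<n} \<and> hub \<sigma> \<delta> G Q \<and> card Q = p"
      for n p :: nat and G :: "nat graph" and L Q
    proof -
      interpret hub_instance q n \<sigma> \<delta> G L Q by unfold_locales (use that in auto)
      have p: "card Q = p" using that by simp
      have "real (time_poly q ?D (Suc \<sigma>) n * ?B ^ (card Q div ?D)) =
          real (?B ^ (p div ?D)) * real (time_poly q ?D (Suc \<sigma>) n)" by (simp add: p)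
      also have "\<dots> \<le> root ?D (real ?B) ^ p * real (C * (n + 1) ^ d)"
        using B(1) Cd[of n] power_div_le_root_power[of ?B ?D p]
        by (intro mult_mono) (auto simp del: of_nat_power of_nat_mult of_nat_add)
      finally show ?thesis using q by (intro mainC_decides) (auto simp: \<epsilon>_def)
    qed
    then show "\<exists>(P::instr list) (C::nat) (d::nat).
        \<forall>(n::nat) (p::nat) (G::nat graph) (L::nat \<Rightarrow> nat set) (Q::nat set).
          list_coloring_instance q G L \<and> verts G = {0..<n} \<and> hub \<sigma> \<delta> G Q \<and> card Q = p \<longrightarrow>
          decides_in_time P (encode q G L Q) (list_colorable G L)
            ((real q - \<epsilon>) ^ p * real (C * (n + 1) ^ d))" by blast
  qed (rule \<epsilon>)
qed

end
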